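(* Let $M$ be a smooth Riemannian manifold of dimension $2$ or $3$ and let $\Delta$ be a continuous corank-1 distribution on $M$. If $\Delta$ is asymptotically involutive, then $\Delta$ is integrable. If $\Delta$ is uniformly asymptotically involutive, then $\Delta$ is uniquely integrable.
   Context: A rank-$k$ distribution $\Delta$ on a manifold $M$ of dimension $n$ is a choice of a $k$-dimensional linear subspace $\Delta_p\subset T_pM$ for each $p\in M$; it has corank 1 if $k=n-1$. A (local) integral manifold of $\Delta$ is a submanifold $N\subset M$ with $T_pN=\Delta_p$ for every $p\in N$. $\Delta$ is integrable if there is a (local) integral manifold through every point of $M$, and uniquely integrable if moreover this integral manifold is unique as a local object (any two integral manifolds through the same point $p$ coincide in a neighbourhood of $p$). All notions are local: one works in a local chart, in which a continuous corank-1 distribution is written as $\Delta=\ker(\eta)$ for a continuous nowhere vanishing 1-form $\eta$. Norms $\|\cdot\|$ of forms are $C^0$ (supremum) norms induced by the Riemannian metric, and convergence of forms is in the $C^0$ topology. A continuous corank-1 distribution $\Delta=\ker(\eta)$ is asymptotically involutive if there is a sequence of $C^1$ differential 1-forms $\eta_k$ with $\eta_k\to\eta$ such that $\|\eta_k\wedge d\eta_k\|\,e^{\|d\eta_k\|}\to 0$ as $k\to\infty$. It is uniformly asymptotically involutive if there is such a sequence which moreover satisfies $\|\eta_k-\eta\|\,e^{\|d\eta_k\|}\to 0$ as $k\to\infty$. (In dimension 2 the first condition is automatically satisfied since $\eta_k\wedge d\eta_k=0$.) *)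

theory Defs
  imports "HOL-Analysis.Analysis"
begin

section \<open>Differentiability classes on open sets\<close>

text \<open>
  \<^term>\<open>C_k_on k S f\<close>: all iterated directional derivatives of \<open>f\<close> of order at most \<open>k\<close> exist (as
  Frechet derivatives) and are continuous.  On an open subset of a Euclidean space this is the
  usual class \<open>C\<^sup>k\<close>.
\<close>

primrec C_k_on ::
  "nat \<Rightarrow> 'a::real_normed_vector set \<Rightarrow> ('a \<Rightarrow> 'b::real_normed_vector) \<Rightarrow> bool" where
  "C_k_on 0 S f \<longleftrightarrow> continuous_on S f"
| "C_k_on (Suc k) S f \<longleftrightarrow>
     (\<forall>x\<in>S. f differentiable (at x)) \<and>
     (\<forall>v. C_k_on k S (\<lambda>x. frechet_derivative f (at x) v))"

definition smooth_on ::
  "'a::real_normed_vector set \<Rightarrow> ('a \<Rightarrow> 'b::real_normed_vector) \<Rightarrow> bool" where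
  "smooth_on S f \<longleftrightarrow> (\<forall>k. C_k_on k S f)"


section \<open>Smooth manifolds, tangent spaces, Riemannian metrics\<close>

text \<open>
  A chart is a pair of a domain and a coordinate map; values of the coordinate map outside the
  domain are irrelevant.  The dimension of the manifold is \<open>DIM('e)\<close>.  The manifold itself is the
  union of the chart domains, an open subset of the Hausdorff second countable space \<open>'m\<close>.
\<close>

type_synonym ('m, 'e) chart = "'m set \<times> ('m \<Rightarrow> 'e)"

abbreviation cdom :: "('m, 'e) chart \<Rightarrow> 'm set" where "cdom \<equiv> fst"
abbreviation cmap :: "('m, 'e) chart \<Rightarrow> 'm \<Rightarrow> 'e" where "cmap \<equiv> snd"

definition cimg :: "('m, 'e) chart \<Rightarrow> 'e set" where
  "cimg c = cmap c ` cdom c"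

definition cinv :: "('m, 'e) chart \<Rightarrow> 'e \<Rightarrow> 'm" where
  "cinv c = inv_into (cdom c) (cmap c)"

definition carrier_of :: "('m, 'e) chart set \<Rightarrow> 'm set" where
  "carrier_of A = (\<Union>c\<in>A. cdom c)"

definition smooth_atlas ::
  "('m::{t2_space,second_countable_topology}, 'e::euclidean_space) chart set \<Rightarrow> bool" where
  "smooth_atlas A \<longleftrightarrow>
     (\<forall>c\<in>A. open (cdom c) \<and> open (cimg c) \<and> homeomorphism (cdom c) (cimg c) (cmap c) (cinv c)) \<and>
     (\<forall>c\<in>A. \<forall>d\<in>A. smooth_on (cmap c ` (cdom c \<inter> cdom d)) (cmap d \<circ> cinv c))"

definition coord_change ::
  "('m, 'e::euclidean_space) chart \<Rightarrow> ('m, 'e) chart \<Rightarrow> 'm \<Rightarrow> 'e \<Rightarrow> 'e" where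
  "coord_change c d p = frechet_derivative (cmap d \<circ> cinv c) (at (cmap c p))"

text \<open>
  A tangent vector at \<open>p\<close> is the family of its coordinate vectors in all charts around \<open>p\<close>,
  subject to the transformation law; it is normalised to \<open>0\<close> on all other indices.
  For a chart \<open>c\<close> around \<open>p\<close>, the map \<open>v \<mapsto> v c\<close> identifies the tangent space with \<open>'e\<close>.
\<close>

type_synonym ('m, 'e) tvec = "('m, 'e) chart \<Rightarrow> 'e"

definition tangent_space ::
  "('m, 'e::euclidean_space) chart set \<Rightarrow> 'm \<Rightarrow> ('m, 'e) tvec set" where
  "tangent_space A p =
     {v. (\<forall>c\<in>A. \<forall>d\<in>A. p \<in> cdom c \<and> p \<in> cdom d \<longrightarrow> v d = coord_change c d p (v c)) \<and>
         (\<forall>c. \<not> (c \<in> A \<and> p \<in> cdom c) \<longrightarrow> v c = 0)}"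

definition riemannian_metric ::
  "('m, 'e::euclidean_space) chart set \<Rightarrow>
     ('m \<Rightarrow> ('m, 'e) tvec \<Rightarrow> ('m, 'e) tvec \<Rightarrow> real) \<Rightarrow> bool" where
  "riemannian_metric A g \<longleftrightarrow>
     (\<forall>c\<in>A. \<exists>G :: 'e \<Rightarrow> 'e \<Rightarrow> 'e \<Rightarrow> real.
        (\<forall>x\<in>cimg c. bilinear (G x) \<and> (\<forall>u w. G x u w = G x w u) \<and> (\<forall>u. u \<noteq> 0 \<longrightarrow> G x u u > 0)) \<and>
        (\<forall>u w. smooth_on (cimg c) (\<lambda>x. G x u w)) \<and>
        (\<forall>p\<in>cdom c. \<forall>v\<in>tangent_space A p. \<forall>w\<in>tangent_space A p.
            g p v w = G (cmap c p) (v c) (w c)))"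

definition riemannian_manifold ::
  "('m::{t2_space,second_countable_topology}, 'e::euclidean_space) chart set \<Rightarrow>
     ('m \<Rightarrow> ('m, 'e) tvec \<Rightarrow> ('m, 'e) tvec \<Rightarrow> real) \<Rightarrow> bool" where
  "riemannian_manifold A g \<longleftrightarrow> smooth_atlas A \<and> riemannian_metric A g"


section \<open>Distributions\<close>

definition in_chart :: "('m, 'e) chart \<Rightarrow> ('m, 'e) tvec set \<Rightarrow> 'e set" where
  "in_chart c E = (\<lambda>v. v c) ` E"

definition distribution ::
  "nat \<Rightarrow> ('m, 'e::euclidean_space) chart set \<Rightarrow> ('m \<Rightarrow> ('m, 'e) tvec set) \<Rightarrow> bool" where
  "distribution k A \<Delta> \<longleftrightarrow>
     (\<forall>p\<in>carrier_of A. \<Delta> p \<subseteq> tangent_space A p \<and>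
        (\<forall>c\<in>A. p \<in> cdom c \<longrightarrow> subspace (in_chart c (\<Delta> p)) \<and> dim (in_chart c (\<Delta> p)) = k))"

text \<open>A local chart around \<open>p\<close> is a chart \<open>c\<close> of the atlas restricted to the part corresponding to an
  open set \<open>V\<close> of its image.\<close>

definition local_chart ::
  "('m, 'e::euclidean_space) chart set \<Rightarrow> 'm \<Rightarrow> ('m, 'e) chart \<Rightarrow> 'e set \<Rightarrow> bool" where
  "local_chart A p c V \<longleftrightarrow>
     c \<in> A \<and> p \<in> cdom c \<and> open V \<and> V \<subseteq> cimg c \<and> cmap c p \<in> V"

text \<open>\<open>\<Delta> = ker \<eta>\<close> on \<open>V\<close>, with \<open>\<eta>\<close> a continuous nowhere vanishing 1-form written in the chart \<open>c\<close>.\<close>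

definition defining_form ::
  "('m \<Rightarrow> ('m, 'e::euclidean_space) tvec set) \<Rightarrow> ('m, 'e) chart \<Rightarrow> 'e set \<Rightarrow>
     ('e \<Rightarrow> 'e \<Rightarrow>\<^sub>L real) \<Rightarrow> bool" where
  "defining_form \<Delta> c V \<eta> \<longleftrightarrow>
     continuous_on V \<eta> \<and>
     (\<forall>x\<in>V. \<eta> x \<noteq> 0 \<and> in_chart c (\<Delta> (cinv c x)) = {u. blinfun_apply (\<eta> x) u = 0})"

definition continuous_corank1_distribution ::
  "('m, 'e::euclidean_space) chart set \<Rightarrow> ('m \<Rightarrow> ('m, 'e) tvec set) \<Rightarrow> bool" where
  "continuous_corank1_distribution A \<Delta> \<longleftrightarrow>
     distribution (DIM('e) - 1) A \<Delta> \<and>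
     (\<forall>p\<in>carrier_of A. \<exists>c V \<eta>. local_chart A p c V \<and> defining_form \<Delta> c V \<eta>)"


section \<open>Integral manifolds\<close>

text \<open>Embedded \<open>C\<^sup>1\<close> submanifolds, by slice charts.  (For a merely continuous distribution, integral
  manifolds are in general no smoother than \<open>C\<^sup>1\<close>.)\<close>

definition C1_submanifold ::
  "('m, 'e::euclidean_space) chart set \<Rightarrow> 'm set \<Rightarrow> bool" where
  "C1_submanifold A N \<longleftrightarrow>
     N \<subseteq> carrier_of A \<and>
     (\<forall>p\<in>N. \<exists>c V \<Phi> \<Psi> S. local_chart A p c V \<and>
        open (\<Phi> ` V) \<and> homeomorphism V (\<Phi> ` V) \<Phi> \<Psi> \<and> C_k_on 1 V \<Phi> \<and> C_k_on 1 (\<Phi> ` V) \<Psi> \<and>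
        subspace (S :: 'e set) \<and>
        \<Phi> ` (V \<inter> cmap c ` (N \<inter> cdom c)) = \<Phi> ` V \<inter> S)"

text \<open>\<open>T\<^sub>pN\<close> as the set of velocities at \<open>p\<close> of \<open>C\<^sup>1\<close> curves in \<open>N\<close>.\<close>

definition submanifold_tangent ::
  "('m, 'e::euclidean_space) chart set \<Rightarrow> 'm set \<Rightarrow> 'm \<Rightarrow> ('m, 'e) tvec set" where
  "submanifold_tangent A N p =
     {v \<in> tangent_space A p. \<exists>c\<in>A. \<exists>\<epsilon>>0. \<exists>\<gamma>.
        \<gamma> ` {-\<epsilon><..<\<epsilon>} \<subseteq> N \<inter> cdom c \<and> \<gamma> 0 = p \<and>
        C_k_on 1 {-\<epsilon><..<\<epsilon>} (cmap c \<circ> \<gamma>) \<and>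
        ((cmap c \<circ> \<gamma>) has_vector_derivative v c) (at (0::real))}"

definition integral_manifold ::
  "('m, 'e::euclidean_space) chart set \<Rightarrow> ('m \<Rightarrow> ('m, 'e) tvec set) \<Rightarrow> 'm set \<Rightarrow> bool" where
  "integral_manifold A \<Delta> N \<longleftrightarrow>
     C1_submanifold A N \<and> (\<forall>p\<in>N. submanifold_tangent A N p = \<Delta> p)"

definition integrable_distribution ::
  "('m, 'e::euclidean_space) chart set \<Rightarrow> ('m \<Rightarrow> ('m, 'e) tvec set) \<Rightarrow> bool" where
  "integrable_distribution A \<Delta> \<longleftrightarrow>
     (\<forall>p\<in>carrier_of A. \<exists>N. p \<in> N \<and> integral_manifold A \<Delta> N)"

definition uniquely_integrable_distribution ::
  "('m::topological_space, 'e::euclidean_space) chart set \<Rightarrow> ('m \<Rightarrow> ('m, 'e) tvec set) \<Rightarrow> bool" where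
  "uniquely_integrable_distribution A \<Delta> \<longleftrightarrow>
     integrable_distribution A \<Delta> \<and>
     (\<forall>p\<in>carrier_of A. \<forall>N\<^sub>1 N\<^sub>2.
        integral_manifold A \<Delta> N\<^sub>1 \<and> integral_manifold A \<Delta> N\<^sub>2 \<and> p \<in> N\<^sub>1 \<and> p \<in> N\<^sub>2 \<longrightarrow>
        (\<exists>W. open W \<and> p \<in> W \<and> N\<^sub>1 \<inter> W = N\<^sub>2 \<inter> W))"


section \<open>Differential forms in a chart and their norms\<close>

definition ext_deriv :: "('e::euclidean_space \<Rightarrow> 'e \<Rightarrow>\<^sub>L real) \<Rightarrow> 'e \<Rightarrow> 'e \<Rightarrow> 'e \<Rightarrow> real" where
  "ext_deriv \<eta> x u w =
     blinfun_apply (frechet_derivative \<eta> (at x) u) w - blinfun_apply (frechet_derivative \<eta> (at x) w) u"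

definition wedge_1_2 ::
  "('e::euclidean_space \<Rightarrow> 'e \<Rightarrow>\<^sub>L real) \<Rightarrow> ('e \<Rightarrow> 'e \<Rightarrow> 'e \<Rightarrow> real) \<Rightarrow>
     'e \<Rightarrow> 'e \<Rightarrow> 'e \<Rightarrow> 'e \<Rightarrow> real" where
  "wedge_1_2 \<alpha> \<omega> x u v w =
     blinfun_apply (\<alpha> x) u * \<omega> x v w + blinfun_apply (\<alpha> x) v * \<omega> x w u +
     blinfun_apply (\<alpha> x) w * \<omega> x u v"

text \<open>
  Pointwise norms of 1-, 2- and 3-forms: the supremum of the absolute value over vectors of
  Riemannian length at most one.  In dimension at most three all 2- and 3-forms are decomposable,
  so by Hadamard's inequality this is also the Euclidean norm induced by the metric on exterior
  powers.
\<close>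

definition unit_ball ::
  "('m, 'e::euclidean_space) chart set \<Rightarrow> ('m \<Rightarrow> ('m, 'e) tvec \<Rightarrow> ('m, 'e) tvec \<Rightarrow> real) \<Rightarrow>
     'm \<Rightarrow> ('m, 'e) tvec set" where
  "unit_ball A g p = {v \<in> tangent_space A p. g p v v \<le> 1}"

definition norm_1 ::
  "('m, 'e::euclidean_space) chart set \<Rightarrow> ('m \<Rightarrow> ('m, 'e) tvec \<Rightarrow> ('m, 'e) tvec \<Rightarrow> real) \<Rightarrow>
     ('m, 'e) chart \<Rightarrow> ('e \<Rightarrow> 'e \<Rightarrow>\<^sub>L real) \<Rightarrow> 'e \<Rightarrow> real" where
  "norm_1 A g c \<alpha> x = (SUP v \<in> unit_ball A g (cinv c x). \<bar>blinfun_apply (\<alpha> x) (v c)\<bar>)"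

definition norm_2 ::
  "('m, 'e::euclidean_space) chart set \<Rightarrow> ('m \<Rightarrow> ('m, 'e) tvec \<Rightarrow> ('m, 'e) tvec \<Rightarrow> real) \<Rightarrow>
     ('m, 'e) chart \<Rightarrow> ('e \<Rightarrow> 'e \<Rightarrow> 'e \<Rightarrow> real) \<Rightarrow> 'e \<Rightarrow> real" where
  "norm_2 A g c \<omega> x =
     (SUP (u, v) \<in> unit_ball A g (cinv c x) \<times> unit_ball A g (cinv c x). \<bar>\<omega> x (u c) (v c)\<bar>)"

definition norm_3 ::
  "('m, 'e::euclidean_space) chart set \<Rightarrow> ('m \<Rightarrow> ('m, 'e) tvec \<Rightarrow> ('m, 'e) tvec \<Rightarrow> real) \<Rightarrow>
     ('m, 'e) chart \<Rightarrow> ('e \<Rightarrow> 'e \<Rightarrow> 'e \<Rightarrow> 'e \<Rightarrow> real) \<Rightarrow> 'e \<Rightarrow> real" where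
  "norm_3 A g c \<omega> x =
     (SUP (u, v, w) \<in> unit_ball A g (cinv c x) \<times> unit_ball A g (cinv c x) \<times> unit_ball A g (cinv c x).
        \<bar>\<omega> x (u c) (v c) (w c)\<bar>)"

text \<open>The \<open>C\<^sup>0\<close> norm over \<open>V\<close> of a form with pointwise norm \<open>f\<close>; it is meaningful only together with
  finiteness, since the supremum of an unbounded set of reals is unspecified.\<close>

definition C0_finite :: "'e set \<Rightarrow> ('e \<Rightarrow> real) \<Rightarrow> bool" where
  "C0_finite V f \<longleftrightarrow> bdd_above (f ` V)"

definition C0_norm :: "'e set \<Rightarrow> ('e \<Rightarrow> real) \<Rightarrow> real" where
  "C0_norm V f = (SUP x\<in>V. f x)"


section \<open>Asymptotic involutivity\<close>

definition involutive_approximation ::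
  "('m, 'e::euclidean_space) chart set \<Rightarrow> ('m \<Rightarrow> ('m, 'e) tvec \<Rightarrow> ('m, 'e) tvec \<Rightarrow> real) \<Rightarrow>
     ('m, 'e) chart \<Rightarrow> 'e set \<Rightarrow> ('e \<Rightarrow> 'e \<Rightarrow>\<^sub>L real) \<Rightarrow> (nat \<Rightarrow> 'e \<Rightarrow> 'e \<Rightarrow>\<^sub>L real) \<Rightarrow> bool" where
  "involutive_approximation A g c V \<eta> \<eta>s \<longleftrightarrow>
     (\<forall>k. C_k_on 1 V (\<eta>s k) \<and>
          C0_finite V (norm_1 A g c (\<lambda>x. \<eta>s k x - \<eta> x)) \<and>
          C0_finite V (norm_2 A g c (ext_deriv (\<eta>s k))) \<and>
          C0_finite V (norm_3 A g c (wedge_1_2 (\<eta>s k) (ext_deriv (\<eta>s k))))) \<and>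
     (\<lambda>k. C0_norm V (norm_1 A g c (\<lambda>x. \<eta>s k x - \<eta> x))) \<longlonglongrightarrow> 0 \<and>
     (\<lambda>k. C0_norm V (norm_3 A g c (wedge_1_2 (\<eta>s k) (ext_deriv (\<eta>s k)))) *
           exp (C0_norm V (norm_2 A g c (ext_deriv (\<eta>s k))))) \<longlonglongrightarrow> 0"

text \<open>Both notions are local: \<open>\<Delta>\<close> is written as the kernel of a form, and approximated, in some
  local chart around every point.\<close>

definition asymptotically_involutive ::
  "('m, 'e::euclidean_space) chart set \<Rightarrow> ('m \<Rightarrow> ('m, 'e) tvec \<Rightarrow> ('m, 'e) tvec \<Rightarrow> real) \<Rightarrow>
     ('m \<Rightarrow> ('m, 'e) tvec set) \<Rightarrow> bool" where
  "asymptotically_involutive A g \<Delta> \<longleftrightarrow>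
     (\<forall>p\<in>carrier_of A. \<exists>c V \<eta> \<eta>s.
        local_chart A p c V \<and> defining_form \<Delta> c V \<eta> \<and> involutive_approximation A g c V \<eta> \<eta>s)"

definition uniformly_asymptotically_involutive ::
  "('m, 'e::euclidean_space) chart set \<Rightarrow> ('m \<Rightarrow> ('m, 'e) tvec \<Rightarrow> ('m, 'e) tvec \<Rightarrow> real) \<Rightarrow>
     ('m \<Rightarrow> ('m, 'e) tvec set) \<Rightarrow> bool" where
  "uniformly_asymptotically_involutive A g \<Delta> \<longleftrightarrow>
     (\<forall>p\<in>carrier_of A. \<exists>c V \<eta> \<eta>s.
        local_chart A p c V \<and> defining_form \<Delta> c V \<eta> \<and> involutive_approximation A g c V \<eta> \<eta>s \<and>
        (\<lambda>k. C0_norm V (norm_1 A g c (\<lambda>x. \<eta>s k x - \<eta> x)) *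
              exp (C0_norm V (norm_2 A g c (ext_deriv (\<eta>s k))))) \<longlonglongrightarrow> 0)"

end

theory Submission
  imports Defs "HOL-Complex_Analysis.Great_Picard"
begin

text \<open>
  Near a point \<open>x0\<close> write the distribution in a chart as the kernel of \<open>\<eta>\<close> and choose \<open>e\<close> with
  \<open>\<eta> x0 e = 1\<close>.  An integral manifold through \<open>x0\<close> is then locally a graph \<open>h \<mapsto> x0 + h + u h *\<^sub>R e\<close>, where
  \<open>u\<close> solves the total differential equation that prescribes its derivative as \<open>- \<eta> h / \<eta> e\<close>, evaluated
  at the point of the graph (\<open>slope\<close>).

  Existence.  For a \<open>C\<^sup>1\<close> form \<open>\<alpha>\<close> the equation can be solved along every ray from the origin, which is an
  ordinary differential equation (\<open>radial_ode_exists\<close>); across the rays it holds only up to an error.  Let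
  \<open>\<gamma>\<close> and \<open>\<gamma>'\<close> be the lifts of two neighbouring rays and \<open>D = \<gamma>' - \<gamma>\<close>.  Because \<open>\<alpha>\<close> annihilates the
  velocity \<open>v\<close> of \<open>\<gamma>\<close>, evaluating \<open>\<alpha> \<and> d\<alpha>\<close> on \<open>(D, v, e)\<close> gives
  \<open>\<alpha> e * d\<alpha> v D = \<alpha> D * d\<alpha> v e - (\<alpha> \<and> d\<alpha>) D v e\<close>, and \<open>d\<alpha> v D\<close> is, up to terms of higher order in \<open>D\<close>, the
  derivative of \<open>\<alpha> D\<close> along the ray.  So the error \<open>\<alpha> D\<close> satisfies a linear differential inequality with
  rate proportional to \<open>d\<alpha>\<close> and source proportional to \<open>\<alpha> \<and> d\<alpha>\<close>, and by Gronwall it is at most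
  \<open>\<bar>\<alpha> \<and> d\<alpha>\<bar> exp \<bar>d\<alpha>\<bar>\<close> per unit of distance (\<open>approximate_leaf\<close>); the constants in the exponent are absorbed by
  taking the rays short.  Comparing neighbouring rays by finite differences avoids differentiating solutions
  with respect to initial values.  For the forms \<open>\<eta>s k\<close> these errors tend to zero, so the functions
  obtained are equi-Lipschitz, and a uniform limit of a subsequence solves the equation exactly
  (\<open>uniform_limit_of_approximate_leaves\<close>, \<open>leaf_exists\<close>).

  Uniqueness.  Two curves tangent to the kernel of \<open>\<eta>\<close> with the same projection along \<open>e\<close> bound a thin strip.
  By Stokes' theorem on the strip, the integral of \<open>\<eta>s k\<close> over the segment joining the two curves at time
  \<open>t\<close> is controlled by the integral of \<open>d(\<eta>s k)\<close> over the strip and by the integrals of \<open>\<eta>s k - \<eta>\<close> along the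
  curves.  Gronwall bounds the width of the strip by \<open>\<bar>\<eta>s k - \<eta>\<bar> exp \<bar>d(\<eta>s k)\<bar>\<close>, which tends to zero
  (\<open>thin_region_bound\<close>, \<open>integral_curves_coincide\<close>).  Hence every integral manifold through the point lies
  in the leaf constructed before, and since both have the same dimension, invariance of domain shows
  that it fills a neighbourhood of the point in the leaf (\<open>slice_equals_leaf\<close>).
\<close>

section \<open>Growth estimates and maps of class \<open>C\<^sup>1\<close>\<close>

text \<open>
  The differential inequality controls \<open>sqrt (w\<^sup>2 + e\<^sup>2)\<close>, which is differentiable even where \<open>w\<close> vanishes;
  multiplied by the integrating factor and corrected by a linear term it decreases, and \<open>e\<close> tends to \<open>0\<close>.
\<close>
lemma gronwall_unit:
  fixes w w' :: "real \<Rightarrow> real"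
  assumes der: "\<And>t. t \<in> {0..1} \<Longrightarrow> (w has_real_derivative w' t) (at t within {0..1})"
    and w0: "w 0 = 0"
    and bound: "\<And>t. t \<in> {0..1} \<Longrightarrow> \<bar>w' t\<bar> \<le> A * \<bar>w t\<bar> + B"
    and A: "0 \<le> A" and B: "0 \<le> B"
  shows "\<bar>w 1\<bar> \<le> B * exp A"
proof -
  have *: "\<bar>w 1\<bar> \<le> exp A * (B + e)" if e: "e > 0" for e
  proof -
    \<comment> \<open>A smooth substitute for the absolute value of w.\<close>
    define \<phi> where "\<phi> t = sqrt ((w t)\<^sup>2 + e\<^sup>2)" for t
    define h where "h t = exp (- A * t) * \<phi> t - B * t" for t
    have pos: "(w t)\<^sup>2 + e\<^sup>2 > 0" for t using e by (simp add: add_nonneg_pos)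
    have \<phi>pos: "\<phi> t > 0" for t unfolding \<phi>_def using pos by simp
    have w\<phi>: "\<bar>w t\<bar> \<le> \<phi> t" for t unfolding \<phi>_def by (rule real_le_rsqrt) simp
    have contw: "continuous_on {0..1} w"
      using der by (meson DERIV_continuous continuous_on_eq_continuous_within)
    have "h 1 \<le> h 0"
    proof (rule DERIV_nonpos_imp_decreasing_open[of 0 1])
      fix t :: real assume t: "0 < t" "t < 1"
      then have d: "(w has_real_derivative w' t) (at t)"
        using der[of t] at_within_interior[of t "{0..1}"] by simp
      define D where "D = exp (- A * t) * (- A) * \<phi> t + exp (- A * t) * (w t * w' t / \<phi> t) - B"
      have "(\<phi> has_real_derivative (w t * w' t / \<phi> t)) (at t)"
        unfolding \<phi>_def using pos[of t]
        by (auto intro!: derivative_eq_intros d simp: field_simps)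
      then have "(h has_real_derivative D) (at t)"
        unfolding h_def D_def by (auto intro!: derivative_eq_intros)
      moreover have "D \<le> 0"
      proof -
        have "w t * w' t \<le> \<phi> t * (A * \<phi> t + B)"
        proof -
          have "w t * w' t \<le> \<bar>w t\<bar> * \<bar>w' t\<bar>" by (metis abs_ge_self abs_mult)
          also have "\<dots> \<le> \<phi> t * \<bar>w' t\<bar>" using w\<phi> by (intro mult_right_mono) auto
          also have "\<bar>w' t\<bar> \<le> A * \<bar>w t\<bar> + B" using bound t by simp
          also have "\<dots> \<le> A * \<phi> t + B" using w\<phi> A by (simp add: mult_left_mono)
          finally show ?thesis using \<phi>pos[of t] by (simp add: mult_left_mono)
        qed
        then have "w t * w' t / \<phi> t \<le> A * \<phi> t + B"
          using \<phi>pos[of t] by (simp add: field_simps)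
        then have "exp (- A * t) * (w t * w' t / \<phi> t) \<le> exp (- A * t) * (A * \<phi> t + B)"
          by (intro mult_left_mono) auto
        moreover have "exp (- A * t) * B \<le> B"
          using t A B by (simp add: mult_left_le_one_le)
        ultimately show ?thesis unfolding D_def by (simp add: algebra_simps)
      qed
      ultimately show "\<exists>y. (h has_real_derivative y) (at t) \<and> y \<le> 0" by blast
    next
      show "continuous_on {0..1} h"
        unfolding h_def \<phi>_def by (intro continuous_intros contw)
    qed simp
    then have "exp (- A) * \<phi> 1 \<le> B + e"
      unfolding h_def \<phi>_def using w0 e by simp
    then have "exp A * (exp (- A) * \<phi> 1) \<le> exp A * (B + e)" by (intro mult_left_mono) auto
    moreover have "exp A * (exp (- A) * \<phi> 1) = \<phi> 1" by (simp add: exp_minus)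
    ultimately have "\<phi> 1 \<le> exp A * (B + e)" by simp
    with w\<phi>[of 1] show ?thesis by linarith
  qed
  have "((\<lambda>e. exp A * (B + e)) \<longlongrightarrow> exp A * (B + 0)) (at_right 0)"
    by (intro tendsto_intros)
  moreover have "\<forall>\<^sub>F e in at_right (0::real). \<bar>w 1\<bar> \<le> exp A * (B + e)"
    using * by (auto simp: eventually_at_right_field intro: exI[of _ 1])
  ultimately have "\<bar>w 1\<bar> \<le> exp A * (B + 0)"
    by (intro tendsto_lowerbound) auto
  then show ?thesis by (simp add: mult.commute)
qed

text \<open>
  A mean value inequality for functions that are not assumed differentiable: along a segment the local
  estimates at single points add up, by bisection.
\<close>
lemma lipschitz_from_pointwise:
  fixes f :: "'a::real_normed_vector \<Rightarrow> 'b::real_normed_vector"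
  assumes C: "convex C"
    and loc: "\<And>x. x \<in> C \<Longrightarrow> \<exists>\<rho>>0. \<forall>y\<in>C. norm (y - x) < \<rho> \<longrightarrow> norm (f y - f x) \<le> B * norm (y - x)"
    and x: "x \<in> C" and y: "y \<in> C"
  shows "norm (f y - f x) \<le> B * norm (y - x)"
proof (cases "x = y")
  case False
  define p where "p t = x + t *\<^sub>R (y - x)" for t :: real
  have pC: "p t \<in> C" if "0 \<le> t" "t \<le> 1" for t
  proof -
    have "p t = (1 - t) *\<^sub>R x + t *\<^sub>R y" by (simp add: p_def algebra_simps)
    with C x y that show ?thesis by (simp add: convexD_alt)
  qed
  have pd: "p t - p s = (t - s) *\<^sub>R (y - x)" for s t by (simp add: p_def algebra_simps)
  have "0 \<le> (0::real) \<and> (1::real) \<le> 1 \<longrightarrow> norm (f (p 1) - f (p 0)) \<le> B * ((1 - 0) * norm (y - x))"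
    using zero_le_one
  proof (induct rule: Bolzano[where P = "\<lambda>s t. 0 \<le> s \<and> t \<le> 1 \<longrightarrow> norm (f (p t) - f (p s)) \<le> B * ((t - s) * norm (y - x))"])
    case (trans a b c)
    show ?case
    proof
      assume "0 \<le> a \<and> c \<le> 1"
      then have "norm (f (p b) - f (p a)) \<le> B * ((b - a) * norm (y - x))"
        "norm (f (p c) - f (p b)) \<le> B * ((c - b) * norm (y - x))" using trans by auto
      then have "norm ((f (p b) - f (p a)) + (f (p c) - f (p b)))
          \<le> B * ((b - a) * norm (y - x)) + B * ((c - b) * norm (y - x))"
        by (meson add_mono norm_triangle_le)
      then show "norm (f (p c) - f (p a)) \<le> B * ((c - a) * norm (y - x))"
        by (simp add: algebra_simps)
    qed
  next
    case (local t)
    obtain \<rho> where \<rho>: "\<rho> > 0" "\<And>z. z \<in> C \<Longrightarrow> norm (z - p t) < \<rho> \<Longrightarrow> norm (f z - f (p t)) \<le> B * norm (z - p t)"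
      using loc[OF pC[OF local]] by blast
    have n: "norm (y - x) > 0" using False by simp
    show ?case
    proof (intro exI[of _ "\<rho> / norm (y - x)"] conjI allI impI)
      show "0 < \<rho> / norm (y - x)" using \<rho> n by simp
    next
      fix a b assume ab: "a \<le> t \<and> t \<le> b \<and> b - a < \<rho> / norm (y - x)" and "0 \<le> a \<and> b \<le> 1"
      have lt: "(b - a) * norm (y - x) < \<rho>" using ab n by (simp add: field_simps)
      have l1: "(b - t) * norm (y - x) < \<rho>" "(t - a) * norm (y - x) < \<rho>"
        using lt ab n by (smt (verit) mult_right_mono)+
      have "norm (p b - p t) = (b - t) * norm (y - x)" "norm (p a - p t) = (t - a) * norm (y - x)"
        using ab by (auto simp: pd)
      then have "norm (f (p b) - f (p t)) \<le> B * ((b - t) * norm (y - x))"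
        "norm (f (p a) - f (p t)) \<le> B * ((t - a) * norm (y - x))"
        using \<rho>(2)[of "p b"] \<rho>(2)[of "p a"] pC l1 ab \<open>0 \<le> a \<and> b \<le> 1\<close> by auto
      then have "norm ((f (p b) - f (p t)) - (f (p a) - f (p t)))
          \<le> B * ((b - t) * norm (y - x)) + B * ((t - a) * norm (y - x))"
        by (meson add_mono norm_triangle_le_diff)
      then show "norm (f (p b) - f (p a)) \<le> B * ((b - a) * norm (y - x))"
        by (simp add: algebra_simps)
    qed
  qed
  then show ?thesis by (simp add: p_def)
qed simp

text \<open>
  In finite dimensions continuity of all directional derivatives is continuity of the derivative in the
  operator norm, which is the form used for compactness and composition arguments.
\<close>
lemma C_1_on_iff:
  fixes f :: "'a::euclidean_space \<Rightarrow> 'b::real_normed_vector"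
  assumes "open V"
  shows "C_k_on 1 V f \<longleftrightarrow>
    (\<exists>f'. (\<forall>x\<in>V. (f has_derivative blinfun_apply (f' x)) (at x)) \<and> continuous_on V f')"
proof
  assume C: "C_k_on 1 V f"
  define f' where "f' x = Blinfun (frechet_derivative f (at x))" for x
  have d: "f differentiable (at x)" if "x \<in> V" for x using C that by simp
  have ap: "blinfun_apply (f' x) = frechet_derivative f (at x)" if "x \<in> V" for x
    unfolding f'_def
    by (rule bounded_linear_Blinfun_apply[OF has_derivative_bounded_linear[OF
          d[OF that, unfolded frechet_derivative_works]]])
  have "continuous_on V f'"
  proof (rule continuous_on_blinfun_componentwise)
    fix i :: 'a
    have "continuous_on V (\<lambda>x. frechet_derivative f (at x) i)" using C by simp
    then show "continuous_on V (\<lambda>x. blinfun_apply (f' x) i)"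
      by (subst continuous_on_cong[OF refl]) (auto simp: ap)
  qed
  then show "\<exists>f'. (\<forall>x\<in>V. (f has_derivative blinfun_apply (f' x)) (at x)) \<and> continuous_on V f'"
    using ap d frechet_derivative_works by (intro exI[of _ f']) auto
next
  assume "\<exists>f'. (\<forall>x\<in>V. (f has_derivative blinfun_apply (f' x)) (at x)) \<and> continuous_on V f'"
  then obtain f' where f': "\<And>x. x \<in> V \<Longrightarrow> (f has_derivative blinfun_apply (f' x)) (at x)"
    "continuous_on V f'" by blast
  have "continuous_on V (\<lambda>x. frechet_derivative f (at x) v)" for v
  proof -
    have "continuous_on V (\<lambda>x. blinfun_apply (f' x) v)"
      by (intro continuous_intros f'(2))
    then show ?thesis
      by (rule continuous_on_cong[OF refl, THEN iffD1, rotated])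
        (use f' frechet_derivative_at in \<open>metis\<close>)
  qed
  then show "C_k_on 1 V f" using f' by (auto simp: differentiable_def)
qed

lemma C_1_onI:
  assumes "\<And>x. x \<in> V \<Longrightarrow> (f has_derivative f' x) (at x)" "\<And>v. continuous_on V (\<lambda>x. f' x v)"
  shows "C_k_on 1 V f"
proof -
  have eq: "frechet_derivative f (at x) = f' x" if "x \<in> V" for x
    using frechet_derivative_at[OF assms(1)[OF that]] by simp
  have "continuous_on V (\<lambda>x. frechet_derivative f (at x) v)" for v
    by (subst continuous_on_cong[OF refl, where g = "\<lambda>x. f' x v"]) (simp_all add: eq assms(2))
  then show ?thesis using assms(1) by (auto simp: differentiable_def)
qed

lemma C_1_on_compose:
  fixes f :: "'a::euclidean_space \<Rightarrow> 'b::euclidean_space" and g :: "'b \<Rightarrow> 'c::real_normed_vector"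
  assumes "open V" "open W" "C_k_on 1 V f" "C_k_on 1 W g" "f ` V \<subseteq> W"
  shows "C_k_on 1 V (g \<circ> f)"
proof -
  obtain f' where f': "\<And>x. x \<in> V \<Longrightarrow> (f has_derivative blinfun_apply (f' x)) (at x)"
    "continuous_on V f'" using assms C_1_on_iff by metis
  obtain g' where g': "\<And>x. x \<in> W \<Longrightarrow> (g has_derivative blinfun_apply (g' x)) (at x)"
    "continuous_on W g'" using assms C_1_on_iff by metis
  have cf: "continuous_on V f"
    by (rule has_derivative_continuous_on[OF has_derivative_at_withinI[OF f'(1)]])
  have "(g \<circ> f has_derivative blinfun_apply (g' (f x) o\<^sub>L f' x)) (at x)" if "x \<in> V" for x
    using diff_chain_at[OF f'(1)[OF that] g'(1)] assms that by (auto simp: o_def blinfun_compose.rep_eq)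
  moreover have "continuous_on V (\<lambda>x. g' (f x) o\<^sub>L f' x)"
    by (intro bounded_bilinear.continuous_on[OF bounded_bilinear_blinfun_compose] f'(2)
        continuous_on_compose2[OF g'(2) cf] assms(5))
  ultimately show ?thesis
    by (intro C_1_on_iff[OF \<open>open V\<close>, THEN iffD2] exI[of _ "\<lambda>x. g' (f x) o\<^sub>L f' x"]) simp
qed

lemma C_1_on_subset: "C_k_on 1 V f \<Longrightarrow> U \<subseteq> V \<Longrightarrow> C_k_on 1 U f"
  by (auto intro: continuous_on_subset)

lemma C_1_on_cong:
  assumes "open V" "C_k_on 1 V f" "\<And>x. x \<in> V \<Longrightarrow> f x = g x"
  shows "C_k_on 1 V g"
proof -
  have t: "(f has_derivative D) (at x) \<longleftrightarrow> (g has_derivative D) (at x)" if "x \<in> V" for x D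
    using assms that by (metis has_derivative_transform_within_open)
  then have "frechet_derivative f (at x) = frechet_derivative g (at x)" if "x \<in> V" for x
    unfolding frechet_derivative_def using that by simp
  then show ?thesis using assms(2) t unfolding One_nat_def C_k_on.simps differentiable_def
    by (metis (mono_tags, lifting) continuous_on_cong)
qed

text \<open>
  Uniform continuity of the derivative on a compact set makes the remainder of the linear approximation
  uniformly small.
\<close>
lemma uniformly_differentiable:
  fixes f :: "'a::real_normed_vector \<Rightarrow> 'b::real_normed_vector"
  assumes K: "compact K" "convex K"
    and der: "\<And>y. y \<in> K \<Longrightarrow> (f has_derivative blinfun_apply (f' y)) (at y)"
    and cont: "continuous_on K f'" and \<tau>: "0 < \<tau>"
  obtains \<delta> where "\<delta> > 0"
    "\<And>y z. y \<in> K \<Longrightarrow> z \<in> K \<Longrightarrow> norm (z - y) < \<delta> \<Longrightarrow> norm (f z - f y - f' y (z - y)) \<le> \<tau> * norm (z - y)"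
proof -
  have "uniformly_continuous_on K f'" using K cont by (intro compact_uniformly_continuous)
  then obtain \<delta> where \<delta>: "\<delta> > 0" "\<And>y z. y \<in> K \<Longrightarrow> z \<in> K \<Longrightarrow> dist z y < \<delta> \<Longrightarrow> dist (f' z) (f' y) < \<tau>"
    unfolding uniformly_continuous_on_def using \<tau> by metis
  show thesis
  proof (rule that[OF \<delta>(1)])
    fix y z assume yz: "y \<in> K" "z \<in> K" "norm (z - y) < \<delta>"
    define S where "S = K \<inter> ball y \<delta>"
    have S: "convex S" "y \<in> S" "z \<in> S" unfolding S_def using K yz \<delta>(1)
      by (auto simp: convex_Int dist_norm norm_minus_commute)
    have "norm (f z - f y - f' y (z - y)) \<le> norm (z - y) * \<tau>"
    proof (rule differentiable_bound_linearization[where S = S and f' = "\<lambda>y. blinfun_apply (f' y)" and ?x0.0 = y])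
      fix t :: real assume "t \<in> {0..1}"
      then show "y + t *\<^sub>R (z - y) \<in> S"
        using convexD_alt[OF S(1) S(2) S(3), of t] by (simp add: algebra_simps)
    next
      fix x assume "x \<in> S"
      then show "(f has_derivative blinfun_apply (f' x)) (at x within S)"
        using der by (auto simp: S_def intro: has_derivative_at_withinI)
      have "dist x y < \<delta>" using \<open>x \<in> S\<close> by (simp add: S_def dist_commute)
      then have "norm (f' x - f' y) \<le> \<tau>" using \<delta>(2)[of y x] yz \<open>x \<in> S\<close> by (simp add: S_def dist_norm)
      then show "onorm (blinfun_apply (f' x) - blinfun_apply (f' y)) \<le> \<tau>"
        by (simp add: norm_blinfun.rep_eq minus_blinfun.rep_eq fun_diff_def)
    qed (use S in auto)
    then show "norm (f z - f y - f' y (z - y)) \<le> \<tau> * norm (z - y)" by (simp add: mult.commute)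
  qed
qed

section \<open>An ordinary differential equation along rays\<close>

text \<open>
  The substitution that turns an integral over the unit interval along the ray to \<open>t x\<close> into an integral
  up to time \<open>t\<close> along the ray to \<open>x\<close>.
\<close>
lemma radial_integral_deriv:
  fixes g :: "real \<Rightarrow> real"
  assumes g: "continuous_on {0..1} g" and t: "t \<in> {0..1}"
  shows "integral {0..1} (\<lambda>s. t * g (s * t)) = integral {0..t} g"
proof -
  define W where "W t = integral {0..t} g" for t
  have W: "(W has_real_derivative g s) (at s within {0..1})" if "s \<in> {0..1}" for s
    unfolding W_def using g that by (rule integral_has_real_derivative)
  have "((\<lambda>s. t * g (s * t)) has_integral (W (1 * t) - W (0 * t))) {0..1}"
  proof (rule fundamental_theorem_of_calculus)
    fix s :: real assume s: "s \<in> {0..1}"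
    have im: "(\<lambda>s. s * t) ` {0..1} \<subseteq> {0..1}" using t by (auto simp: mult_le_one)
    have "((W \<circ> (\<lambda>s. s * t)) has_real_derivative g (s * t) * t) (at s within {0..1})"
    proof (rule DERIV_image_chain)
      show "(W has_real_derivative g (s * t)) (at (s * t) within (\<lambda>s. s * t) ` {0..1})"
        using W[of "s * t"] s im by (meson has_field_derivative_subset image_subset_iff)
      show "((\<lambda>s. s * t) has_real_derivative t) (at s within {0..1})"
        by (auto intro!: derivative_eq_intros)
    qed
    then show "((\<lambda>s. W (s * t)) has_vector_derivative t * g (s * t)) (at s within {0..1})"
      by (simp add: o_def has_real_derivative_iff_has_vector_derivative mult.commute)
  qed simp
  then have "integral {0..1} (\<lambda>s. t * g (s * t)) = W (1 * t) - W (0 * t)" by (rule integral_unique)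
  also have "\<dots> = integral {0..t} g" by (simp add: W_def)
  finally show ?thesis .
qed

text \<open>
  The equations along all rays are solved at once, as a fixed point of one integral operator acting on
  functions of \<open>x\<close>: the point \<open>t x\<close> lies on the same ray as \<open>x\<close>, so a single function \<open>u\<close> records every
  solution at every time, and its continuity in the ray comes for free.  Picard iteration
  converges on the whole ball because the iterates never leave the region \<open>\<bar>z\<bar> \<le> m * norm x\<close>.
\<close>
lemma radial_ode_exists:
  fixes F :: "'a::euclidean_space \<Rightarrow> real \<Rightarrow> 'a \<Rightarrow>\<^sub>L real"
  assumes r: "0 < r" and m: "0 \<le> m" "m * r \<le> b" and L: "0 \<le> L"
    and cont: "continuous_on (cball 0 r \<times> {-b..b}) (\<lambda>(x, z). F x z)"
    and bnd: "\<And>x z. norm x \<le> r \<Longrightarrow> \<bar>z\<bar> \<le> b \<Longrightarrow> norm (F x z) \<le> m"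
    and lip: "\<And>x z z'. norm x \<le> r \<Longrightarrow> \<bar>z\<bar> \<le> b \<Longrightarrow> \<bar>z'\<bar> \<le> b \<Longrightarrow>
                norm (F x z - F x z') \<le> L * \<bar>z - z'\<bar>"
  obtains u where "continuous_on (cball 0 r) u" "\<And>x. norm x \<le> r \<Longrightarrow> \<bar>u x\<bar> \<le> m * norm x"
    "\<And>x t. norm x \<le> r \<Longrightarrow> t \<in> {0..1} \<Longrightarrow>
       ((\<lambda>t. u (t *\<^sub>R x)) has_real_derivative F (t *\<^sub>R x) (u (t *\<^sub>R x)) x) (at t within {0..1})"
proof -
  define T where "T v x = integral {0..1} (\<lambda>s. F (s *\<^sub>R x) (v (s *\<^sub>R x)) x)" for v :: "'a \<Rightarrow> real" and x
  define Adm where "Adm v \<longleftrightarrow> continuous_on (cball 0 r) v \<and> (\<forall>x. norm x \<le> r \<longrightarrow> \<bar>v x\<bar> \<le> m * norm x)"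
    for v :: "'a \<Rightarrow> real"
  have sc: "norm (s *\<^sub>R x) \<le> r" if "norm x \<le> r" "s \<in> {0..1}" for s and x :: 'a
    using that mult_le_cancel_right1[of "norm x" s] by (auto simp: mult_left_le_one_le intro: order_trans[rotated])
  have Ab: "\<bar>v x\<bar> \<le> b" if "Adm v" "norm x \<le> r" for v x
    using that m r unfolding Adm_def by (meson mult_left_mono order_trans)
  have cI: "continuous_on (cball 0 r \<times> {0..1}) (\<lambda>(x, s). F (s *\<^sub>R x) (v (s *\<^sub>R x)) x)" if v: "Adm v" for v :: "'a \<Rightarrow> real"
  proof -
    have cv: "continuous_on (cball 0 r) v" using v by (simp add: Adm_def)
    have "continuous_on (cball 0 r \<times> {0..1}) (\<lambda>p. v (snd p *\<^sub>R fst p))"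
      by (rule continuous_on_compose2[OF cv]) (use sc in \<open>auto intro!: continuous_intros simp del: norm_scaleR\<close>)
    then have "continuous_on (cball 0 r \<times> {0..1}) (\<lambda>p. (snd p *\<^sub>R fst p, v (snd p *\<^sub>R fst p)))"
      by (intro continuous_intros)
    then have "continuous_on (cball 0 r \<times> {0..1}) (\<lambda>p. (\<lambda>(x, z). F x z) (snd p *\<^sub>R fst p, v (snd p *\<^sub>R fst p)))"
    proof (rule continuous_on_compose2[OF cont], clarify)
      fix x :: 'a and s :: real assume "x \<in> cball 0 r" "s \<in> {0..1}"
      then have "norm (s *\<^sub>R x) \<le> r" by (intro sc) auto
      moreover from this have "\<bar>v (s *\<^sub>R x)\<bar> \<le> b" by (rule Ab[OF v])
      ultimately show "snd (x, s) *\<^sub>R fst (x, s) \<in> cball 0 r \<and> v (snd (x, s) *\<^sub>R fst (x, s)) \<in> {-b..b}"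
        by (simp add: abs_le_iff del: norm_scaleR)
    qed
    then have "continuous_on (cball 0 r \<times> {0..1}) (\<lambda>p. F (snd p *\<^sub>R fst p) (v (snd p *\<^sub>R fst p)) (fst p))"
      by (auto intro!: continuous_intros)
    then show ?thesis by (simp add: case_prod_beta)
  qed
  have cx: "continuous_on {0..1} (\<lambda>s. F (s *\<^sub>R x) (v (s *\<^sub>R x)) x)" if "Adm v" "norm x \<le> r" for v :: "'a \<Rightarrow> real" and x
  proof -
    have "continuous_on {0..1} (\<lambda>s. (\<lambda>(x, s). F (s *\<^sub>R x) (v (s *\<^sub>R x)) x) (x, s))"
      by (rule continuous_on_compose2[OF cI[OF that(1)]])
        (use that(2) in \<open>auto intro: continuous_on_Pair continuous_on_const continuous_on_id\<close>)
    then show ?thesis by simp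
  qed
  have ix: "(\<lambda>s. F (s *\<^sub>R x) (v (s *\<^sub>R x)) x) integrable_on {0..1}" if "Adm v" "norm x \<le> r" for v :: "'a \<Rightarrow> real" and x
    using cx[OF that] by (rule integrable_continuous_real)
  have AT: "Adm (T v)" if v: "Adm v" for v :: "'a \<Rightarrow> real"
  proof -
    have "continuous_on (cball 0 r) (T v)"
      unfolding T_def
      using integral_continuous_on_param[OF cI[OF v, unfolded cbox_interval[symmetric]]]
      by (simp add: cbox_interval)
    moreover have "\<bar>T v x\<bar> \<le> m * norm x" if x: "norm x \<le> r" for x
    proof -
      have "norm (integral {0..1} (\<lambda>s. F (s *\<^sub>R x) (v (s *\<^sub>R x)) x)) \<le> integral {0..1} (\<lambda>s::real. m * norm x)"
      proof (rule integral_norm_bound_integral)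
        fix s :: real assume "s \<in> {0..1}"
        then have "norm (F (s *\<^sub>R x) (v (s *\<^sub>R x))) \<le> m" using sc[OF x] Ab[OF v] bnd by blast
        then show "norm (F (s *\<^sub>R x) (v (s *\<^sub>R x)) x) \<le> m * norm x"
          by (meson norm_blinfun mult_right_mono norm_ge_zero order_trans)
      qed (use ix[OF v x] in auto)
      then show ?thesis by (simp add: T_def)
    qed
    ultimately show ?thesis by (simp add: Adm_def)
  qed
  have Tdiff: "\<bar>T v x - T w x\<bar> \<le> integral {0..1} (\<lambda>s. L * norm x * h s)"
    if v: "Adm v" and w: "Adm w" and x: "norm x \<le> r"
      and h: "\<And>s. s \<in> {0..1} \<Longrightarrow> \<bar>v (s *\<^sub>R x) - w (s *\<^sub>R x)\<bar> \<le> h s" "continuous_on {0..1} h" for v w :: "'a \<Rightarrow> real" and x h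
  proof -
    have "T v x - T w x = integral {0..1} (\<lambda>s. F (s *\<^sub>R x) (v (s *\<^sub>R x)) x - F (s *\<^sub>R x) (w (s *\<^sub>R x)) x)"
      unfolding T_def using ix v w x by (simp add: integral_diff)
    also have "norm \<dots> \<le> integral {0..1} (\<lambda>s. L * norm x * h s)"
    proof (rule integral_norm_bound_integral)
      fix s :: real assume s: "s \<in> {0..1}"
      have "norm (F (s *\<^sub>R x) (v (s *\<^sub>R x)) x - F (s *\<^sub>R x) (w (s *\<^sub>R x)) x)
          = norm ((F (s *\<^sub>R x) (v (s *\<^sub>R x)) - F (s *\<^sub>R x) (w (s *\<^sub>R x))) x)"
        by (simp add: blinfun.diff_left)
      also have "\<dots> \<le> norm (F (s *\<^sub>R x) (v (s *\<^sub>R x)) - F (s *\<^sub>R x) (w (s *\<^sub>R x))) * norm x"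
        by (rule norm_blinfun)
      also have "\<dots> \<le> (L * \<bar>v (s *\<^sub>R x) - w (s *\<^sub>R x)\<bar>) * norm x"
        using sc[OF x s] Ab v w by (intro mult_right_mono lip) auto
      also have "\<dots> \<le> (L * h s) * norm x"
        using h(1)[OF s] L by (intro mult_right_mono mult_left_mono) auto
      finally show "norm (F (s *\<^sub>R x) (v (s *\<^sub>R x)) x - F (s *\<^sub>R x) (w (s *\<^sub>R x)) x) \<le> L * norm x * h s"
        by (simp add: algebra_simps)
    next
      show "(\<lambda>s. L * norm x * h s) integrable_on {0..1}"
        by (intro integrable_continuous_real continuous_intros h)
    qed (use ix v w x in \<open>auto intro!: integrable_diff\<close>)
    finally show ?thesis by simp
  qed
  define U where "U n = (T ^^ n) (\<lambda>_. 0)" for n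
  have U0: "U 0 = (\<lambda>_. 0)" and US: "U (Suc n) = T (U n)" for n by (simp_all add: U_def)
  have AU: "Adm (U n)" for n
    by (induction n) (use m in \<open>auto simp: U0 US AT, auto simp: Adm_def\<close>)
  define c where "c = m * r"
  have c: "c \<ge> 0" using m r by (simp add: c_def)
  \<comment> \<open>The weight exp (2 * L * norm x) is chosen because the integral operator halves it.\<close>
  have step: "\<bar>U (Suc n) x - U n x\<bar> \<le> c * (1/2)^n * exp (2 * L * norm x)" if "norm x \<le> r" for n x
    using that
  proof (induction n arbitrary: x)
    case 0
    have "\<bar>U (Suc 0) x\<bar> \<le> m * norm x" using AU[of "Suc 0"] 0 by (auto simp: Adm_def)
    also have "\<dots> \<le> c * 1" using 0 m by (simp add: c_def mult_left_mono)
    also have "\<dots> \<le> c * exp (2 * L * norm x)" using c L by (intro mult_left_mono) auto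
    finally show ?case by (simp add: U0)
  next
    case (Suc n)
    define h where "h s = c * (1/2)^n * exp (2 * L * (s * norm x))" for s
    have "\<bar>T (U (Suc n)) x - T (U n) x\<bar> \<le> integral {0..1} (\<lambda>s. L * norm x * h s)"
    proof (rule Tdiff[OF AU AU Suc.prems])
      fix s :: real assume s: "s \<in> {0..1}"
      show "\<bar>U (Suc n) (s *\<^sub>R x) - U n (s *\<^sub>R x)\<bar> \<le> h s"
        using Suc.IH[OF sc[OF Suc.prems s]] s by (simp add: h_def)
    qed (auto simp: h_def intro!: continuous_intros)
    also have "((\<lambda>s. L * norm x * h s) has_integral
        (c * (1/2)^n * exp (2 * L * (1 * norm x)) / 2 - c * (1/2)^n * exp (2 * L * (0 * norm x)) / 2)) {0..1}"
      by (rule fundamental_theorem_of_calculus)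
        (auto simp: h_def has_real_derivative_iff_has_vector_derivative[symmetric]
          intro!: derivative_eq_intros)
    then have "integral {0..1} (\<lambda>s. L * norm x * h s)
        = c * (1/2)^n * exp (2 * L * (1 * norm x)) / 2 - c * (1/2)^n * exp (2 * L * (0 * norm x)) / 2"
      by (rule integral_unique)
    also have "\<dots> \<le> c * (1/2)^(Suc n) * exp (2 * L * norm x)" using c by simp
    finally show ?case by (simp add: US)
  qed
  define E where "E = exp (2 * L * r)"
  have stepE: "norm (U (Suc n) x - U n x) \<le> c * E * (1/2)^n" if x: "x \<in> cball 0 r" for n x
  proof -
    have "\<bar>U (Suc n) x - U n x\<bar> \<le> c * (1/2)^n * exp (2 * L * norm x)" using step x by simp
    also have "\<dots> \<le> c * (1/2)^n * E"
      unfolding E_def using x L c by (intro mult_left_mono) (auto intro: mult_left_mono)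
    finally show ?thesis by (simp add: algebra_simps)
  qed
  define u where "u x = (\<Sum>n. U (Suc n) x - U n x)" for x
  have "uniform_limit (cball 0 r) (\<lambda>n x. \<Sum>i<n. U (Suc i) x - U i x) u sequentially"
    unfolding u_def by (rule Weierstrass_m_test[OF stepE]) (auto intro!: summable_mult summable_geometric)
  then have ul: "uniform_limit (cball 0 r) U u sequentially"
  proof -
    have "(\<lambda>n x. \<Sum>i<n. U (Suc i) x - U i x) = U"
      using sum_lessThan_telescope[of "\<lambda>i. U i _"] by (intro ext) (simp add: U0)
    then show ?thesis using \<open>uniform_limit _ _ u sequentially\<close> by simp
  qed
  have Au: "Adm u"
    unfolding Adm_def
  proof (intro conjI allI impI)
    show "continuous_on (cball 0 r) u"
      using AU ul by (intro uniform_limit_theorem[OF _ ul]) (auto simp: Adm_def)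
    fix x :: 'a assume x: "norm x \<le> r"
    then have "(\<lambda>n. U n x) \<longlonglongrightarrow> u x" using tendsto_uniform_limitI[OF ul, of x] by simp
    then show "\<bar>u x\<bar> \<le> m * norm x"
      using AU x by (intro Lim_bounded[OF tendsto_rabs, where M = 0]) (auto simp: Adm_def)
  qed
  have fix_u: "u x = T u x" if x: "norm x \<le> r" for x
  proof (rule LIMSEQ_unique)
    show "(\<lambda>n. U (Suc n) x) \<longlonglongrightarrow> u x"
      using LIMSEQ_Suc[OF tendsto_uniform_limitI[OF ul, of x]] x by simp
    show "(\<lambda>n. U (Suc n) x) \<longlonglongrightarrow> T u x"
    proof (rule LIMSEQ_I)
      fix e :: real assume e: "e > 0"
      define d where "d = e / (L * norm x + 1)"
      have p: "L * norm x + 1 > 0" using L by (simp add: add_nonneg_pos)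
      have d: "d > 0" using e p by (simp add: d_def)
      obtain N where N: "\<And>n y. n \<ge> N \<Longrightarrow> y \<in> cball 0 r \<Longrightarrow> dist (U n y) (u y) < d"
        using ul d unfolding uniform_limit_iff eventually_sequentially by meson
      have "\<bar>U (Suc n) x - T u x\<bar> < e" if "n \<ge> N" for n
      proof -
        have "\<bar>T (U n) x - T u x\<bar> \<le> integral {0..1} (\<lambda>s::real. L * norm x * d)"
        proof (rule Tdiff[OF AU Au x])
          fix s :: real assume "s \<in> {0..1}"
          then show "\<bar>U n (s *\<^sub>R x) - u (s *\<^sub>R x)\<bar> \<le> d"
            using N[OF that, of "s *\<^sub>R x"] sc[OF x] by (simp add: dist_real_def)
        qed auto
        also have "\<dots> = L * norm x * d" by simp
        also have "\<dots> < (L * norm x + 1) * d" using d by (simp add: algebra_simps)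
        also have "\<dots> = e" using p by (simp add: d_def)
        finally show ?thesis by (simp add: US)
      qed
      then show "\<exists>N. \<forall>n\<ge>N. norm (U (Suc n) x - T u x) < e" by auto
    qed
  qed
  show thesis
  proof (rule that[of u])
    show "continuous_on (cball 0 r) u" "\<And>x. norm x \<le> r \<Longrightarrow> \<bar>u x\<bar> \<le> m * norm x"
      using Au by (auto simp: Adm_def)
    fix x :: 'a and t :: real assume x: "norm x \<le> r" and t: "t \<in> {0..1}"
    define g where "g s = F (s *\<^sub>R x) (u (s *\<^sub>R x)) x" for s
    have g: "continuous_on {0..1} g" unfolding g_def by (rule cx[OF Au x])
    have eq: "u (t *\<^sub>R x) = integral {0..t} g" if t: "t \<in> {0..1}" for t
    proof -
      have "u (t *\<^sub>R x) = integral {0..1} (\<lambda>s. t * g (s * t))"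
        using fix_u[OF sc[OF x t]] by (simp add: T_def g_def blinfun.scaleR_right)
      then show ?thesis using radial_integral_deriv[OF g t] by simp
    qed
    have "((\<lambda>t. integral {0..t} g) has_real_derivative g t) (at t within {0..1})"
      using g t by (rule integral_has_real_derivative)
    then show "((\<lambda>t. u (t *\<^sub>R x)) has_real_derivative F (t *\<^sub>R x) (u (t *\<^sub>R x)) x) (at t within {0..1})"
      unfolding g_def[symmetric] using eq t
      by (subst has_field_derivative_cong_eventually[where g = "\<lambda>t. integral {0..t} g"])
        (auto simp: eventually_at_filter)
  qed
qed

section \<open>Leaves of a continuously differentiable form up to its curvature\<close>

text \<open>
  For a functional \<open>a\<close> that does not vanish on \<open>e\<close>, the kernel of \<open>a\<close> is the graph of this functional over
  any complement of the line spanned by \<open>e\<close>.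
\<close>
definition slope :: "('e::real_normed_vector \<Rightarrow>\<^sub>L real) \<Rightarrow> 'e \<Rightarrow> 'e \<Rightarrow>\<^sub>L real" where
  "slope a e = (- inverse (a e)) *\<^sub>R a"

lemma slope_apply:
  fixes a :: "'e::real_normed_vector \<Rightarrow>\<^sub>L real"
  shows "slope a e h = - (a h / a e)"
  by (simp add: slope_def blinfun.bilinear_simps field_simps)

lemma slope_kernel_iff:
  fixes a :: "'e::real_normed_vector \<Rightarrow>\<^sub>L real"
  shows "a e \<noteq> 0 \<Longrightarrow> a (h + c *\<^sub>R e) = 0 \<longleftrightarrow> c = slope a e h"
  by (auto simp: slope_apply blinfun.bilinear_simps field_simps)

lemma norm_slope_le:
  fixes a :: "'e::real_normed_vector \<Rightarrow>\<^sub>L real"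
  assumes "a e \<ge> 1/2" "norm a \<le> M"
  shows "norm (slope a e) \<le> 2 * M"
proof -
  have "0 < inverse (a e)" "inverse (a e) \<le> 2"
    using assms(1) le_imp_inverse_le[of "1/2" "a e"] by auto
  then show ?thesis unfolding slope_def using assms(2) by (simp add: mult_mono)
qed

lemma slope_lipschitz:
  fixes a b :: "'e::real_normed_vector \<Rightarrow>\<^sub>L real"
  assumes ae: "a e \<ge> 1/2" and be: "b e \<ge> 1/2" and M: "norm b \<le> M"
  shows "norm (slope a e - slope b e) \<le> (2 + 4 * norm e * M) * norm (a - b)"
proof -
  let ?i = "inverse (a e)" and ?j = "inverse (b e)"
  have i: "0 < ?i" "?i \<le> 2" using ae le_imp_inverse_le[of "1/2" "a e"] by auto
  have j: "0 < ?j" "?j \<le> 2" using be le_imp_inverse_le[of "1/2" "b e"] by auto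
  have "slope a e - slope b e = - (?i *\<^sub>R (a - b) + (?i - ?j) *\<^sub>R b)"
    by (simp add: slope_def algebra_simps)
  then have "norm (slope a e - slope b e) \<le> norm (?i *\<^sub>R (a - b)) + norm ((?i - ?j) *\<^sub>R b)"
    by (metis norm_minus_cancel norm_triangle_ineq)
  also have "norm (?i *\<^sub>R (a - b)) \<le> 2 * norm (a - b)"
    using i by (simp add: mult_right_mono)
  also have "norm ((?i - ?j) *\<^sub>R b) \<le> (4 * (norm (a - b) * norm e)) * M"
  proof -
    have "?i - ?j = ?i * ?j * ((b - a) e)"
      using i j by (simp add: blinfun.diff_left field_simps)
    then have "\<bar>?i - ?j\<bar> = \<bar>?i * ?j\<bar> * \<bar>(b - a) e\<bar>" by (simp only: abs_mult)
    also have "\<dots> \<le> 4 * (norm (a - b) * norm e)"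
    proof (rule mult_mono)
      show "\<bar>?i * ?j\<bar> \<le> 4" using mult_mono[OF i(2) j(2)] i(1) j(1) by simp
      show "\<bar>(b - a) e\<bar> \<le> norm (a - b) * norm e"
        using norm_blinfun[of "b - a" e] by (simp add: norm_minus_commute)
    qed auto
    finally show ?thesis using M by (auto intro!: mult_mono)
  qed
  finally show ?thesis by (simp add: algebra_simps)
qed

text \<open>
  The wedge product of \<open>a\<close> with the antisymmetrisation of \<open>A\<close>, evaluated on \<open>d\<close>, \<open>p\<close> and \<open>e\<close>: it is alternating, so
  the \<open>e\<close>-component of \<open>d\<close> drops out, and what remains carries the factor \<open>t\<close>.
\<close>
lemma transverse_slope_identity:
  fixes a :: "'e::real_normed_vector \<Rightarrow>\<^sub>L real" and A :: "'e \<Rightarrow>\<^sub>L 'e \<Rightarrow>\<^sub>L real"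
  assumes "a p = 0" and d: "d = t *\<^sub>R h + s *\<^sub>R e"
  defines "\<omega> \<equiv> \<lambda>u v. A u v - A v u"
  shows "a e * \<omega> p d = a d * \<omega> p e - t * (a h * \<omega> p e + a p * \<omega> e h + a e * \<omega> h p)"
  unfolding \<omega>_def d using assms(1)
  by (simp add: blinfun.bilinear_simps algebra_simps)

text \<open>
  The pointwise estimate behind the comparison of neighbouring rays.  Here \<open>a\<close> and \<open>a'\<close> are the values of a
  form at two nearby points with difference \<open>d\<close>, \<open>A\<close> is its derivative at the first point, and \<open>p\<close>, \<open>q\<close> are the
  velocities of the two lifted rays.  The left-hand side is the rate of change of \<open>a d\<close>; up to the errors
  \<open>\<kappa>\<close> and \<open>\<sigma>\<close> it is an exterior derivative, to which the previous identity applies.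
\<close>
lemma transverse_growth_bound:
  fixes a a' :: "'e::real_normed_vector \<Rightarrow>\<^sub>L real" and A :: "'e \<Rightarrow>\<^sub>L 'e \<Rightarrow>\<^sub>L real"
  assumes ap: "a p = 0" and aq: "a' q = 0" and d: "d = t *\<^sub>R h + s *\<^sub>R e" and t: "0 \<le> t" "t \<le> 1"
    and lin: "norm (a' - a - A d) \<le> \<kappa> * norm d" and qp: "norm (q - p) \<le> \<sigma>"
    and S: "norm p \<le> S" "norm q \<le> S" and B: "norm A \<le> B" and ae: "a e \<ge> 1/2" and M: "norm a \<le> M"
    and \<omega>: "\<And>u v. \<bar>A u v - A v u\<bar> \<le> D * norm u * norm v" and D: "0 \<le> D" and \<rho>: "0 \<le> \<rho>"
    and wedge: "\<And>u v w. \<bar>a u * (A v w - A w v) + a v * (A w u - A u w) + a w * (A u v - A v u)\<bar>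
                  \<le> \<rho> * norm u * norm v * norm w"
    and \<tau>: "(\<kappa> * S + B * \<sigma>) * (1 + 2 * norm e + 2 * M * norm e) \<le> \<tau>"
    and pos: "0 \<le> \<kappa>" "0 \<le> \<sigma>"
  shows "\<bar>A p d + a (q - p)\<bar> \<le> (2 * S * norm e * D + \<tau>) * \<bar>a d\<bar> + (2 * S * norm e * \<rho> + \<tau>) * norm h"
proof -
  define \<omega>' where "\<omega>' u v = A u v - A v u" for u v
  have S0: "0 \<le> S" using S norm_ge_zero order_trans by blast
  have B0: "0 \<le> B" using B norm_ge_zero order_trans by blast
  have M0: "0 \<le> M" using M norm_ge_zero order_trans by blast
  \<comment> \<open>Tangency of p and q turns the left-hand side into an exterior derivative plus errors.\<close>
  have split: "A p d + a (q - p) = \<omega>' p d - (a' - a - A d) q - A d (q - p)"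
    using ap aq by (simp add: \<omega>'_def blinfun.bilinear_simps)
  have "\<bar>\<omega>' p d\<bar> \<le> 2 * \<bar>a e * \<omega>' p d\<bar>"
    using mult_right_mono[OF ae, of "\<bar>\<omega>' p d\<bar>"] ae by (simp add: abs_mult)
  also have "\<bar>a e * \<omega>' p d\<bar> \<le> \<bar>a d\<bar> * (D * S * norm e) + 1 * (\<rho> * norm h * S * norm e)"
  proof -
    have "a e * \<omega>' p d = a d * \<omega>' p e - t * (a h * \<omega>' p e + a p * \<omega>' e h + a e * \<omega>' h p)"
      unfolding \<omega>'_def by (rule transverse_slope_identity[OF ap d])
    moreover have "\<bar>a d * \<omega>' p e\<bar> \<le> \<bar>a d\<bar> * (D * S * norm e)"
      unfolding abs_mult \<omega>'_def
      by (intro mult_left_mono order_trans[OF \<omega>] mult_right_mono mult_left_mono S D) auto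
    moreover have "\<bar>t * (a h * \<omega>' p e + a p * \<omega>' e h + a e * \<omega>' h p)\<bar> \<le> 1 * (\<rho> * norm h * S * norm e)"
      unfolding abs_mult \<omega>'_def
      by (intro mult_mono order_trans[OF wedge] mult_right_mono mult_left_mono S \<rho> mult_nonneg_nonneg)
        (use t in auto)
    ultimately show ?thesis by linarith
  qed
  finally have 1: "\<bar>\<omega>' p d\<bar> \<le> 2 * S * norm e * D * \<bar>a d\<bar> + 2 * S * norm e * \<rho> * norm h"
    by (simp add: algebra_simps)
  have "\<bar>(a' - a - A d) q\<bar> \<le> norm (a' - a - A d) * norm q"
    using norm_blinfun[of "a' - a - A d" q] by simp
  also have "\<dots> \<le> (\<kappa> * norm d) * S"
    by (intro mult_mono lin S) (use pos in auto)
  finally have 2: "\<bar>(a' - a - A d) q\<bar> \<le> \<kappa> * S * norm d" by (simp add: algebra_simps)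
  have "\<bar>A d (q - p)\<bar> \<le> norm (A d) * norm (q - p)" using norm_blinfun[of "A d" "q - p"] by simp
  also have "\<dots> \<le> (norm A * norm d) * \<sigma>" by (intro mult_mono norm_blinfun qp) auto
  also have "\<dots> \<le> (B * norm d) * \<sigma>" using B pos by (intro mult_right_mono) auto
  finally have 3: "\<bar>A d (q - p)\<bar> \<le> B * \<sigma> * norm d" by (simp add: algebra_simps)
  have nd: "norm d \<le> (1 + 2 * norm e + 2 * M * norm e) * (\<bar>a d\<bar> + norm h)"
  proof -
    have ah: "\<bar>a h\<bar> \<le> M * norm h" 
      using order_trans[OF norm_blinfun mult_right_mono[OF M norm_ge_zero]] by simp
    have "s * a e = a d - t * a h" unfolding d by (simp add: blinfun.bilinear_simps)
    then have "\<bar>s\<bar> * a e \<le> \<bar>a d\<bar> + \<bar>t * a h\<bar>" using ae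
      by (metis abs_mult abs_of_nonneg abs_triangle_ineq4 divide_nonneg_nonneg order_trans zero_le_numeral zero_le_one)
    also have "\<bar>t * a h\<bar> \<le> 1 * (M * norm h)" unfolding abs_mult using t ah M0 by (intro mult_mono) auto
    finally have "\<bar>s\<bar> * a e \<le> \<bar>a d\<bar> + M * norm h" by simp
    moreover have "\<bar>s\<bar> * (1/2) \<le> \<bar>s\<bar> * a e" using ae by (intro mult_left_mono) auto
    ultimately have s: "\<bar>s\<bar> \<le> 2 * \<bar>a d\<bar> + 2 * M * norm h" by linarith
    have "norm d \<le> norm (t *\<^sub>R h) + norm (s *\<^sub>R e)" unfolding d by (rule norm_triangle_ineq)
    also have "\<dots> \<le> 1 * norm h + \<bar>s\<bar> * norm e" using t by (auto simp: mult_left_le_one_le intro!: add_mono mult_right_mono)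
    also have "\<dots> \<le> 1 * norm h + (2 * \<bar>a d\<bar> + 2 * M * norm h) * norm e" using s by (intro add_mono mult_right_mono) auto
    also have "\<dots> \<le> (1 + 2 * norm e + 2 * M * norm e) * (\<bar>a d\<bar> + norm h)"
    proof -
      have "0 \<le> \<bar>a d\<bar> + 2 * norm e * norm h + 2 * M * norm e * \<bar>a d\<bar>" using M0 by simp
      then show ?thesis by (simp add: algebra_simps)
    qed
    finally show ?thesis .
  qed
  have "\<bar>A p d + a (q - p)\<bar> \<le> \<bar>\<omega>' p d\<bar> + (\<kappa> * S + B * \<sigma>) * norm d"
    unfolding split using 2 3 by (simp add: algebra_simps)
  also have "(\<kappa> * S + B * \<sigma>) * norm d \<le> (\<kappa> * S + B * \<sigma>) * ((1 + 2 * norm e + 2 * M * norm e) * (\<bar>a d\<bar> + norm h))"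
    using nd pos S0 B0 by (intro mult_left_mono) auto
  also have "\<dots> \<le> \<tau> * (\<bar>a d\<bar> + norm h)"
    unfolding mult.assoc[symmetric] using \<tau> by (intro mult_right_mono) auto
  finally show ?thesis using 1 by (simp add: algebra_simps)
qed

text \<open>
  Along the rays from the origin \<open>u\<close> solves the equation exactly; the conclusion says that, in every other
  direction, its increments are those prescribed by the slope up to the curvature \<open>\<rho>\<close> amplified by the
  exponential of \<open>D\<close>.  The term \<open>\<tau>\<close> stands for the errors of second order in the increment, which is why the
  estimate holds only for \<open>x'\<close> close to \<open>x\<close>.
\<close>
lemma approximate_leaf:
  fixes \<alpha> :: "'e::euclidean_space \<Rightarrow> 'e \<Rightarrow>\<^sub>L real" and \<alpha>' :: "'e \<Rightarrow> 'e \<Rightarrow>\<^sub>L 'e \<Rightarrow>\<^sub>L real"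
  assumes r: "0 < r" and R: "0 < R" and S: "S = r * (1 + 2 * M * norm e)" "S \<le> R"
    and der: "\<And>y. y \<in> cball x0 R \<Longrightarrow> (\<alpha> has_derivative blinfun_apply (\<alpha>' y)) (at y)"
    and cont: "continuous_on (cball x0 R) \<alpha>'"
    and ae: "\<And>y. y \<in> cball x0 R \<Longrightarrow> \<alpha> y e \<ge> 1/2"
    and M: "\<And>y. y \<in> cball x0 R \<Longrightarrow> norm (\<alpha> y) \<le> M"
    and \<omega>: "\<And>y u v. y \<in> cball x0 R \<Longrightarrow> \<bar>\<alpha>' y u v - \<alpha>' y v u\<bar> \<le> D * norm u * norm v"
    and wedge: "\<And>y u v w. y \<in> cball x0 R \<Longrightarrow>
       \<bar>\<alpha> y u * (\<alpha>' y v w - \<alpha>' y w v) + \<alpha> y v * (\<alpha>' y w u - \<alpha>' y u w) + \<alpha> y w * (\<alpha>' y u v - \<alpha>' y v u)\<bar>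
         \<le> \<rho> * norm u * norm v * norm w"
    and D: "0 \<le> D" and \<rho>: "0 \<le> \<rho>" and \<tau>: "0 < \<tau>"
  obtains u where "\<And>x. norm x \<le> r \<Longrightarrow> \<bar>u x\<bar> \<le> 2 * M * norm x"
    "\<And>x. norm x \<le> r \<Longrightarrow> \<exists>\<delta>>0. \<forall>x'. norm x' \<le> r \<and> norm (x' - x) < \<delta> \<longrightarrow>
       \<bar>u x' - u x - slope (\<alpha> (x0 + x + u x *\<^sub>R e)) e (x' - x)\<bar>
         \<le> 2 * (2 * S * norm e * \<rho> + \<tau>) * exp (2 * S * norm e * D + \<tau>) * norm (x' - x)"
proof -
  define K where "K = cball x0 R"
  have K: "compact K" "convex K" by (simp_all add: K_def)
  have xK: "x0 \<in> K"
    using R by (simp add: K_def)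
  have M0: "0 \<le> M" using M xK norm_ge_zero order_trans unfolding K_def by blast
  have S0: "0 \<le> S" using r M0 by (simp add: S)
  note der = der[folded K_def] and cont = cont[folded K_def] and ae = ae[folded K_def]
    and M = M[folded K_def] and \<omega> = \<omega>[folded K_def] and wedge = wedge[folded K_def]
  have c\<alpha>: "continuous_on K \<alpha>"
    by (rule has_derivative_continuous_on[OF has_derivative_at_withinI[OF der]])
  obtain B where B: "B > 0" "\<And>y. y \<in> K \<Longrightarrow> norm (\<alpha>' y) \<le> B"
    using compact_imp_bounded[OF compact_continuous_image[OF cont K(1)]] by (auto simp: bounded_pos)
  have \<alpha>L: "norm (\<alpha> y - \<alpha> z) \<le> B * norm (y - z)" if "y \<in> K" "z \<in> K" for y z
    using differentiable_bound[OF K(2) has_derivative_at_withinI[OF der], of B y z] B that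
    by (simp add: norm_blinfun.rep_eq)
  define F where "F y = slope (\<alpha> y) e" for y
  have ip: "\<alpha> y e > 0" "inverse (\<alpha> y e) \<le> 2" if "y \<in> K" for y
    using ae[OF that] le_imp_inverse_le[of "1/2" "\<alpha> y e"] by auto
  have Fn: "norm (F y) \<le> 2 * M" if "y \<in> K" for y
    unfolding F_def using ae[OF that] M[OF that] by (rule norm_slope_le)
  define L0 where "L0 = (2 + 4 * norm e * M) * B"
  have L0: "L0 \<ge> 0" using B M0 by (simp add: L0_def)
  have FL: "norm (F y - F z) \<le> L0 * norm (y - z)" if y: "y \<in> K" and z: "z \<in> K" for y z
  proof -
    have "norm (F y - F z) \<le> (2 + 4 * norm e * M) * norm (\<alpha> y - \<alpha> z)"
      unfolding F_def using ae[OF y] ae[OF z] M[OF z] by (rule slope_lipschitz)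
    also have "\<dots> \<le> (2 + 4 * norm e * M) * (B * norm (y - z))"
      using \<alpha>L[OF y z] M0 by (intro mult_left_mono) auto
    finally show ?thesis by (simp add: L0_def algebra_simps)
  qed
  have cF: "continuous_on K F"
    unfolding F_def slope_def using ae by (intro continuous_intros c\<alpha>) force
  have inK: "x0 + x + z *\<^sub>R e \<in> K" if "norm x \<le> r" "\<bar>z\<bar> \<le> 2 * M * r" for x z
  proof -
    have "norm (x + z *\<^sub>R e) \<le> norm x + \<bar>z\<bar> * norm e" by (metis norm_scaleR norm_triangle_ineq)
    also have "\<dots> \<le> r + (2 * M * r) * norm e" using that by (intro add_mono mult_right_mono) auto
    also have "\<dots> \<le> R" using S by (simp add: algebra_simps)
    finally have "norm (x + z *\<^sub>R e) \<le> R" .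
    moreover have "x0 - (x0 + x + z *\<^sub>R e) = - (x + z *\<^sub>R e)" by simp
    ultimately show ?thesis by (simp only: K_def mem_cball dist_norm norm_minus_cancel)
  qed
  obtain u where cu: "continuous_on (cball 0 r) u" and ub: "\<And>x. norm x \<le> r \<Longrightarrow> \<bar>u x\<bar> \<le> 2 * M * norm x"
    and ude: "\<And>x t. norm x \<le> r \<Longrightarrow> t \<in> {0..1} \<Longrightarrow>
       ((\<lambda>t. u (t *\<^sub>R x)) has_real_derivative F (x0 + t *\<^sub>R x + u (t *\<^sub>R x) *\<^sub>R e) x) (at t within {0..1})"
  proof (rule radial_ode_exists[of r "2 * M" "2 * M * r" "L0 * norm e" "\<lambda>x z. F (x0 + x + z *\<^sub>R e)"])
    show "continuous_on (cball 0 r \<times> {- (2 * M * r)..2 * M * r}) (\<lambda>(x, z). F (x0 + x + z *\<^sub>R e))"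
      unfolding case_prod_beta
      by (rule continuous_on_compose2[OF cF]) (use inK in \<open>auto intro!: continuous_intros simp: abs_le_iff\<close>)
    fix x :: 'e and z z' assume *: "norm x \<le> r" "\<bar>z\<bar> \<le> 2 * M * r" "\<bar>z'\<bar> \<le> 2 * M * r"
    show "norm (F (x0 + x + z *\<^sub>R e) - F (x0 + x + z' *\<^sub>R e)) \<le> L0 * norm e * \<bar>z - z'\<bar>"
      using FL[OF inK[OF *(1,2)] inK[OF *(1,3)]]
      by (simp add: scaleR_left_diff_distrib[symmetric] algebra_simps del: scaleR_left_diff_distrib)
  qed (use r M0 L0 Fn inK in auto)
  define \<pi> where "\<pi> x = x0 + x + u x *\<^sub>R e" for x
  have \<pi>K: "\<pi> x \<in> K" if "norm x \<le> r" for x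
    unfolding \<pi>_def using that M0
    by (intro inK order_trans[OF ub[OF that]] mult_left_mono) auto
  have sc: "norm (t *\<^sub>R x) \<le> r" if "norm x \<le> r" "t \<in> {0..1}" for t and x :: 'e
    using that by (auto simp: mult_left_le_one_le intro: order_trans[rotated])
  define v where "v x t = x + F (\<pi> (t *\<^sub>R x)) x *\<^sub>R e" for x t
  have \<gamma>: "((\<lambda>t. \<pi> (t *\<^sub>R x)) has_vector_derivative v x t) (at t within {0..1})"
    if "norm x \<le> r" "t \<in> {0..1}" for x t
    using ude[OF that] unfolding \<pi>_def v_def
    by (auto intro!: derivative_eq_intros simp: has_real_derivative_iff_has_vector_derivative)
  have \<alpha>v: "\<alpha> (\<pi> (t *\<^sub>R x)) (v x t) = 0" if "norm x \<le> r" "t \<in> {0..1}" for x t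
    using ip(1)[OF \<pi>K[OF sc[OF that]]] by (simp add: v_def F_def slope_kernel_iff)
  have vS: "norm (v x t) \<le> S" if "norm x \<le> r" "t \<in> {0..1}" for x t
  proof -
    have "\<bar>F (\<pi> (t *\<^sub>R x)) x\<bar> \<le> norm (F (\<pi> (t *\<^sub>R x))) * norm x" using norm_blinfun[of "F (\<pi> (t *\<^sub>R x))" x] by simp
    also have "\<dots> \<le> (2 * M) * r" using Fn[OF \<pi>K[OF sc[OF that]]] that M0 by (intro mult_mono) auto
    finally have "\<bar>F (\<pi> (t *\<^sub>R x)) x\<bar> * norm e \<le> 2 * M * r * norm e" by (intro mult_right_mono) auto
    then have "norm x + norm (F (\<pi> (t *\<^sub>R x)) x *\<^sub>R e) \<le> S" using that by (simp add: S algebra_simps)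
    then show ?thesis unfolding v_def using norm_triangle_ineq order_trans by blast
  qed
  have c\<pi>: "continuous_on (cball 0 r) \<pi>" unfolding \<pi>_def by (intro continuous_intros cu)
  define c2 where "c2 = 1 + 2 * norm e + 2 * M * norm e"
  have c2: "c2 > 0" using M0 by (simp add: c2_def add_pos_nonneg)
  \<comment> \<open>The tolerances are such that the errors of the pointwise bound, multiplied by c2, add up to at most \<tau>.\<close>
  define \<tau>1 where "\<tau>1 = \<tau> / (2 * c2 * (S + 1))"
  define \<tau>3 where "\<tau>3 = \<tau> / (2 * c2 * (B + 1))"
  have \<tau>13: "0 < \<tau>1" "0 < \<tau>3" using \<tau> c2 S0 B by (simp_all add: \<tau>1_def \<tau>3_def)
  have \<tau>c: "(\<tau>1 * S + B * \<tau>3) * (1 + 2 * norm e + 2 * M * norm e) \<le> \<tau>"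
  proof -
    have "\<tau>1 * S * c2 \<le> \<tau>1 * (S + 1) * c2" "B * \<tau>3 * c2 \<le> (B + 1) * \<tau>3 * c2"
      using \<tau>13 c2 by (auto intro!: mult_right_mono mult_left_mono)
    moreover have cancel: "\<tau> / (2 * c2 * s) * s * c2 = \<tau> / 2" if "s > 0" for s
      using that c2 by (simp add: field_simps)
    have "\<tau>1 * (S + 1) * c2 = \<tau> / 2" "(B + 1) * \<tau>3 * c2 = \<tau> / 2"
      using cancel[of "S + 1"] cancel[of "B + 1"] S0 B
      by (simp_all only: \<tau>1_def \<tau>3_def mult.commute[of "B + 1"])
    ultimately show ?thesis unfolding c2_def[symmetric] by (simp add: distrib_right)
  qed
  obtain \<delta>1 where \<delta>1: "\<delta>1 > 0" "\<And>y z. y \<in> K \<Longrightarrow> z \<in> K \<Longrightarrow> norm (z - y) < \<delta>1 \<Longrightarrow>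
      norm (\<alpha> z - \<alpha> y - \<alpha>' y (z - y)) \<le> \<tau>1 * norm (z - y)"
    using uniformly_differentiable[OF K der cont \<tau>13(1)] by blast
  define \<theta> where "\<theta> = \<tau>3 / (2 * (r * norm e + 1))"
  have re: "0 < r * norm e + 1" using r by (simp add: add_nonneg_pos)
  have \<theta>: "\<theta> > 0" using \<tau>13 re by (simp add: \<theta>_def)
  have half: "\<tau>3 / (2 * q) * q = \<tau>3 / 2" if "q > 0" for q
    using that by simp
  have \<theta>r: "\<theta> * r * norm e \<le> \<tau>3 / 2"
  proof -
    have "\<theta> * (r * norm e) \<le> \<theta> * (r * norm e + 1)" using \<theta> by (intro mult_left_mono) auto
    also have "\<dots> = \<tau>3 / 2" unfolding \<theta>_def by (rule half[OF re])
    finally show ?thesis by (simp add: mult.assoc)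
  qed
  define \<delta>2 where "\<delta>2 = \<theta> / (L0 + 1)"
  have \<delta>2: "\<delta>2 > 0" using \<theta> L0 by (simp add: \<delta>2_def)
  have F2: "norm (F z - F y) \<le> \<theta>" if "y \<in> K" "z \<in> K" "norm (z - y) < \<delta>2" for y z
  proof -
    have "norm (F z - F y) \<le> L0 * norm (z - y)" using FL that by simp
    also have "\<dots> \<le> (L0 + 1) * \<delta>2" using that L0 by (intro mult_mono) auto
    also have "\<dots> = \<theta>" using L0 by (simp add: \<delta>2_def)
    finally show ?thesis .
  qed
  have "uniformly_continuous_on (cball 0 r) \<pi>" using c\<pi> by (intro compact_uniformly_continuous) auto
  then obtain \<delta>3 where \<delta>3: "\<delta>3 > 0" "\<And>x y. norm x \<le> r \<Longrightarrow> norm y \<le> r \<Longrightarrow> dist y x < \<delta>3 \<Longrightarrow>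
      dist (\<pi> y) (\<pi> x) < min \<delta>1 \<delta>2"
    unfolding uniformly_continuous_on_def using \<delta>1(1) \<delta>2
    by (metis mem_cball_0 min_less_iff_conj)
  define \<delta>4 where "\<delta>4 = \<tau>3 / (2 * (1 + 2 * M * norm e))"
  have Me: "1 + 2 * M * norm e > 0" using M0 by (simp add: add_pos_nonneg)
  have \<delta>4: "\<delta>4 > 0" "(1 + 2 * M * norm e) * \<delta>4 = \<tau>3 / 2"
    using \<tau>13 Me half[OF Me] by (simp_all only: \<delta>4_def mult.commute[of "1 + 2 * M * norm e"]) simp
  have main: "\<bar>u x' - u x - slope (\<alpha> (\<pi> x)) e (x' - x)\<bar>
         \<le> 2 * (2 * S * norm e * \<rho> + \<tau>) * exp (2 * S * norm e * D + \<tau>) * norm (x' - x)"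
    if x: "norm x \<le> r" and x': "norm x' \<le> r" and xx: "norm (x' - x) < min \<delta>3 \<delta>4" for x x'
  proof -
    define d where "d t = \<pi> (t *\<^sub>R x') - \<pi> (t *\<^sub>R x)" for t
    \<comment> \<open>The displacement of the neighbouring ray, measured by the form.\<close>
    define w where "w t = \<alpha> (\<pi> (t *\<^sub>R x)) (d t)" for t
    define w' where "w' t = \<alpha>' (\<pi> (t *\<^sub>R x)) (v x t) (d t) + \<alpha> (\<pi> (t *\<^sub>R x)) (v x' t - v x t)" for t
    have "\<bar>w 1\<bar> \<le> (2 * S * norm e * \<rho> + \<tau>) * norm (x' - x) * exp (2 * S * norm e * D + \<tau>)"
    proof (rule gronwall_unit[of w w'])
      fix t :: real assume t: "t \<in> {0..1}"
      have "((\<lambda>t. \<alpha> (\<pi> (t *\<^sub>R x))) has_vector_derivative \<alpha>' (\<pi> (t *\<^sub>R x)) (v x t)) (at t within {0..1})"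
        using has_derivative_compose[OF \<gamma>[OF x t, unfolded has_vector_derivative_def] der[OF \<pi>K[OF sc[OF x t]]]]
        by (simp add: has_vector_derivative_def blinfun.scaleR_right)
      then show "(w has_real_derivative w' t) (at t within {0..1})"
        unfolding w_def[abs_def] w'_def d_def has_real_derivative_iff_has_vector_derivative
        using bounded_bilinear.has_vector_derivative[OF bounded_bilinear_blinfun_apply _
            has_vector_derivative_diff[OF \<gamma>[OF x' t] \<gamma>[OF x t]]]
        by (simp only: add.commute[of "\<alpha>' _ _ _"])
    next
      show "w 0 = 0" by (simp add: w_def d_def blinfun.zero_right)
    next
      fix t :: real assume t: "t \<in> {0..1}"
      note tx = sc[OF x t] and tx' = sc[OF x' t]
      have "dist (t *\<^sub>R x') (t *\<^sub>R x) < \<delta>3"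
      proof -
        have "dist (t *\<^sub>R x') (t *\<^sub>R x) = t * norm (x' - x)"
          using t by (simp add: dist_norm flip: scaleR_diff_right)
        also have "\<dots> \<le> 1 * norm (x' - x)" using t by (intro mult_right_mono) auto
        finally show ?thesis using xx by simp
      qed
      then have dd: "norm (d t) < \<delta>1" "norm (d t) < \<delta>2"
        using \<delta>3(2)[OF tx tx'] by (simp_all add: d_def dist_norm)
      show "\<bar>w' t\<bar> \<le> (2 * S * norm e * D + \<tau>) * \<bar>w t\<bar> + (2 * S * norm e * \<rho> + \<tau>) * norm (x' - x)"
        unfolding w'_def w_def
      proof (rule transverse_growth_bound[OF \<alpha>v[OF x t] \<alpha>v[OF x' t], where t = t and s = "u (t *\<^sub>R x') - u (t *\<^sub>R x)"
            and B = B and M = M and \<kappa> = \<tau>1 and \<sigma> = \<tau>3])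
        show "d t = t *\<^sub>R (x' - x) + (u (t *\<^sub>R x') - u (t *\<^sub>R x)) *\<^sub>R e"
          by (simp add: d_def \<pi>_def algebra_simps)
        show "norm (\<alpha> (\<pi> (t *\<^sub>R x')) - \<alpha> (\<pi> (t *\<^sub>R x)) - \<alpha>' (\<pi> (t *\<^sub>R x)) (d t)) \<le> \<tau>1 * norm (d t)"
          using \<delta>1(2)[OF \<pi>K[OF tx] \<pi>K[OF tx']] dd by (simp add: d_def)
        show "norm (v x' t - v x t) \<le> \<tau>3"
        proof -
          let ?G = "F (\<pi> (t *\<^sub>R x'))" and ?F = "F (\<pi> (t *\<^sub>R x))"
          have "v x' t - v x t = (x' - x) + ((?G - ?F) x' + ?F (x' - x)) *\<^sub>R e"
            by (simp add: v_def blinfun.bilinear_simps algebra_simps)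
          then have "norm (v x' t - v x t) \<le> norm (x' - x) + \<bar>(?G - ?F) x' + ?F (x' - x)\<bar> * norm e"
            by (metis norm_scaleR norm_triangle_ineq)
          also have "\<bar>(?G - ?F) x' + ?F (x' - x)\<bar> \<le> \<theta> * r + 2 * M * norm (x' - x)"
          proof -
            have "\<bar>(?G - ?F) x'\<bar> \<le> \<theta> * r"
              using F2[OF \<pi>K[OF tx] \<pi>K[OF tx']] dd x' \<theta>
              by (intro order_trans[OF norm_blinfun[of "?G - ?F" x', simplified] mult_mono]) (auto simp: d_def)
            moreover have "\<bar>?F (x' - x)\<bar> \<le> 2 * M * norm (x' - x)"
              by (intro order_trans[OF norm_blinfun[of ?F "x' - x", simplified] mult_right_mono] Fn \<pi>K tx) auto
            ultimately show ?thesis by linarith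
          qed
          then have "norm (x' - x) + \<bar>(?G - ?F) x' + ?F (x' - x)\<bar> * norm e
             \<le> norm (x' - x) + (\<theta> * r + 2 * M * norm (x' - x)) * norm e"
            by (intro add_mono mult_right_mono) auto
          also have "\<dots> = (1 + 2 * M * norm e) * norm (x' - x) + \<theta> * r * norm e" by (simp add: algebra_simps)
          also have "\<dots> \<le> (1 + 2 * M * norm e) * \<delta>4 + \<tau>3 / 2"
            using xx Me \<theta>r by (intro add_mono mult_left_mono) auto
          also have "\<dots> = \<tau>3" using \<delta>4 by simp
          finally show ?thesis .
        qed
      qed (use t vS[OF x t] vS[OF x' t] B(2)[OF \<pi>K[OF tx]] ae[OF \<pi>K[OF tx]] M[OF \<pi>K[OF tx]]
             \<omega>[OF \<pi>K[OF tx]] wedge[OF \<pi>K[OF tx]] D \<rho> \<tau>c \<tau>13 in auto)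
    qed (use S0 D \<rho> \<tau> in auto)
    moreover have "u x' - u x - slope (\<alpha> (\<pi> x)) e (x' - x) = inverse (\<alpha> (\<pi> x) e) * w 1"
    proof -
      have "d 1 = (x' - x) + (u x' - u x) *\<^sub>R e" by (simp add: d_def \<pi>_def algebra_simps)
      then have "w 1 = \<alpha> (\<pi> x) (x' - x) + (u x' - u x) * \<alpha> (\<pi> x) e"
        by (simp only: w_def blinfun.add_right blinfun.scaleR_right scaleR_one real_scaleR_def)
      then show ?thesis using ip(1)[OF \<pi>K[OF x]] by (simp add: slope_apply field_simps)
    qed
    moreover have "\<bar>inverse (\<alpha> (\<pi> x) e) * w 1\<bar> \<le> 2 * \<bar>w 1\<bar>"
      unfolding abs_mult using ip[OF \<pi>K[OF x]] by (intro mult_right_mono) auto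
    ultimately show ?thesis by (simp add: algebra_simps)
  qed
  show thesis
  proof (rule that[of u])
    fix x :: 'e assume x: "norm x \<le> r"
    show "\<bar>u x\<bar> \<le> 2 * M * norm x" using ub x by simp
    show "\<exists>\<delta>>0. \<forall>x'. norm x' \<le> r \<and> norm (x' - x) < \<delta> \<longrightarrow>
       \<bar>u x' - u x - slope (\<alpha> (x0 + x + u x *\<^sub>R e)) e (x' - x)\<bar>
         \<le> 2 * (2 * S * norm e * \<rho> + \<tau>) * exp (2 * S * norm e * D + \<tau>) * norm (x' - x)"
      using main[OF x] \<delta>3(1) \<delta>4(1) unfolding \<pi>_def by (intro exI[of _ "min \<delta>3 \<delta>4"]) auto
  qed
qed

section \<open>Passing to the limit\<close>

lemma ext_deriv_eq:
  assumes "(\<alpha> has_derivative blinfun_apply A) (at y)"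
  shows "ext_deriv \<alpha> y u v = A u v - A v u"
  using frechet_derivative_at[OF assms] by (simp add: ext_deriv_def)

text \<open>
  Locally approximate solutions are globally Lipschitz on the ball with a common constant, so Arzela-Ascoli
  applies.  The limit is differentiable because, near a fixed point, the approximate solutions minus one
  fixed linear functional are Lipschitz with an arbitrarily small constant, and this survives the limit.
\<close>
lemma uniform_limit_of_approximate_leaves:
  fixes \<eta> :: "'e::euclidean_space \<Rightarrow> 'e \<Rightarrow>\<^sub>L real" and \<eta>s :: "nat \<Rightarrow> 'e \<Rightarrow> 'e \<Rightarrow>\<^sub>L real"
  assumes r: "0 < r" and M0: "0 \<le> M"
    and c\<eta>: "continuous_on K \<eta>" and K: "closed K"
    and e1: "\<And>y. y \<in> K \<Longrightarrow> \<eta> y e \<ge> 1/2" and e2: "\<And>k y. y \<in> K \<Longrightarrow> \<eta>s k y e \<ge> 1/2"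
    and M1: "\<And>y. y \<in> K \<Longrightarrow> norm (\<eta> y) \<le> M" and M2: "\<And>k y. y \<in> K \<Longrightarrow> norm (\<eta>s k y) \<le> M"
    and close: "\<And>k y. y \<in> K \<Longrightarrow> norm (\<eta>s k y - \<eta> y) \<le> \<delta> k" and \<delta>: "\<delta> \<longlonglongrightarrow> 0"
    and B: "B \<longlonglongrightarrow> 0"
    and inK: "\<And>k x. norm x \<le> r \<Longrightarrow> x0 + x + U k x *\<^sub>R e \<in> K"
    and U0: "\<And>k x. norm x \<le> r \<Longrightarrow> \<bar>U k x\<bar> \<le> 2 * M * norm x"
    and U: "\<And>k x. norm x \<le> r \<Longrightarrow> \<exists>\<delta>>0. \<forall>x'. norm x' \<le> r \<and> norm (x' - x) < \<delta> \<longrightarrow>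
       \<bar>U k x' - U k x - slope (\<eta>s k (x0 + x + U k x *\<^sub>R e)) e (x' - x)\<bar> \<le> B k * norm (x' - x)"
  obtains u where "u 0 = 0" "\<And>x. norm x \<le> r \<Longrightarrow> x0 + x + u x *\<^sub>R e \<in> K"
    "\<And>x. norm x \<le> r \<Longrightarrow>
      (u has_derivative slope (\<eta> (x0 + x + u x *\<^sub>R e)) e) (at x within cball 0 r)"
proof -
  obtain Bm where Bm: "\<And>k. \<bar>B k\<bar> \<le> Bm" "Bm > 0"
    using convergent_imp_Bseq[OF convergentI[OF B]] by (auto simp: Bseq_def)
  define L where "L = Bm + 2 * M"
  have L: "L > 0" using Bm M0 by (simp add: L_def)
  have lip: "norm (U k x' - U k x) \<le> L * norm (x' - x)" if x: "x \<in> cball 0 r" and x': "x' \<in> cball 0 r" for k and x x' :: 'e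
  proof (rule lipschitz_from_pointwise[OF convex_cball _ x x'])
    fix x :: 'e assume "x \<in> cball 0 r"
    then have x: "norm x \<le> r" by simp
    obtain \<epsilon> where \<epsilon>: "\<epsilon> > 0" "\<And>x'. norm x' \<le> r \<Longrightarrow> norm (x' - x) < \<epsilon> \<Longrightarrow>
       \<bar>U k x' - U k x - slope (\<eta>s k (x0 + x + U k x *\<^sub>R e)) e (x' - x)\<bar> \<le> B k * norm (x' - x)"
      using U[OF x] by blast
    show "\<exists>\<rho>>0. \<forall>y\<in>cball 0 r. norm (y - x) < \<rho> \<longrightarrow> norm (U k y - U k x) \<le> L * norm (y - x)"
    proof (intro exI[of _ \<epsilon>] conjI ballI impI \<epsilon>)
      fix y assume y: "y \<in> cball 0 r" "norm (y - x) < \<epsilon>"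
      let ?s = "slope (\<eta>s k (x0 + x + U k x *\<^sub>R e)) e"
      have "\<bar>?s (y - x)\<bar> \<le> norm ?s * norm (y - x)" using norm_blinfun[of ?s] by simp
      also have "\<dots> \<le> 2 * M * norm (y - x)"
        using e2 M2 inK[OF x] by (intro mult_right_mono norm_slope_le) auto
      finally have "\<bar>?s (y - x)\<bar> \<le> 2 * M * norm (y - x)" .
      moreover have "\<bar>U k y - U k x - ?s (y - x)\<bar> \<le> B k * norm (y - x)" using \<epsilon>(2) y by simp
      moreover have "B k * norm (y - x) \<le> Bm * norm (y - x)" using Bm(1)[of k] by (intro mult_right_mono) auto
      ultimately show "norm (U k y - U k x) \<le> L * norm (y - x)" by (simp add: L_def algebra_simps)
    qed
  qed
  obtain u \<sigma> where cu: "continuous_on (cball 0 r) u" and \<sigma>: "strict_mono (\<sigma> :: nat \<Rightarrow> nat)"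
    and conv: "\<And>\<epsilon>. 0 < \<epsilon> \<Longrightarrow> \<exists>N. \<forall>n x. n \<ge> N \<and> x \<in> cball 0 r \<longrightarrow> norm (U (\<sigma> n) x - u x) < \<epsilon>"
  proof (rule Arzela_Ascoli[of "cball (0::'e) r" U "2 * M * r"])
    show "norm (U n x) \<le> 2 * M * r" if "x \<in> cball 0 r" for n and x :: 'e
    proof -
      have "\<bar>U n x\<bar> \<le> 2 * M * norm x" using U0 that by simp
      also have "\<dots> \<le> 2 * M * r" using that M0 by (intro mult_left_mono) auto
      finally show ?thesis by simp
    qed
    show "\<exists>d>0. \<forall>n y. y \<in> cball 0 r \<and> norm (x - y) < d \<longrightarrow> norm (U n x - U n y) < \<epsilon>"
      if x: "x \<in> cball 0 r" and \<epsilon>: "0 < \<epsilon>" for x :: 'e and \<epsilon>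
    proof (intro exI[of _ "\<epsilon> / L"] conjI allI impI)
      show "\<epsilon> / L > 0" using \<epsilon> L by simp
      fix n y assume y: "y \<in> cball 0 r \<and> norm (x - y) < \<epsilon> / L"
      have "norm (U n x - U n y) \<le> L * norm (x - y)" using lip x y by blast
      also have "\<dots> < \<epsilon>" using y L by (simp add: field_simps)
      finally show "norm (U n x - U n y) < \<epsilon>" .
    qed
  qed auto
  have pt: "(\<lambda>n. U (\<sigma> n) x) \<longlonglongrightarrow> u x" if "norm x \<le> r" for x :: 'e
    unfolding LIMSEQ_iff using conv that by (metis mem_cball_0)
  have uK: "x0 + x + u x *\<^sub>R e \<in> K" if x: "norm x \<le> r" for x
  proof (rule closed_sequentially[OF K])
    show "\<And>n. x0 + x + U (\<sigma> n) x *\<^sub>R e \<in> K" using inK[OF x] by simp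
    show "(\<lambda>n. x0 + x + U (\<sigma> n) x *\<^sub>R e) \<longlonglongrightarrow> x0 + x + u x *\<^sub>R e"
      by (intro tendsto_intros pt x)
  qed
  have u0: "u 0 = 0"
  proof (rule LIMSEQ_unique[OF pt])
    have "U (\<sigma> n) 0 = 0" for n using U0[of 0 "\<sigma> n"] r by simp
    then show "(\<lambda>n. U (\<sigma> n) 0) \<longlonglongrightarrow> 0" by simp
  qed (use r in simp)
  have \<delta>\<sigma>: "(\<lambda>n. \<delta> (\<sigma> n)) \<longlonglongrightarrow> 0" and B\<sigma>: "(\<lambda>n. B (\<sigma> n)) \<longlonglongrightarrow> 0"
    using LIMSEQ_subseq_LIMSEQ[OF \<delta> \<sigma>] LIMSEQ_subseq_LIMSEQ[OF B \<sigma>] by (simp_all add: o_def)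
  have der: "(u has_derivative slope (\<eta> (x0 + x + u x *\<^sub>R e)) e) (at x within cball 0 r)"
    if x: "norm x \<le> r" for x
    unfolding has_derivative_within_alt
  proof (intro conjI allI impI)
    show "bounded_linear (blinfun_apply (slope (\<eta> (x0 + x + u x *\<^sub>R e)) e))"
      by (rule blinfun.bounded_linear_right)
    fix \<tau> :: real assume \<tau>: "0 < \<tau>"
    define p where "p = x0 + x + u x *\<^sub>R e"
    have pK: "p \<in> K" using uK[OF x] by (simp add: p_def)
    define c where "c = 2 + 4 * norm e * M"
    have c: "c > 0" using M0 by (simp add: c_def add_pos_nonneg)
    define \<theta> where "\<theta> = \<tau> / (4 * c)"
    have \<theta>: "\<theta> > 0" "c * (\<theta> + \<theta>) = \<tau> / 2" using \<tau> c by (simp_all add: \<theta>_def field_simps)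
    obtain \<beta> where \<beta>: "\<beta> > 0" "\<And>y. y \<in> K \<Longrightarrow> norm (y - p) < \<beta> \<Longrightarrow> norm (\<eta> y - \<eta> p) < \<theta>"
      using c\<eta> pK \<theta>(1) unfolding continuous_on_iff dist_norm by meson
    define \<nu> where "\<nu> = \<beta> / (2 * (1 + L * norm e))"
    have Le: "1 + L * norm e > 0" using L by (simp add: add_pos_nonneg)
    have \<nu>: "\<nu> > 0" "(1 + L * norm e) * \<nu> = \<beta> / 2"
    proof -
      show "\<nu> > 0" using \<beta> Le by (simp add: \<nu>_def)
      have "q * (\<beta> / (2 * q)) = \<beta> / 2" if "q > 0" for q using that by simp
      then show "(1 + L * norm e) * \<nu> = \<beta> / 2" unfolding \<nu>_def using Le by blast
    qed
    have "\<forall>\<^sub>F n in sequentially. \<delta> (\<sigma> n) < \<theta>" "\<forall>\<^sub>F n in sequentially. B (\<sigma> n) < \<tau> / 2"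
      using order_tendstoD(2)[OF \<delta>\<sigma>] order_tendstoD(2)[OF B\<sigma>] \<theta> \<tau> by auto
    moreover have "\<forall>\<^sub>F n in sequentially. \<bar>U (\<sigma> n) x - u x\<bar> * norm e < \<beta> / 2"
    proof -
      have "(\<lambda>n. \<bar>U (\<sigma> n) x - u x\<bar> * norm e) \<longlonglongrightarrow> \<bar>u x - u x\<bar> * norm e"
        by (intro tendsto_intros pt x)
      then show ?thesis using order_tendstoD(2)[of _ 0 sequentially "\<beta> / 2"] \<beta> by simp
    qed
    ultimately have ev: "\<forall>\<^sub>F n in sequentially. \<delta> (\<sigma> n) < \<theta> \<and> B (\<sigma> n) < \<tau> / 2 \<and> \<bar>U (\<sigma> n) x - u x\<bar> * norm e < \<beta> / 2"
      by (intro eventually_conj)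
    have est: "norm ((U k y - slope (\<eta> p) e y) - (U k x - slope (\<eta> p) e x)) \<le> \<tau> * norm (y - x)"
      if k: "\<delta> k < \<theta>" "B k < \<tau> / 2" "\<bar>U k x - u x\<bar> * norm e < \<beta> / 2" and y: "norm y \<le> r" "norm (y - x) < \<nu>" for k y
    proof (rule lipschitz_from_pointwise[where C = "cball 0 r \<inter> ball x \<nu>"
          and f = "\<lambda>y. U k y - slope (\<eta> p) e y"])
      show "convex (cball 0 r \<inter> ball x \<nu>)" by (intro convex_Int convex_cball convex_ball)
      show "x \<in> cball 0 r \<inter> ball x \<nu>" "y \<in> cball 0 r \<inter> ball x \<nu>"
        using x y \<nu> by (auto simp: dist_norm norm_minus_commute)
      fix z assume z: "z \<in> cball 0 r \<inter> ball x \<nu>"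
      then have z': "norm z \<le> r" "norm (z - x) < \<nu>" by (auto simp: dist_norm norm_minus_commute)
      define q where "q = x0 + z + U k z *\<^sub>R e"
      have qK: "q \<in> K" unfolding q_def by (rule inK[OF z'(1)])
      have "norm (q - p) < \<beta>"
      proof -
        have "q - p = (z - x) + (U k z - U k x) *\<^sub>R e + (U k x - u x) *\<^sub>R e"
          by (simp add: q_def p_def algebra_simps)
        then have "norm (q - p) \<le> norm (z - x) + \<bar>U k z - U k x\<bar> * norm e + \<bar>U k x - u x\<bar> * norm e"
          by (metis (no_types, lifting) add_mono norm_scaleR norm_triangle_ineq norm_triangle_le order_refl)
        also have "\<bar>U k z - U k x\<bar> * norm e \<le> (L * norm (z - x)) * norm e"
          using lip[of x z k] x z' by (intro mult_right_mono) auto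
        also have "norm (z - x) + L * norm (z - x) * norm e + \<bar>U k x - u x\<bar> * norm e
            = (1 + L * norm e) * norm (z - x) + \<bar>U k x - u x\<bar> * norm e" by (simp add: algebra_simps)
        also have "\<dots> < (1 + L * norm e) * \<nu> + \<beta> / 2"
          using z' Le k by (intro add_strict_mono mult_strict_left_mono) auto
        also have "\<dots> = \<beta>" using \<nu> by simp
        finally show ?thesis by simp
      qed
      then have "norm (\<eta> q - \<eta> p) < \<theta>" using \<beta>(2) qK by simp
      moreover have "norm (\<eta>s k q - \<eta> q) \<le> \<delta> k" by (rule close[OF qK])
      ultimately have "norm (\<eta>s k q - \<eta> p) \<le> \<theta> + \<theta>"
        using norm_triangle_ineq[of "\<eta>s k q - \<eta> q" "\<eta> q - \<eta> p"] k by simp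
      then have "c * norm (\<eta>s k q - \<eta> p) \<le> c * (\<theta> + \<theta>)" using c by (intro mult_left_mono) auto
      moreover have "norm (slope (\<eta>s k q) e - slope (\<eta> p) e) \<le> c * norm (\<eta>s k q - \<eta> p)"
        unfolding c_def using e2[OF qK] e1[OF pK] M1[OF pK] by (rule slope_lipschitz)
      ultimately have sl: "norm (slope (\<eta>s k q) e - slope (\<eta> p) e) \<le> \<tau> / 2" using \<theta> by simp
      obtain \<epsilon> where \<epsilon>: "\<epsilon> > 0" "\<And>x'. norm x' \<le> r \<Longrightarrow> norm (x' - z) < \<epsilon> \<Longrightarrow>
         \<bar>U k x' - U k z - slope (\<eta>s k q) e (x' - z)\<bar> \<le> B k * norm (x' - z)"
        using U[OF z'(1), of k] unfolding q_def by blast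
      show "\<exists>\<rho>>0. \<forall>y\<in>cball 0 r \<inter> ball x \<nu>. norm (y - z) < \<rho> \<longrightarrow>
          norm ((U k y - slope (\<eta> p) e y) - (U k z - slope (\<eta> p) e z)) \<le> \<tau> * norm (y - z)"
      proof (intro exI[of _ \<epsilon>] conjI ballI impI \<epsilon>)
        fix y assume y: "y \<in> cball 0 r \<inter> ball x \<nu>" "norm (y - z) < \<epsilon>"
        have "(U k y - slope (\<eta> p) e y) - (U k z - slope (\<eta> p) e z)
           = (U k y - U k z - slope (\<eta>s k q) e (y - z)) + (slope (\<eta>s k q) e - slope (\<eta> p) e) (y - z)"
          by (simp add: blinfun.bilinear_simps)
        moreover have "\<bar>U k y - U k z - slope (\<eta>s k q) e (y - z)\<bar> \<le> \<tau> / 2 * norm (y - z)"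
          using y by (intro order_trans[OF \<epsilon>(2)] mult_right_mono) (use k in auto)
        moreover have "\<bar>(slope (\<eta>s k q) e - slope (\<eta> p) e) (y - z)\<bar> \<le> \<tau> / 2 * norm (y - z)"
          using order_trans[OF norm_blinfun mult_right_mono[OF sl norm_ge_zero]] by simp
        ultimately show "norm ((U k y - slope (\<eta> p) e y) - (U k z - slope (\<eta> p) e z)) \<le> \<tau> * norm (y - z)"
          unfolding real_norm_def by linarith
      qed
    qed
    have "norm (u y - u x - slope (\<eta> p) e (y - x)) \<le> \<tau> * norm (y - x)"
      if y: "y \<in> cball 0 r" "norm (y - x) < \<nu>" for y
    proof (rule tendsto_upperbound)
      show "(\<lambda>n. norm ((U (\<sigma> n) y - slope (\<eta> p) e y) - (U (\<sigma> n) x - slope (\<eta> p) e x)))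
          \<longlonglongrightarrow> norm (u y - u x - slope (\<eta> p) e (y - x))"
      proof -
        have "u y - u x - slope (\<eta> p) e (y - x) = (u y - slope (\<eta> p) e y) - (u x - slope (\<eta> p) e x)"
          by (simp add: blinfun.bilinear_simps)
        moreover have "norm y \<le> r" using y by simp
        ultimately show ?thesis
          by (simp only:) (intro tendsto_norm tendsto_diff tendsto_const pt x)
      qed
      show "\<forall>\<^sub>F n in sequentially. norm ((U (\<sigma> n) y - slope (\<eta> p) e y) - (U (\<sigma> n) x - slope (\<eta> p) e x)) \<le> \<tau> * norm (y - x)"
        using ev by eventually_elim (use est y in auto)
    qed simp
    then show "\<exists>d>0. \<forall>y\<in>cball 0 r. norm (y - x) < d \<longrightarrow>
        norm (u y - u x - slope (\<eta> (x0 + x + u x *\<^sub>R e)) e (y - x)) \<le> \<tau> * norm (y - x)"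
      using \<nu>(1) unfolding p_def by blast
  qed
  show thesis using that[OF u0 uK der] .
qed

text \<open>
  Makes room for the second order errors of the approximate leaves without spoiling the convergence to zero.
\<close>
lemma exp_perturbation:
  fixes \<rho> d \<epsilon> :: real
  assumes "\<epsilon> > 0"
  obtains \<tau> where "\<tau> > 0" "(\<rho> + \<tau>) * exp (d + \<tau>) \<le> \<rho> * exp d + \<epsilon>"
proof -
  have "((\<lambda>\<tau>. (\<rho> + \<tau>) * exp (d + \<tau>)) \<longlongrightarrow> (\<rho> + 0) * exp (d + 0)) (at_right 0)"
    by (intro tendsto_intros)
  then have "\<forall>\<^sub>F \<tau> in at_right 0. (\<rho> + \<tau>) * exp (d + \<tau>) < \<rho> * exp d + \<epsilon>"
    using assms by (intro order_tendstoD) auto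
  then have "\<forall>\<^sub>F \<tau> in at_right 0. \<tau> > 0 \<and> (\<rho> + \<tau>) * exp (d + \<tau>) < \<rho> * exp d + \<epsilon>"
    by (intro eventually_conj) (auto simp: eventually_at_right_less)
  from eventually_happens[OF this] that show thesis by (auto simp: less_imp_le)
qed

text \<open>
  The radius \<open>r\<close> is chosen so small that the product of the length of the rays and all constants in the
  exponent is at most one; only then does the assumption on \<open>\<rho> k * exp (d k)\<close> suffice.
\<close>
theorem leaf_exists:
  fixes \<eta> :: "'e::euclidean_space \<Rightarrow> 'e \<Rightarrow>\<^sub>L real" and \<eta>s :: "nat \<Rightarrow> 'e \<Rightarrow> 'e \<Rightarrow>\<^sub>L real"
  assumes V: "open V" "cball x0 R0 \<subseteq> V" "R0 > 0"
    and c\<eta>: "continuous_on V \<eta>" and e: "\<eta> x0 e = 1"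
    and C1: "\<And>k. C_k_on 1 V (\<eta>s k)"
    and close: "\<And>k y. y \<in> cball x0 R0 \<Longrightarrow> norm (\<eta>s k y - \<eta> y) \<le> \<delta> k" and \<delta>: "\<delta> \<longlonglongrightarrow> 0"
    and \<omega>: "\<And>k y u v. y \<in> cball x0 R0 \<Longrightarrow> \<bar>ext_deriv (\<eta>s k) y u v\<bar> \<le> C * d k * norm u * norm v"
    and wedge: "\<And>k y u v w. y \<in> cball x0 R0 \<Longrightarrow>
      \<bar>wedge_1_2 (\<eta>s k) (ext_deriv (\<eta>s k)) y u v w\<bar> \<le> C * \<rho> k * norm u * norm v * norm w"
    and nn: "0 \<le> C" "\<And>k. 0 \<le> d k" "\<And>k. 0 \<le> \<rho> k"
    and lim: "(\<lambda>k. \<rho> k * exp (d k)) \<longlonglongrightarrow> 0"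
  obtains r u where "r > 0" "u 0 = 0" "\<And>x. norm x \<le> r \<Longrightarrow> x0 + x + u x *\<^sub>R e \<in> cball x0 R0"
    "\<And>x. norm x \<le> r \<Longrightarrow> \<eta> (x0 + x + u x *\<^sub>R e) e \<ge> 1/2"
    "\<And>x. norm x \<le> r \<Longrightarrow>
      (u has_derivative slope (\<eta> (x0 + x + u x *\<^sub>R e)) e) (at x within cball 0 r)"
proof -
  define \<beta> where "\<beta> = 1 / (4 * (norm e + 1))"
  have \<beta>: "\<beta> > 0" "\<beta> * norm e \<le> 1/4" "\<beta> \<le> 1"
    by (auto simp: \<beta>_def field_simps add_pos_nonneg add_nonneg_pos)
  have x0V: "x0 \<in> V" using V by auto
  then have "isCont \<eta> x0" using c\<eta> V(1) by (simp add: continuous_on_eq_continuous_at)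
  then obtain R1 where R1: "R1 > 0" "\<And>y. dist y x0 < R1 \<Longrightarrow> dist (\<eta> y) (\<eta> x0) < \<beta>"
    unfolding continuous_at_eps_delta using \<beta>(1) by meson
  define R where "R = min R0 (R1 / 2)"
  have R: "R > 0" "R \<le> R0" "R < R1" using R1 V by (auto simp: R_def)
  define K where "K = cball x0 R"
  have KV: "K \<subseteq> V" "K \<subseteq> cball x0 R0" using R V by (auto simp: K_def)
  have near: "norm (\<eta> y - \<eta> x0) \<le> \<beta>" if "y \<in> K" for y
  proof -
    have "dist y x0 < R1" using that R by (auto simp: K_def dist_commute)
    then show ?thesis using R1(2)[of y] by (simp add: dist_norm)
  qed
  \<comment> \<open>From index N on the forms are transverse to e on K; the sequence is shifted accordingly.\<close>
  obtain N where N: "\<And>k. k \<ge> N \<Longrightarrow> \<delta> k < \<beta>"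
    using order_tendstoD(2)[OF \<delta> \<beta>(1)] by (auto simp: eventually_sequentially)
  define M where "M = norm (\<eta> x0) + 2"
  have M0: "0 \<le> M" by (simp add: M_def add_nonneg_nonneg)
  have val: "a e \<ge> 1/2 \<and> norm a \<le> M" if "norm (a - \<eta> x0) \<le> 2 * \<beta>" for a
  proof
    have "\<bar>(a - \<eta> x0) e\<bar> \<le> norm (a - \<eta> x0) * norm e" using norm_blinfun[of "a - \<eta> x0" e] by simp
    also have "\<dots> \<le> (2 * \<beta>) * norm e" using that by (intro mult_right_mono) auto
    also have "\<dots> \<le> 1/2" using \<beta> by simp
    finally have "\<bar>a e - 1\<bar> \<le> 1/2" using e by (simp add: blinfun.diff_left)
    then show "a e \<ge> 1/2" by linarith
    have "norm a \<le> norm (a - \<eta> x0) + norm (\<eta> x0)" using norm_triangle_ineq[of "a - \<eta> x0" "\<eta> x0"] by simp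
    then show "norm a \<le> M" using that \<beta> by (simp add: M_def)
  qed
  have v1: "\<eta> y e \<ge> 1/2" "norm (\<eta> y) \<le> M" if "y \<in> K" for y
    using val[of "\<eta> y"] near[OF that] \<beta> by auto
  have v2: "\<eta>s (k + N) y e \<ge> 1/2" "norm (\<eta>s (k + N) y) \<le> M" if "y \<in> K" for k y
  proof -
    have "norm (\<eta>s (k + N) y - \<eta> y) \<le> \<beta>" using close[of y "k + N"] N[of "k + N"] that KV by auto
    then have "norm (\<eta>s (k + N) y - \<eta> x0) \<le> 2 * \<beta>"
      using near[OF that] norm_triangle_ineq[of "\<eta>s (k + N) y - \<eta> y" "\<eta> y - \<eta> x0"] by simp
    then show "\<eta>s (k + N) y e \<ge> 1/2" "norm (\<eta>s (k + N) y) \<le> M" using val by auto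
  qed
  define q where "q = 1 + 2 * M * norm e"
  have q: "q > 0" using M0 by (simp add: q_def add_pos_nonneg)
  define S where "S = min R (1 / (2 * norm e * C + 1))"
  have eC: "2 * norm e * C + 1 > 0" using nn by (simp add: add_nonneg_pos)
  have S: "S > 0" "S \<le> R" using R eC by (auto simp: S_def)
  \<comment> \<open>This smallness of S keeps the exponents below d k.\<close>
  have SC: "2 * S * norm e * C \<le> 1"
  proof -
    have "S * (2 * norm e * C) \<le> S * (2 * norm e * C + 1)" using S by (intro mult_left_mono) auto
    also have "\<dots> \<le> 1 / (2 * norm e * C + 1) * (2 * norm e * C + 1)"
      using eC by (intro mult_right_mono) (auto simp: S_def)
    also have "\<dots> = 1" using eC by simp
    finally show ?thesis by (simp add: algebra_simps)
  qed
  define r where "r = S / q"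
  have r: "r > 0" "S = r * q" using S q by (simp_all add: r_def)
  define B where "B k = 2 * (\<rho> (k + N) * exp (d (k + N)) + inverse (real (Suc k)))" for k
  have inB: "x0 + x + z *\<^sub>R e \<in> K" if "norm x \<le> r" "\<bar>z\<bar> \<le> 2 * M * norm x" for x z
  proof -
    have "norm (x + z *\<^sub>R e) \<le> norm x + \<bar>z\<bar> * norm e" by (metis norm_scaleR norm_triangle_ineq)
    also have "\<dots> \<le> norm x + (2 * M * norm x) * norm e" using that by (intro add_mono mult_right_mono) auto
    also have "\<dots> = q * norm x" by (simp add: q_def algebra_simps)
    also have "\<dots> \<le> q * r" using that q by (intro mult_left_mono) auto
    also have "\<dots> \<le> R" using S r by (simp add: mult.commute)
    finally have "norm (x + z *\<^sub>R e) \<le> R" .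
    moreover have "x0 - (x0 + x + z *\<^sub>R e) = - (x + z *\<^sub>R e)" by simp
    ultimately show ?thesis by (simp only: K_def mem_cball dist_norm norm_minus_cancel)
  qed
  have "\<exists>u. (\<forall>x. norm x \<le> r \<longrightarrow> \<bar>u x\<bar> \<le> 2 * M * norm x) \<and>
     (\<forall>x. norm x \<le> r \<longrightarrow> (\<exists>\<delta>>0. \<forall>x'. norm x' \<le> r \<and> norm (x' - x) < \<delta> \<longrightarrow>
       \<bar>u x' - u x - slope (\<eta>s (k + N) (x0 + x + u x *\<^sub>R e)) e (x' - x)\<bar> \<le> B k * norm (x' - x)))" for k
  proof -
    define n where "n = k + N"
    obtain \<alpha>' where \<alpha>': "\<And>y. y \<in> V \<Longrightarrow> (\<eta>s n has_derivative blinfun_apply (\<alpha>' y)) (at y)" "continuous_on V \<alpha>'"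
      using C1[of n] unfolding C_1_on_iff[OF V(1)] by blast
    obtain \<tau> where \<tau>: "\<tau> > 0" "(\<rho> n + \<tau>) * exp (d n + \<tau>) \<le> \<rho> n * exp (d n) + inverse (real (Suc k))"
      by (rule exp_perturbation[of "inverse (real (Suc k))"]) auto
    obtain u where u: "\<And>x. norm x \<le> r \<Longrightarrow> \<bar>u x\<bar> \<le> 2 * M * norm x"
      "\<And>x. norm x \<le> r \<Longrightarrow> \<exists>\<delta>>0. \<forall>x'. norm x' \<le> r \<and> norm (x' - x) < \<delta> \<longrightarrow>
         \<bar>u x' - u x - slope (\<eta>s n (x0 + x + u x *\<^sub>R e)) e (x' - x)\<bar>
         \<le> 2 * (2 * S * norm e * (C * \<rho> n) + \<tau>) * exp (2 * S * norm e * (C * d n) + \<tau>) * norm (x' - x)"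
    proof (rule approximate_leaf[of r R S M e x0 "\<eta>s n" \<alpha>' "C * d n" "C * \<rho> n" \<tau>])
      fix y assume y: "y \<in> cball x0 R"
      then have yV: "y \<in> V" "y \<in> cball x0 R0" and yK: "y \<in> K" using KV by (auto simp: K_def)
      note ed = ext_deriv_eq[OF \<alpha>'(1)[OF yV(1)]]
      show "(\<eta>s n has_derivative blinfun_apply (\<alpha>' y)) (at y)" by (rule \<alpha>'(1)[OF yV(1)])
      show "1/2 \<le> \<eta>s n y e" "norm (\<eta>s n y) \<le> M" using v2[OF yK] by (auto simp: n_def)
      show "\<bar>\<alpha>' y u v - \<alpha>' y v u\<bar> \<le> C * d n * norm u * norm v" for u v
        using \<omega>[OF yV(2), of n u v] by (simp add: ed)
      show "\<bar>\<eta>s n y u * (\<alpha>' y v w - \<alpha>' y w v) + \<eta>s n y v * (\<alpha>' y w u - \<alpha>' y u w) + \<eta>s n y w * (\<alpha>' y u v - \<alpha>' y v u)\<bar>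
         \<le> C * \<rho> n * norm u * norm v * norm w" for u v w
        using wedge[OF yV(2), of n u v w] by (simp add: ed wedge_1_2_def)
    qed (use r R S nn \<tau> \<alpha>'(2) KV in \<open>auto simp: q_def K_def intro: continuous_on_subset\<close>)
    have "2 * (2 * S * norm e * (C * \<rho> n) + \<tau>) * exp (2 * S * norm e * (C * d n) + \<tau>) \<le> B k"
    proof -
      have l: "2 * S * norm e * (C * z) \<le> z" if "z \<ge> 0" for z
        using mult_right_mono[OF SC that] by (simp add: algebra_simps)
      have "(2 * S * norm e * (C * \<rho> n) + \<tau>) * exp (2 * S * norm e * (C * d n) + \<tau>) \<le> (\<rho> n + \<tau>) * exp (d n + \<tau>)"
        using l[OF nn(2)[of n]] l[OF nn(3)[of n]] nn \<tau> by (intro mult_mono) auto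
      then show ?thesis using \<tau> unfolding B_def n_def by (simp add: algebra_simps)
    qed
    then have "\<exists>\<delta>>0. \<forall>x'. norm x' \<le> r \<and> norm (x' - x) < \<delta> \<longrightarrow>
         \<bar>u x' - u x - slope (\<eta>s n (x0 + x + u x *\<^sub>R e)) e (x' - x)\<bar> \<le> B k * norm (x' - x)" if "norm x \<le> r" for x
      using u(2)[OF that] by (meson mult_right_mono norm_ge_zero order_trans)
    then show ?thesis using u(1) unfolding n_def by blast
  qed
  then obtain U where U: "\<And>k x. norm x \<le> r \<Longrightarrow> \<bar>U k x\<bar> \<le> 2 * M * norm x"
     "\<And>k x. norm x \<le> r \<Longrightarrow> \<exists>\<delta>>0. \<forall>x'. norm x' \<le> r \<and> norm (x' - x) < \<delta> \<longrightarrow>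
       \<bar>U k x' - U k x - slope (\<eta>s (k + N) (x0 + x + U k x *\<^sub>R e)) e (x' - x)\<bar> \<le> B k * norm (x' - x)"
    by metis
  obtain u where u: "u 0 = 0" "\<And>x. norm x \<le> r \<Longrightarrow> x0 + x + u x *\<^sub>R e \<in> K"
    "\<And>x. norm x \<le> r \<Longrightarrow>
      (u has_derivative slope (\<eta> (x0 + x + u x *\<^sub>R e)) e) (at x within cball 0 r)"
  proof (rule uniform_limit_of_approximate_leaves[of r M K \<eta> e "\<lambda>k. \<eta>s (k + N)" "\<lambda>k. \<delta> (k + N)" B x0 U])
    show "(\<lambda>k. \<delta> (k + N)) \<longlonglongrightarrow> 0" by (rule LIMSEQ_ignore_initial_segment[OF \<delta>])
    have "(\<lambda>k. 2 * (\<rho> (k + N) * exp (d (k + N)) + inverse (real (Suc k)))) \<longlonglongrightarrow> 2 * (0 + 0)"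
      by (intro tendsto_intros LIMSEQ_inverse_real_of_nat LIMSEQ_ignore_initial_segment[OF lim])
    then show "B \<longlonglongrightarrow> 0" by (simp add: B_def[abs_def])
  qed (use r M0 v1 v2 U inB KV close in \<open>auto simp: K_def intro: continuous_on_subset[OF c\<eta>]\<close>)
  show thesis
    using that[OF r(1) u(1) _ _ u(3)] u(2) KV v1 by blast
qed

section \<open>Integral curves over a common base curve\<close>

text \<open>
  Stokes' theorem for the strip swept out by the segments from \<open>\<gamma> t\<close> to \<open>\<gamma>' t\<close>, in differential form: the
  derivative in \<open>t\<close> of the integral of \<open>\<alpha>\<close> over the segment is the integral of \<open>d\<alpha>\<close> over the segment plus the
  values of \<open>\<alpha>\<close> on the two boundary velocities.  Since \<open>\<alpha> e\<close> is bounded below, that integral also bounds the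
  length of the segment, which closes the Gronwall loop.
\<close>
lemma thin_region_bound:
  fixes \<alpha> :: "'e::euclidean_space \<Rightarrow> 'e \<Rightarrow>\<^sub>L real" and \<gamma> \<gamma>' v v' :: "real \<Rightarrow> 'e"
  assumes K: "convex K"
    and der: "\<And>y. y \<in> K \<Longrightarrow> (\<alpha> has_derivative blinfun_apply (A y)) (at y)"
    and cA: "continuous_on K A"
    and ae: "\<And>y. y \<in> K \<Longrightarrow> \<alpha> y e \<ge> 1/2"
    and \<omega>: "\<And>y u v. y \<in> K \<Longrightarrow> \<bar>A y u v - A y v u\<bar> \<le> D * norm u * norm v"
    and \<gamma>: "\<And>t. t \<in> {0..1} \<Longrightarrow> (\<gamma> has_vector_derivative v t) (at t within {0..1})"
    and \<gamma>': "\<And>t. t \<in> {0..1} \<Longrightarrow> (\<gamma>' has_vector_derivative v' t) (at t within {0..1})"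
    and cv: "continuous_on {0..1} v" "continuous_on {0..1} v'"
    and inK: "\<And>t. t \<in> {0..1} \<Longrightarrow> \<gamma> t \<in> K" "\<And>t. t \<in> {0..1} \<Longrightarrow> \<gamma>' t \<in> K"
    and S: "\<And>t. t \<in> {0..1} \<Longrightarrow> norm (v t) \<le> S" "\<And>t. t \<in> {0..1} \<Longrightarrow> norm (v' t) \<le> S"
    and \<kappa>: "\<And>t. t \<in> {0..1} \<Longrightarrow> \<bar>\<alpha> (\<gamma> t) (v t)\<bar> \<le> \<kappa>" "\<And>t. t \<in> {0..1} \<Longrightarrow> \<bar>\<alpha> (\<gamma>' t) (v' t)\<bar> \<le> \<kappa>"
    and e: "\<And>t. t \<in> {0..1} \<Longrightarrow> \<gamma>' t - \<gamma> t = s t *\<^sub>R e"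
    and start: "\<gamma> 0 = \<gamma>' 0" and D: "0 \<le> D"
  shows "norm (\<gamma>' 1 - \<gamma> 1) \<le> 2 * norm e * (2 * \<kappa> * exp (2 * S * norm e * D))"
proof -
  \<comment> \<open>The segments between the curves, and their velocities.\<close>
  define \<Gamma> where "\<Gamma> t \<sigma> = \<gamma> t + \<sigma> *\<^sub>R (\<gamma>' t - \<gamma> t)" for t \<sigma>
  define W where "W t \<sigma> = v t + \<sigma> *\<^sub>R (v' t - v t)" for t \<sigma>
  define d where "d t = \<gamma>' t - \<gamma> t" for t
  have \<Gamma>K: "\<Gamma> t \<sigma> \<in> K" if "t \<in> {0..1}" "\<sigma> \<in> {0..1}" for t \<sigma>
  proof -
    have "\<Gamma> t \<sigma> = (1 - \<sigma>) *\<^sub>R \<gamma> t + \<sigma> *\<^sub>R \<gamma>' t" by (simp add: \<Gamma>_def algebra_simps)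
    then show ?thesis using convexD_alt[OF K inK(1)[OF that(1)] inK(2)[OF that(1)]] that by simp
  qed
  have WS: "norm (W t \<sigma>) \<le> S" if "t \<in> {0..1}" "\<sigma> \<in> {0..1}" for t \<sigma>
  proof -
    have "W t \<sigma> = (1 - \<sigma>) *\<^sub>R v t + \<sigma> *\<^sub>R v' t" by (simp add: W_def algebra_simps)
    then show ?thesis using convexD_alt[OF convex_cball[of 0 S], of "v t" "v' t" \<sigma>] S[OF that(1)] that by simp
  qed
  have S0: "0 \<le> S" using order_trans[OF norm_ge_zero S(1)[of 0]] by simp
  have \<kappa>0: "0 \<le> \<kappa>" using \<kappa>(1)[of 0] by simp
  have c\<alpha>: "continuous_on K \<alpha>"
    by (rule has_derivative_continuous_on[OF has_derivative_at_withinI[OF der]])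
  have c\<gamma>: "continuous_on {0..1} \<gamma>" "continuous_on {0..1} \<gamma>'"
    unfolding continuous_on_eq_continuous_within
    using \<gamma> \<gamma>' has_vector_derivative_continuous by blast+
  note c2 = continuous_on_compose2[OF _ continuous_on_fst[OF continuous_on_id]]
  let ?Q = "{0..1} \<times> {0..1} :: (real \<times> real) set"
  have cQ: "continuous_on ?Q (\<lambda>p. \<Gamma> (fst p) (snd p))" "continuous_on ?Q (\<lambda>p. W (fst p) (snd p))"
    "continuous_on ?Q (\<lambda>p. d (fst p))" "continuous_on ?Q (\<lambda>p. v' (fst p) - v (fst p))"
    unfolding \<Gamma>_def W_def d_def
    by (intro continuous_intros c2[OF c\<gamma>(1)] c2[OF c\<gamma>(2)] c2[OF cv(1)] c2[OF cv(2)]; force)+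
  have cAQ: "continuous_on ?Q (\<lambda>p. A (\<Gamma> (fst p) (snd p)))" "continuous_on ?Q (\<lambda>p. \<alpha> (\<Gamma> (fst p) (snd p)))"
    by (rule continuous_on_compose2[OF cA cQ(1)] continuous_on_compose2[OF c\<alpha> cQ(1)]; use \<Gamma>K in force)+
  define f where "f t \<sigma> = \<alpha> (\<Gamma> t \<sigma>) (d t)" for t \<sigma>
  define ft where "ft t \<sigma> = A (\<Gamma> t \<sigma>) (W t \<sigma>) (d t) + \<alpha> (\<Gamma> t \<sigma>) (v' t - v t)" for t \<sigma>
  \<comment> \<open>The derivative of the form on W in the direction of the segment; it differs from ft by an exterior derivative.\<close>
  define h where "h t \<sigma> = A (\<Gamma> t \<sigma>) (d t) (W t \<sigma>) + \<alpha> (\<Gamma> t \<sigma>) (v' t - v t)" for t \<sigma>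
  have cf: "continuous_on ?Q (\<lambda>p. f (fst p) (snd p))" "continuous_on ?Q (\<lambda>p. ft (fst p) (snd p))"
    "continuous_on ?Q (\<lambda>p. h (fst p) (snd p))"
    unfolding f_def ft_def h_def by (intro continuous_intros cQ cAQ)+
  have slice: "continuous_on {0..1} (g t)" if "continuous_on ?Q (\<lambda>p. g (fst p) (snd p))" "t \<in> {0..1}"
    for g :: "real \<Rightarrow> real \<Rightarrow> real" and t
    using continuous_on_compose2[OF that(1), of "{0..1}" "Pair t"] that(2)
    by (force intro: continuous_on_Pair continuous_on_const continuous_on_id)
  have df: "((\<lambda>t. f t \<sigma>) has_field_derivative ft t \<sigma>) (at t within {0..1})"
    if t: "t \<in> {0..1}" and \<sigma>: "\<sigma> \<in> {0..1}" for t \<sigma>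
  proof -
    have \<Gamma>': "((\<lambda>t. \<Gamma> t \<sigma>) has_vector_derivative W t \<sigma>) (at t within {0..1})"
      unfolding \<Gamma>_def W_def using \<gamma>[OF t] \<gamma>'[OF t]
      by (auto intro!: derivative_eq_intros)
    have "((\<lambda>t. \<alpha> (\<Gamma> t \<sigma>)) has_vector_derivative A (\<Gamma> t \<sigma>) (W t \<sigma>)) (at t within {0..1})"
      using has_derivative_compose[OF \<Gamma>'[unfolded has_vector_derivative_def] der[OF \<Gamma>K[OF t \<sigma>]]]
      by (simp add: has_vector_derivative_def blinfun.scaleR_right)
    then show ?thesis
      unfolding f_def[abs_def] ft_def d_def has_real_derivative_iff_has_vector_derivative
      using bounded_bilinear.has_vector_derivative[OF bounded_bilinear_blinfun_apply _
          has_vector_derivative_diff[OF \<gamma>'[OF t] \<gamma>[OF t]]]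
      by (simp only: add.commute[of "A _ _ _"])
  qed
  define \<phi> where "\<phi> t = integral {0..1} (f t)" for t
  have d\<phi>: "(\<phi> has_real_derivative integral {0..1} (ft t)) (at t within {0..1})" if t: "t \<in> {0..1}" for t
    unfolding \<phi>_def
    by (rule leibniz_rule_field_derivative[where a = "0::real" and b = 1 and f = f and fx = ft, unfolded cbox_interval])
      (use t df cf(2) integrable_continuous_real[OF slice[OF cf(1)]] in \<open>auto simp: case_prod_beta\<close>)
  have ih: "integral {0..1} (h t) = \<alpha> (\<gamma>' t) (v' t) - \<alpha> (\<gamma> t) (v t)" if t: "t \<in> {0..1}" for t
  proof -
    have "(h t has_integral (\<alpha> (\<Gamma> t 1) (W t 1) - \<alpha> (\<Gamma> t 0) (W t 0))) {0..1}"
    proof (rule fundamental_theorem_of_calculus)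
      fix \<sigma> :: real assume \<sigma>: "\<sigma> \<in> {0..1}"
      have \<Gamma>': "((\<lambda>\<sigma>. \<Gamma> t \<sigma>) has_vector_derivative d t) (at \<sigma> within {0..1})"
        unfolding \<Gamma>_def d_def by (auto intro!: derivative_eq_intros)
      have W': "((\<lambda>\<sigma>. W t \<sigma>) has_vector_derivative v' t - v t) (at \<sigma> within {0..1})"
        unfolding W_def by (auto intro!: derivative_eq_intros)
      have "((\<lambda>\<sigma>. \<alpha> (\<Gamma> t \<sigma>)) has_vector_derivative A (\<Gamma> t \<sigma>) (d t)) (at \<sigma> within {0..1})"
        using has_derivative_compose[OF \<Gamma>'[unfolded has_vector_derivative_def] der[OF \<Gamma>K[OF t \<sigma>]]]
        by (simp add: has_vector_derivative_def blinfun.scaleR_right)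
      from bounded_bilinear.has_vector_derivative[OF bounded_bilinear_blinfun_apply this W']
      show "((\<lambda>\<sigma>. \<alpha> (\<Gamma> t \<sigma>) (W t \<sigma>)) has_vector_derivative h t \<sigma>) (at \<sigma> within {0..1})"
        by (simp only: h_def add.commute[of "A _ _ _"])
    qed simp
    then show ?thesis by (simp add: integral_unique \<Gamma>_def W_def)
  qed
  have nd: "norm (d t) \<le> 2 * norm e * \<bar>\<phi> t\<bar>" if t: "t \<in> {0..1}" for t
  proof -
    define g where "g \<sigma> = \<alpha> (\<Gamma> t \<sigma>) e" for \<sigma>
    have cg: "continuous_on {0..1} g"
      unfolding g_def
      by (rule slice[of "\<lambda>t \<sigma>. \<alpha> (\<Gamma> t \<sigma>) e", OF _ t]) (intro continuous_intros cAQ)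
    have "integral {0..1} (\<lambda>\<sigma>::real. 1/2::real) \<le> integral {0..1} g"
      using cg ae \<Gamma>K[OF t] by (intro integral_le integrable_continuous_real) (auto simp: g_def)
    then have g: "1/2 \<le> integral {0..1} g" by simp
    have "\<phi> t = s t * integral {0..1} g"
      by (simp add: \<phi>_def f_def[abs_def] d_def e[OF t] g_def[abs_def] blinfun.scaleR_right)
    then have "\<bar>\<phi> t\<bar> = \<bar>s t\<bar> * integral {0..1} g" using g by (simp add: abs_mult)
    then have "\<bar>s t\<bar> \<le> 2 * \<bar>\<phi> t\<bar>" using mult_left_mono[OF g, of "\<bar>s t\<bar>"] by simp
    then show ?thesis using mult_right_mono[of "\<bar>s t\<bar>" "2 * \<bar>\<phi> t\<bar>" "norm e"]
      by (simp add: d_def e[OF t] algebra_simps)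
  qed
  have "\<bar>\<phi> 1\<bar> \<le> (2 * \<kappa>) * exp (2 * S * norm e * D)"
  proof (rule gronwall_unit[OF d\<phi>])
    show "\<phi> 0 = 0" by (simp add: \<phi>_def f_def[abs_def] d_def start blinfun.zero_right)
    fix t :: real assume t: "t \<in> {0..1}"
    note i = integrable_continuous_real[OF slice[OF cf(2) t]] integrable_continuous_real[OF slice[OF cf(3) t]]
    have "integral {0..1} (ft t) - integral {0..1} (h t) = integral {0..1} (\<lambda>\<sigma>. ft t \<sigma> - h t \<sigma>)"
      using i by (simp add: integral_diff)
    also have "norm \<dots> \<le> integral {0..1} (\<lambda>\<sigma>::real. D * S * norm (d t))"
    proof (rule integral_norm_bound_integral)
      fix \<sigma> :: real assume \<sigma>: "\<sigma> \<in> {0..1}"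
      have "\<bar>A (\<Gamma> t \<sigma>) (W t \<sigma>) (d t) - A (\<Gamma> t \<sigma>) (d t) (W t \<sigma>)\<bar> \<le> D * norm (W t \<sigma>) * norm (d t)"
        by (rule \<omega>[OF \<Gamma>K[OF t \<sigma>]])
      also have "\<dots> \<le> D * S * norm (d t)"
        using WS[OF t \<sigma>] D by (intro mult_right_mono mult_left_mono) auto
      finally show "norm (ft t \<sigma> - h t \<sigma>) \<le> D * S * norm (d t)" by (simp add: ft_def h_def)
    qed (use i in \<open>auto intro: integrable_diff\<close>)
    also have "\<dots> = D * S * norm (d t)" by simp
    also have "\<dots> \<le> D * S * (2 * norm e * \<bar>\<phi> t\<bar>)"
      using nd[OF t] D S0 by (intro mult_left_mono) auto
    finally have "\<bar>integral {0..1} (ft t) - integral {0..1} (h t)\<bar> \<le> 2 * S * norm e * D * \<bar>\<phi> t\<bar>"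
      by (simp add: algebra_simps)
    moreover have "\<bar>integral {0..1} (h t)\<bar> \<le> 2 * \<kappa>" using \<kappa>[OF t] by (simp add: ih[OF t])
    ultimately show "\<bar>integral {0..1} (ft t)\<bar> \<le> 2 * S * norm e * D * \<bar>\<phi> t\<bar> + 2 * \<kappa>" by linarith
  qed (use S0 D \<kappa>0 in auto)
  then have "2 * norm e * \<bar>\<phi> 1\<bar> \<le> 2 * norm e * ((2 * \<kappa>) * exp (2 * S * norm e * D))"
    by (intro mult_left_mono) auto
  moreover have "norm (\<gamma>' 1 - \<gamma> 1) \<le> 2 * norm e * \<bar>\<phi> 1\<bar>" using nd[of 1] by (simp add: d_def)
  ultimately show ?thesis by (rule order_trans[rotated])
qed

text \<open>
  A curve tangent to the kernel of \<open>\<eta>\<close> is nearly tangent to that of \<open>\<eta>s k\<close>.  The bound \<open>SC\<close> on the speed keeps the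
  exponent of the previous estimate below \<open>d k\<close>.
\<close>
theorem integral_curves_coincide:
  fixes \<eta> :: "'e::euclidean_space \<Rightarrow> 'e \<Rightarrow>\<^sub>L real" and \<eta>s :: "nat \<Rightarrow> 'e \<Rightarrow> 'e \<Rightarrow>\<^sub>L real"
    and \<gamma> \<gamma>' v v' :: "real \<Rightarrow> 'e"
  assumes V: "open V" "cball x0 R \<subseteq> V"
    and C1: "\<And>k. C_k_on 1 V (\<eta>s k)"
    and ae: "\<And>y. y \<in> cball x0 R \<Longrightarrow> \<eta> y e \<ge> 3/4"
    and close: "\<And>k y. y \<in> cball x0 R \<Longrightarrow> norm (\<eta>s k y - \<eta> y) \<le> C * \<delta> k" and \<delta>: "\<delta> \<longlonglongrightarrow> 0"
    and \<omega>: "\<And>k y u v. y \<in> cball x0 R \<Longrightarrow> \<bar>ext_deriv (\<eta>s k) y u v\<bar> \<le> C * d k * norm u * norm v"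
    and nn: "0 \<le> C" "\<And>k. 0 \<le> d k"
    and lim: "(\<lambda>k. \<delta> k * exp (d k)) \<longlonglongrightarrow> 0"
    and \<gamma>: "\<And>t. t \<in> {0..1} \<Longrightarrow> (\<gamma> has_vector_derivative v t) (at t within {0..1})"
    and \<gamma>': "\<And>t. t \<in> {0..1} \<Longrightarrow> (\<gamma>' has_vector_derivative v' t) (at t within {0..1})"
    and cv: "continuous_on {0..1} v" "continuous_on {0..1} v'"
    and inK: "\<And>t. t \<in> {0..1} \<Longrightarrow> \<gamma> t \<in> cball x0 R" "\<And>t. t \<in> {0..1} \<Longrightarrow> \<gamma>' t \<in> cball x0 R"
    and S: "\<And>t. t \<in> {0..1} \<Longrightarrow> norm (v t) \<le> S" "\<And>t. t \<in> {0..1} \<Longrightarrow> norm (v' t) \<le> S"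
    and SC: "2 * S * norm e * C \<le> 1"
    and tangent: "\<And>t. t \<in> {0..1} \<Longrightarrow> \<eta> (\<gamma> t) (v t) = 0" "\<And>t. t \<in> {0..1} \<Longrightarrow> \<eta> (\<gamma>' t) (v' t) = 0"
    and e: "\<And>t. t \<in> {0..1} \<Longrightarrow> \<gamma>' t - \<gamma> t = s t *\<^sub>R e"
    and start: "\<gamma> 0 = \<gamma>' 0"
  shows "\<gamma> 1 = \<gamma>' 1"
proof -
  have S0: "0 \<le> S" using order_trans[OF norm_ge_zero S(1)[of 0]] by simp
  have "(\<lambda>k. C * \<delta> k * norm e) \<longlonglongrightarrow> C * 0 * norm e" by (intro tendsto_intros \<delta>)
  then have "\<forall>\<^sub>F k in sequentially. C * \<delta> k * norm e < 1/4"
    by (intro order_tendstoD(2)) auto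
  then have ev: "\<forall>\<^sub>F k in sequentially. norm (\<gamma>' 1 - \<gamma> 1) \<le> 2 * norm e * (2 * (C * S) * (\<delta> k * exp (d k)))"
  proof eventually_elim
    case (elim k)
    obtain A where A: "\<And>y. y \<in> V \<Longrightarrow> (\<eta>s k has_derivative blinfun_apply (A y)) (at y)" "continuous_on V A"
      using C1[of k] unfolding C_1_on_iff[OF V(1)] by blast
    have small: "\<bar>(\<eta>s k y - \<eta> y) u\<bar> \<le> C * \<delta> k * norm u" if "y \<in> cball x0 R" for y u
      using order_trans[OF norm_blinfun mult_right_mono[OF close[OF that] norm_ge_zero]] by simp
    have "x0 \<in> cball x0 R" using inK(1)[of 0] zero_le_dist[of x0 "\<gamma> 0"] by (auto simp del: zero_le_dist)
    have C\<delta>: "0 \<le> C * \<delta> k" using order_trans[OF norm_ge_zero close[OF \<open>x0 \<in> cball x0 R\<close>]] .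
    have "norm (\<gamma>' 1 - \<gamma> 1) \<le> 2 * norm e * (2 * (C * \<delta> k * S) * exp (2 * S * norm e * (C * d k)))"
    proof (rule thin_region_bound[OF convex_cball _ continuous_on_subset[OF A(2) V(2)] _ _ \<gamma> \<gamma>' cv inK S _ _ e start])
      fix y assume y: "y \<in> cball x0 R"
      show "(\<eta>s k has_derivative blinfun_apply (A y)) (at y)" using A(1) V y by blast
      show "\<eta>s k y e \<ge> 1/2" using small[OF y, of e] elim ae[OF y] by (simp add: blinfun.diff_left)
      show "\<bar>A y u v - A y v u\<bar> \<le> C * d k * norm u * norm v" for u v
        using \<omega>[OF y, of k u v] ext_deriv_eq[OF A(1), of y u v] V y by (simp add: subset_iff)
    next
      fix t :: real assume t: "t \<in> {0..1}"
      show "\<bar>\<eta>s k (\<gamma> t) (v t)\<bar> \<le> C * \<delta> k * S"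
        using small[OF inK(1)[OF t], of "v t"] tangent(1)[OF t] mult_left_mono[OF S(1)[OF t] C\<delta>]
        by (simp add: blinfun.diff_left)
      show "\<bar>\<eta>s k (\<gamma>' t) (v' t)\<bar> \<le> C * \<delta> k * S"
        using small[OF inK(2)[OF t], of "v' t"] tangent(2)[OF t] mult_left_mono[OF S(2)[OF t] C\<delta>]
        by (simp add: blinfun.diff_left)
    qed (use nn in auto)
    also have "\<dots> \<le> 2 * norm e * (2 * (C * \<delta> k * S) * exp (d k))"
    proof -
      have "2 * S * norm e * (C * d k) \<le> d k" using mult_right_mono[OF SC nn(2)] by (simp add: algebra_simps)
      then show ?thesis using C\<delta> S0 by (intro mult_left_mono) auto
    qed
    finally show ?case by (simp add: algebra_simps)
  qed
  have "(\<lambda>k. 2 * norm e * (2 * (C * S) * (\<delta> k * exp (d k)))) \<longlonglongrightarrow> 2 * norm e * (2 * (C * S) * 0)"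
    by (intro tendsto_intros lim)
  then have "norm (\<gamma>' 1 - \<gamma> 1) \<le> 2 * norm e * (2 * (C * S) * 0)"
    using ev by (rule tendsto_lowerbound) simp
  then show ?thesis by simp
qed

section \<open>Charts and tangent vectors\<close>

lemma atlas_chart:
  assumes "smooth_atlas A" "c \<in> A"
  shows open_cdom: "open (cdom c)" and open_cimg: "open (cimg c)"
    and chart_homeomorphism: "homeomorphism (cdom c) (cimg c) (cmap c) (cinv c)"
  using assms unfolding smooth_atlas_def by auto

lemma cinv_cmap:
  assumes "smooth_atlas A" "c \<in> A" "p \<in> cdom c"
  shows "cinv c (cmap c p) = p"
  using homeomorphism_apply1[OF chart_homeomorphism[OF assms(1,2)] assms(3)] .

lemma cmap_cinv:
  assumes "smooth_atlas A" "c \<in> A" "x \<in> cimg c"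
  shows "cmap c (cinv c x) = x" "cinv c x \<in> cdom c"
  using homeomorphism_apply2[OF chart_homeomorphism[OF assms(1,2)] assms(3)]
    homeomorphism_image2[OF chart_homeomorphism[OF assms(1,2)]] assms(3) by auto

lemma cmap_in_cimg: "p \<in> cdom c \<Longrightarrow> cmap c p \<in> cimg c"
  by (simp add: cimg_def)

lemma open_chart_image:
  assumes "smooth_atlas A" "c \<in> A" "open U" "U \<subseteq> cdom c"
  shows "open (cmap c ` U)"
proof -
  have "cmap c ` U = cimg c \<inter> cinv c -` U"
  proof (intro equalityI subsetI)
    fix x assume "x \<in> cmap c ` U"
    then obtain p where "p \<in> U" "x = cmap c p" by blast
    then show "x \<in> cimg c \<inter> cinv c -` U"
      using cinv_cmap[OF assms(1,2), of p] cmap_in_cimg[of p c] assms(4) by auto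
  next
    fix x assume "x \<in> cimg c \<inter> cinv c -` U"
    then show "x \<in> cmap c ` U" using cmap_cinv(1)[OF assms(1,2), of x] by (intro image_eqI[of x _ "cinv c x"]) auto
  qed
  moreover have "continuous_on (cimg c) (cinv c)"
    using chart_homeomorphism[OF assms(1,2)] by (simp add: homeomorphism_def)
  ultimately show ?thesis
    using continuous_open_preimage open_cimg[OF assms(1,2)] assms(3) by metis
qed

lemma open_chart_preimage:
  assumes "smooth_atlas A" "c \<in> A" "open W"
  shows "open (cdom c \<inter> cmap c -` W)"
  using chart_homeomorphism[OF assms(1,2)] open_cdom[OF assms(1,2)] assms(3)
  by (intro continuous_open_preimage) (auto simp: homeomorphism_def)

lemma smooth_imp_C1: "smooth_on S f \<Longrightarrow> C_k_on 1 S f"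
  unfolding smooth_on_def by blast

lemma transition_C1:
  assumes "smooth_atlas A" "c \<in> A" "d \<in> A"
  shows "open (cmap c ` (cdom c \<inter> cdom d))" "C_k_on 1 (cmap c ` (cdom c \<inter> cdom d)) (cmap d \<circ> cinv c)"
proof -
  show "open (cmap c ` (cdom c \<inter> cdom d))"
    using open_cdom[OF assms(1,2)] open_cdom[OF assms(1,3)]
    by (intro open_chart_image[OF assms(1,2)]) auto
  show "C_k_on 1 (cmap c ` (cdom c \<inter> cdom d)) (cmap d \<circ> cinv c)"
    using assms by (intro smooth_imp_C1) (simp add: smooth_atlas_def)
qed

lemma transition_has_derivative:
  assumes "smooth_atlas A" "c \<in> A" "d \<in> A" "p \<in> cdom c" "p \<in> cdom d"
  shows "(cmap d \<circ> cinv c has_derivative coord_change c d p) (at (cmap c p))"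
proof -
  have "(cmap d \<circ> cinv c) differentiable (at (cmap c p))"
    using transition_C1(2)[OF assms(1-3)] assms(4,5) by simp
  then show ?thesis unfolding coord_change_def by (rule frechet_derivative_works[THEN iffD1])
qed

lemma coord_change_self:
  assumes "smooth_atlas A" "c \<in> A" "p \<in> cdom c"
  shows "coord_change c c p u = u"
proof -
  have "(cmap c \<circ> cinv c has_derivative (\<lambda>u. u)) (at (cmap c p))"
    by (rule has_derivative_transform_within_open[OF has_derivative_ident open_cimg[OF assms(1,2)]])
      (use assms in \<open>auto simp: cmap_in_cimg cmap_cinv\<close>)
  from has_derivative_unique[OF this transition_has_derivative[OF assms(1,2,2,3,3)]]
  show ?thesis by (metis)
qed

text \<open>
  The chain rule for transition maps; it makes the family of coordinate vectors in a tangent vector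
  consistent, so that every vector in one chart extends to a tangent vector.
\<close>
lemma coord_change_cocycle:
  assumes A: "smooth_atlas A" "c \<in> A" "d \<in> A" "f \<in> A" and p: "p \<in> cdom c" "p \<in> cdom d" "p \<in> cdom f"
  shows "coord_change d f p (coord_change c d p u) = coord_change c f p u"
proof -
  let ?O = "cmap c ` (cdom c \<inter> cdom d)"
  have "(cmap f \<circ> cinv d has_derivative coord_change d f p) (at ((cmap d \<circ> cinv c) (cmap c p)))"
    using transition_has_derivative[OF A(1,3,4) p(2,3)] cinv_cmap[OF A(1,2) p(1)] by simp
  from diff_chain_at[OF transition_has_derivative[OF A(1,2,3) p(1,2)] this]
  have "((cmap f \<circ> cinv d) \<circ> (cmap d \<circ> cinv c) has_derivative coord_change d f p \<circ> coord_change c d p) (at (cmap c p))" .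
  then have "(cmap f \<circ> cinv c has_derivative coord_change d f p \<circ> coord_change c d p) (at (cmap c p))"
    by (rule has_derivative_transform_within_open[OF _ transition_C1(1)[OF A(1-3)]])
      (use p cinv_cmap[OF A(1,2)] cinv_cmap[OF A(1,3)] in auto)
  from has_derivative_unique[OF this transition_has_derivative[OF A(1,2,4) p(1,3)]]
  show ?thesis by (metis comp_apply)
qed

lemma tangent_vector_exists:
  assumes A: "smooth_atlas A" "c \<in> A" "p \<in> cdom c"
  obtains v where "v \<in> tangent_space A p" "v c = u"
proof
  let ?v = "\<lambda>d. if d \<in> A \<and> p \<in> cdom d then coord_change c d p u else 0"
  show "?v \<in> tangent_space A p"
    unfolding tangent_space_def using coord_change_cocycle[OF A(1,2) _ _ A(3)] by simp
  show "?v c = u" using A coord_change_self by simp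
qed

lemma tangent_vector_change:
  assumes "v \<in> tangent_space A p" "c \<in> A" "p \<in> cdom c" "d \<in> A" "p \<in> cdom d"
  shows "v d = coord_change c d p (v c)"
  using assms unfolding tangent_space_def by blast

lemma tangent_vector_unique:
  assumes "v \<in> tangent_space A p" "w \<in> tangent_space A p" "c \<in> A" "p \<in> cdom c" "v c = w c"
  shows "v = w"
proof
  fix d show "v d = w d"
  proof (cases "d \<in> A \<and> p \<in> cdom d")
    case True
    then show ?thesis
      using tangent_vector_change[OF assms(1,3,4)] tangent_vector_change[OF assms(2,3,4)] assms(5) by simp
  next
    case False
    then have "v d = 0" "w d = 0" using assms(1,2) unfolding tangent_space_def by blast+
    then show ?thesis by simp
  qed
qed

lemma in_chart_iff:
  assumes "smooth_atlas A" "c \<in> A" "p \<in> cdom c" "E \<subseteq> tangent_space A p" "v \<in> tangent_space A p"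
  shows "v c \<in> in_chart c E \<longleftrightarrow> v \<in> E"
proof
  assume "v c \<in> in_chart c E"
  then obtain w where "w \<in> E" "v c = w c" by (auto simp: in_chart_def)
  then show "v \<in> E" using tangent_vector_unique[OF assms(5) _ assms(2,3), of w] assms(4) by auto
qed (simp add: in_chart_def)

text \<open>
  The chart in the definition of the tangent space of a submanifold is arbitrary; velocities may be computed
  in any prescribed chart around the point.
\<close>
lemma submanifold_tangent_velocity:
  assumes A: "smooth_atlas A" "c \<in> A" "p \<in> cdom c" and v: "v \<in> submanifold_tangent A N p"
  obtains \<gamma> \<epsilon> where "\<epsilon> > 0" "\<gamma> ` {-\<epsilon><..<\<epsilon>} \<subseteq> N \<inter> cdom c" "\<gamma> (0::real) = p"
    "((cmap c \<circ> \<gamma>) has_vector_derivative v c) (at 0)"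
proof -
  obtain c' \<epsilon> \<gamma> where vt: "v \<in> tangent_space A p" and c': "c' \<in> A" and \<epsilon>: "\<epsilon> > 0"
    and \<gamma>: "\<gamma> ` {-\<epsilon><..<\<epsilon>} \<subseteq> N \<inter> cdom c'" "\<gamma> 0 = p"
    and d: "((cmap c' \<circ> \<gamma>) has_vector_derivative v c') (at 0)"
    using v unfolding submanifold_tangent_def by blast
  have pc': "p \<in> cdom c'" using \<gamma> \<epsilon> by force
  have vc: "v c = coord_change c' c p (v c')" by (rule tangent_vector_change[OF vt c' pc' A(2,3)])
  have t: "(cmap c \<circ> cinv c' has_derivative coord_change c' c p) (at (cmap c' p))"
    by (rule transition_has_derivative[OF A(1) c' A(2) pc' A(3)])
  have "((cmap c \<circ> cinv c') \<circ> (cmap c' \<circ> \<gamma>) has_derivative coord_change c' c p \<circ> (\<lambda>x. x *\<^sub>R v c')) (at 0)"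
    using d t \<gamma>(2) unfolding has_vector_derivative_def by (intro diff_chain_at) auto
  then have "((cmap c \<circ> cinv c') \<circ> (cmap c' \<circ> \<gamma>) has_vector_derivative v c) (at 0)"
    unfolding has_vector_derivative_def vc
    using linear_scale[OF has_derivative_linear[OF t]] by (simp add: o_def)
  then have der: "((cmap c \<circ> \<gamma>) has_vector_derivative v c) (at 0)"
    by (rule has_vector_derivative_transform_within_open[where S = "{-\<epsilon><..<\<epsilon>}"])
      (use \<epsilon> \<gamma>(1) cinv_cmap[OF A(1) c'] in \<open>auto simp: image_subset_iff\<close>)
  have "((cmap c' \<circ> \<gamma>) \<longlongrightarrow> cmap c' p) (at 0)"
    using has_vector_derivative_continuous[OF d] \<gamma>(2) by (simp add: isCont_def)
  from topological_tendstoD[OF this transition_C1(1)[OF A(1) c' A(2)]]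
  have "\<forall>\<^sub>F s in at 0. cmap c' (\<gamma> s) \<in> cmap c' ` (cdom c' \<inter> cdom c)" using pc' A(3) by simp
  then obtain e where e: "e > 0" "\<And>s. s \<noteq> 0 \<Longrightarrow> \<bar>s\<bar> < e \<Longrightarrow> cmap c' (\<gamma> s) \<in> cmap c' ` (cdom c' \<inter> cdom c)"
    unfolding eventually_at by (auto simp: dist_real_def)
  have "\<gamma> s \<in> cdom c" if s: "\<bar>s\<bar> < e" "\<bar>s\<bar> < \<epsilon>" for s
  proof (cases "s = 0")
    case False
    then obtain q where q: "q \<in> cdom c' \<inter> cdom c" "cmap c' (\<gamma> s) = cmap c' q"
      using e(2)[OF False s(1)] by blast
    have "\<gamma> s \<in> cdom c'" using \<gamma>(1) s by (simp add: image_subset_iff abs_less_iff)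
    then have "\<gamma> s = q" using q cinv_cmap[OF A(1) c'] by (metis IntD1)
    then show ?thesis using q by simp
  qed (use \<gamma> A in simp)
  then have "\<gamma> ` {-(min e \<epsilon>)<..<min e \<epsilon>} \<subseteq> N \<inter> cdom c"
    using \<gamma>(1) by (auto simp: image_subset_iff abs_less_iff)
  then show thesis
    using \<gamma>(2) e(1) \<epsilon> der by (intro that[of "min e \<epsilon>" \<gamma>]) simp_all
qed

section \<open>Riemannian norms in a chart\<close>

lemma unit_ball_in_chart:
  assumes A: "smooth_atlas A" "c \<in> A" "x \<in> cimg c"
    and G: "\<And>p v w. p \<in> cdom c \<Longrightarrow> v \<in> tangent_space A p \<Longrightarrow> w \<in> tangent_space A p \<Longrightarrow>
              g p v w = G (cmap c p) (v c) (w c)"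
  shows "(\<lambda>v. v c) ` unit_ball A g (cinv c x) = {u. G x u u \<le> 1}"
proof -
  note p = cmap_cinv[OF A]
  show ?thesis
  proof (intro equalityI subsetI)
    fix u assume "u \<in> {u. G x u u \<le> 1}"
    moreover obtain v where "v \<in> tangent_space A (cinv c x)" "v c = u"
      using tangent_vector_exists[OF A(1,2) p(2)] by blast
    ultimately show "u \<in> (\<lambda>v. v c) ` unit_ball A g (cinv c x)"
      using G[OF p(2)] p(1) by (force simp: unit_ball_def)
  qed (use G[OF p(2)] p(1) in \<open>auto simp: unit_ball_def\<close>)
qed

text \<open>
  Guarantees that the suprema defining the pointwise norms of forms are suprema of bounded sets, and hence
  meaningful.
\<close>
lemma positive_definite_unit_ball_bounded:
  fixes h :: "'e::euclidean_space \<Rightarrow> 'e \<Rightarrow> real"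
  assumes bil: "bilinear h" and pos: "\<And>u. u \<noteq> 0 \<Longrightarrow> h u u > 0"
  shows "bounded {u. h u u \<le> 1}"
proof -
  have bb: "bounded_bilinear h" using bil by (simp add: bilinear_conv_bounded_bilinear)
  have "continuous_on (sphere 0 1) (\<lambda>u. h u u)"
    by (intro bounded_bilinear.continuous_on[OF bb] continuous_on_id)
  then obtain a where a: "a \<in> sphere 0 1" "\<And>u. u \<in> sphere 0 1 \<Longrightarrow> h a a \<le> h u u"
    using continuous_attains_inf[of "sphere (0::'e) 1" "\<lambda>u. h u u"] by auto
  have m: "h a a > 0" using a(1) by (intro pos) auto
  have "norm u \<le> sqrt (1 / h a a)" if "h u u \<le> 1" for u
  proof (cases "u = 0")
    case False
    have "h a a \<le> h (u /\<^sub>R norm u) (u /\<^sub>R norm u)" using False by (intro a(2)) simp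
    also have "\<dots> = h u u / (norm u)\<^sup>2"
      by (simp add: bilinear_lmul[OF bil] bilinear_rmul[OF bil] power2_eq_square field_simps)
    also have "\<dots> \<le> 1 / (norm u)\<^sup>2" using that by (intro divide_right_mono) auto
    finally have "(norm u)\<^sup>2 \<le> 1 / h a a" using m False by (simp add: field_simps)
    then show ?thesis by (rule real_le_rsqrt)
  qed (use m in simp)
  then show ?thesis unfolding bounded_iff by blast
qed

text \<open>
  On a compact set the coefficients of the metric are bounded, so its unit balls contain a common Euclidean
  ball; this compares norms of forms with Euclidean operator bounds uniformly in the point.
\<close>
lemma unit_balls_contain_uniform_ball:
  fixes G :: "'e::euclidean_space \<Rightarrow> 'e \<Rightarrow> 'e \<Rightarrow> real"
  assumes K: "compact K" and bil: "\<And>x. x \<in> K \<Longrightarrow> bilinear (G x)"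
    and cont: "\<And>u w. continuous_on K (\<lambda>x. G x u w)"
  obtains \<kappa> where "0 < \<kappa>" "\<kappa> \<le> 1" "\<And>x u. x \<in> K \<Longrightarrow> norm u \<le> \<kappa> \<Longrightarrow> G x u u \<le> 1"
proof -
  define b where "b x = (\<Sum>i\<in>Basis. \<Sum>j\<in>Basis. \<bar>G x i j\<bar>)" for x
  have "continuous_on K b" unfolding b_def by (intro continuous_intros cont)
  from compact_imp_bounded[OF compact_continuous_image[OF this K]]
  obtain B where B: "B > 0" "\<And>x. x \<in> K \<Longrightarrow> \<bar>b x\<bar> \<le> B" by (auto simp: bounded_pos)
  have est: "G x u u \<le> B * (norm u)\<^sup>2" if x: "x \<in> K" for x u
  proof -
    have lin1: "linear (\<lambda>u. G x u w)" and lin2: "linear (\<lambda>w. G x u w)" for u w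
      using bil[OF x] by (auto simp: bilinear_def)
    have "G x u u = (\<Sum>i\<in>Basis. (u \<bullet> i) * G x i u)"
      using linear_sum[OF lin1, of "\<lambda>i. (u \<bullet> i) *\<^sub>R i" Basis u] linear_scale[OF lin1]
      by (simp add: euclidean_representation)
    also have "\<dots> = (\<Sum>i\<in>Basis. (u \<bullet> i) * (\<Sum>j\<in>Basis. (u \<bullet> j) * G x i j))"
    proof (rule sum.cong[OF refl])
      fix i :: 'e
      show "(u \<bullet> i) * G x i u = (u \<bullet> i) * (\<Sum>j\<in>Basis. (u \<bullet> j) * G x i j)"
        using linear_sum[OF lin2, of i "\<lambda>j. (u \<bullet> j) *\<^sub>R j" Basis] linear_scale[OF lin2]
        by (simp add: euclidean_representation)
    qed
    also have "\<dots> \<le> (\<Sum>i\<in>Basis. \<Sum>j\<in>Basis. (norm u)\<^sup>2 * \<bar>G x i j\<bar>)"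
      unfolding sum_distrib_left
    proof (intro sum_mono)
      fix i j :: 'e assume ij: "i \<in> Basis" "j \<in> Basis"
      have "(u \<bullet> i) * ((u \<bullet> j) * G x i j) \<le> \<bar>u \<bullet> i\<bar> * \<bar>u \<bullet> j\<bar> * \<bar>G x i j\<bar>"
        by (metis abs_ge_self abs_mult mult.assoc)
      also have "\<dots> \<le> norm u * norm u * \<bar>G x i j\<bar>"
        using ij by (intro mult_right_mono mult_mono Basis_le_norm) auto
      finally show "(u \<bullet> i) * ((u \<bullet> j) * G x i j) \<le> (norm u)\<^sup>2 * \<bar>G x i j\<bar>" by (simp add: power2_eq_square)
    qed
    also have "\<dots> = (norm u)\<^sup>2 * b x" by (simp add: b_def sum_distrib_left)
    also have "\<dots> \<le> (norm u)\<^sup>2 * B" using B(2)[OF x] by (intro mult_left_mono) auto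
    finally show ?thesis by (simp add: mult.commute)
  qed
  show thesis
  proof (rule that[of "min 1 (1 / sqrt B)"])
    fix x and u :: 'e assume x: "x \<in> K" and u: "norm u \<le> min 1 (1 / sqrt B)"
    have "(norm u)\<^sup>2 \<le> (1 / sqrt B)\<^sup>2" using u by (intro power_mono) auto
    also have "\<dots> = 1 / B" using B(1) by (simp add: power_divide)
    finally have "B * (norm u)\<^sup>2 \<le> 1" using B(1) by (simp add: field_simps)
    then show "G x u u \<le> 1" using est[OF x, of u] by linarith
  qed (use B in auto)
qed

lemma rescale_into_ball:
  fixes u :: "'e::real_normed_vector"
  assumes "\<kappa> > 0"
  obtains w where "norm w \<le> \<kappa>" "u = (norm u / \<kappa>) *\<^sub>R w"
proof (cases "u = 0")
  case True then show thesis using assms by (intro that[of 0]) auto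
next
  case False
  then show thesis using assms by (intro that[of "(\<kappa> / norm u) *\<^sub>R u"]) auto
qed

lemma le_C0_norm: "C0_finite V f \<Longrightarrow> x \<in> V \<Longrightarrow> f x \<le> C0_norm V f"
  unfolding C0_finite_def C0_norm_def by (rule cSUP_upper)

text \<open>
  A supremum over the unit ball of the metric dominates the values on a Euclidean ball of radius \<open>\<kappa>\<close>, and
  homogeneity extends the bound to all vectors.  The a priori bounds by \<open>B\<close> make the suprema finite.
\<close>
lemma pointwise_norm_bounds:
  fixes \<alpha> :: "'e::euclidean_space \<Rightarrow> 'e \<Rightarrow>\<^sub>L real"
  assumes E: "(\<lambda>v. v c) ` unit_ball A g (cinv c x) = E" and b: "bounded E"
    and \<kappa>: "\<kappa> > 0" "cball 0 \<kappa> \<subseteq> E"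
  shows norm_1_bound: "\<bar>\<alpha> x u\<bar> \<le> norm_1 A g c \<alpha> x / \<kappa> * norm u"
    and norm_2_bound: "(\<And>t u v. \<omega> x (t *\<^sub>R u) v = t * \<omega> x u v) \<Longrightarrow> (\<And>t u v. \<omega> x u (t *\<^sub>R v) = t * \<omega> x u v) \<Longrightarrow>
       (\<And>u v. \<bar>\<omega> x u v\<bar> \<le> B * norm u * norm v) \<Longrightarrow> \<bar>\<omega> x u v\<bar> \<le> norm_2 A g c \<omega> x / \<kappa>^2 * norm u * norm v"
    and norm_3_bound: "(\<And>t u v w. \<mu> x (t *\<^sub>R u) v w = t * \<mu> x u v w) \<Longrightarrow> (\<And>t u v w. \<mu> x u (t *\<^sub>R v) w = t * \<mu> x u v w) \<Longrightarrow>
       (\<And>t u v w. \<mu> x u v (t *\<^sub>R w) = t * \<mu> x u v w) \<Longrightarrow>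
       (\<And>u v w. \<bar>\<mu> x u v w\<bar> \<le> B * norm u * norm v * norm w) \<Longrightarrow>
       \<bar>\<mu> x u v w\<bar> \<le> norm_3 A g c \<mu> x / \<kappa>^3 * norm u * norm v * norm w"
proof -
  have \<kappa>E: "u \<in> E" if "norm u \<le> \<kappa>" for u using \<kappa>(2) that by auto
  obtain b where b: "\<And>u. u \<in> E \<Longrightarrow> norm u \<le> b" using b by (auto simp: bounded_iff)
  let ?U = "unit_ball A g (cinv c x)"
  have vb: "norm (v c) \<le> b" if "v \<in> ?U" for v using E b that by blast
  have b0: "0 \<le> b" using b[OF \<kappa>E[of 0]] \<kappa>(1) by simp
  obtain u' where u': "norm u' \<le> \<kappa>" "u = (norm u / \<kappa>) *\<^sub>R u'" by (rule rescale_into_ball[OF \<kappa>(1)])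
  obtain v' where v': "norm v' \<le> \<kappa>" "v = (norm v / \<kappa>) *\<^sub>R v'" by (rule rescale_into_ball[OF \<kappa>(1)])
  obtain w' where w': "norm w' \<le> \<kappa>" "w = (norm w / \<kappa>) *\<^sub>R w'" by (rule rescale_into_ball[OF \<kappa>(1)])
  obtain u1 where u1: "u1 \<in> ?U" "u1 c = u'" using E \<kappa>E[OF u'(1)] by blast
  obtain v1 where v1: "v1 \<in> ?U" "v1 c = v'" using E \<kappa>E[OF v'(1)] by blast
  obtain w1 where w1: "w1 \<in> ?U" "w1 c = w'" using E \<kappa>E[OF w'(1)] by blast
  show "\<bar>\<alpha> x u\<bar> \<le> norm_1 A g c \<alpha> x / \<kappa> * norm u"
  proof -
    have "bdd_above ((\<lambda>v. \<bar>\<alpha> x (v c)\<bar>) ` ?U)"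
    proof (rule bdd_aboveI2)
      fix v assume "v \<in> ?U"
      from order_trans[OF norm_blinfun[of "\<alpha> x"] mult_left_mono[OF vb[OF this] norm_ge_zero]]
      show "\<bar>\<alpha> x (v c)\<bar> \<le> norm (\<alpha> x) * b" by simp
    qed
    then have "\<bar>\<alpha> x (u1 c)\<bar> \<le> norm_1 A g c \<alpha> x" unfolding norm_1_def by (rule cSUP_upper[OF u1(1)])
    then have "norm u / \<kappa> * \<bar>\<alpha> x u'\<bar> \<le> norm u / \<kappa> * norm_1 A g c \<alpha> x"
      unfolding u1(2) using \<kappa> by (intro mult_left_mono) auto
    moreover have "\<bar>\<alpha> x u\<bar> = norm u / \<kappa> * \<bar>\<alpha> x u'\<bar>"
      by (subst u'(2)) (use \<kappa> in \<open>simp add: blinfun.scaleR_right abs_mult\<close>)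
    ultimately show ?thesis by (simp add: mult.commute)
  qed
  show "\<bar>\<omega> x u v\<bar> \<le> norm_2 A g c \<omega> x / \<kappa>^2 * norm u * norm v"
    if l: "\<And>t u v. \<omega> x (t *\<^sub>R u) v = t * \<omega> x u v" "\<And>t u v. \<omega> x u (t *\<^sub>R v) = t * \<omega> x u v"
      and B: "\<And>u v. \<bar>\<omega> x u v\<bar> \<le> B * norm u * norm v" for \<omega> B
  proof -
    have "bdd_above ((\<lambda>(u, v). \<bar>\<omega> x (u c) (v c)\<bar>) ` (?U \<times> ?U))"
    proof (rule bdd_aboveI2, clarify)
      fix u v assume "u \<in> ?U" "v \<in> ?U"
      have "\<bar>\<omega> x (u c) (v c)\<bar> \<le> \<bar>B\<bar> * norm (u c) * norm (v c)"
        by (rule order_trans[OF B]) (intro mult_right_mono; simp)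
      also have "\<dots> \<le> \<bar>B\<bar> * b * b" using vb \<open>u \<in> ?U\<close> \<open>v \<in> ?U\<close> b0 by (intro mult_mono) auto
      finally show "\<bar>\<omega> x (u c) (v c)\<bar> \<le> \<bar>B\<bar> * b * b" .
    qed
    from cSUP_upper[OF _ this, of "(u1, v1)"] have "\<bar>\<omega> x u' v'\<bar> \<le> norm_2 A g c \<omega> x"
      unfolding norm_2_def using u1 v1 by simp
    then have "norm u / \<kappa> * (norm v / \<kappa>) * \<bar>\<omega> x u' v'\<bar> \<le> norm u / \<kappa> * (norm v / \<kappa>) * norm_2 A g c \<omega> x"
      using \<kappa> by (intro mult_left_mono) auto
    moreover have "\<bar>\<omega> x u v\<bar> = norm u / \<kappa> * (norm v / \<kappa>) * \<bar>\<omega> x u' v'\<bar>"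
      by (subst u'(2), subst v'(2)) (use \<kappa> in \<open>simp add: l abs_mult\<close>)
    ultimately show ?thesis by (simp add: power2_eq_square mult_ac)
  qed
  show "\<bar>\<mu> x u v w\<bar> \<le> norm_3 A g c \<mu> x / \<kappa>^3 * norm u * norm v * norm w"
    if l: "\<And>t u v w. \<mu> x (t *\<^sub>R u) v w = t * \<mu> x u v w" "\<And>t u v w. \<mu> x u (t *\<^sub>R v) w = t * \<mu> x u v w"
       "\<And>t u v w. \<mu> x u v (t *\<^sub>R w) = t * \<mu> x u v w"
      and B: "\<And>u v w. \<bar>\<mu> x u v w\<bar> \<le> B * norm u * norm v * norm w" for \<mu> B
  proof -
    have "bdd_above ((\<lambda>(u, v, w). \<bar>\<mu> x (u c) (v c) (w c)\<bar>) ` (?U \<times> ?U \<times> ?U))"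
    proof (rule bdd_aboveI2, clarify)
      fix u v w assume "u \<in> ?U" "v \<in> ?U" "w \<in> ?U"
      have "\<bar>\<mu> x (u c) (v c) (w c)\<bar> \<le> \<bar>B\<bar> * norm (u c) * norm (v c) * norm (w c)"
        by (rule order_trans[OF B]) (intro mult_right_mono; simp)
      also have "\<dots> \<le> \<bar>B\<bar> * b * b * b"
        using vb \<open>u \<in> ?U\<close> \<open>v \<in> ?U\<close> \<open>w \<in> ?U\<close> b0 by (intro mult_mono) auto
      finally show "\<bar>\<mu> x (u c) (v c) (w c)\<bar> \<le> \<bar>B\<bar> * b * b * b" .
    qed
    from cSUP_upper[OF _ this, of "(u1, v1, w1)"] have "\<bar>\<mu> x u' v' w'\<bar> \<le> norm_3 A g c \<mu> x"
      unfolding norm_3_def using u1 v1 w1 by simp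
    then have "norm u / \<kappa> * (norm v / \<kappa>) * (norm w / \<kappa>) * \<bar>\<mu> x u' v' w'\<bar>
        \<le> norm u / \<kappa> * (norm v / \<kappa>) * (norm w / \<kappa>) * norm_3 A g c \<mu> x"
      using \<kappa> by (intro mult_left_mono) auto
    moreover have "\<bar>\<mu> x u v w\<bar> = norm u / \<kappa> * (norm v / \<kappa>) * (norm w / \<kappa>) * \<bar>\<mu> x u' v' w'\<bar>"
      by (subst u'(2), subst v'(2), subst w'(2)) (use \<kappa> in \<open>simp add: l abs_mult mult_ac\<close>)
    ultimately show ?thesis by (simp add: power3_eq_cube mult_ac)
  qed
qed

text \<open>
  After this step the Riemannian metric has disappeared: the hypotheses on the approximating forms become
  estimates with one Euclidean constant \<open>C\<close> on a ball around the point.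
\<close>
lemma involutive_approximation_bounds:
  assumes M: "riemannian_manifold A g" and lc: "local_chart A p c V"
    and inv: "involutive_approximation A g c V \<eta> \<eta>s"
  defines "\<delta> \<equiv> \<lambda>k. C0_norm V (norm_1 A g c (\<lambda>x. \<eta>s k x - \<eta> x))"
    and "d \<equiv> \<lambda>k. C0_norm V (norm_2 A g c (ext_deriv (\<eta>s k)))"
    and "\<rho> \<equiv> \<lambda>k. C0_norm V (norm_3 A g c (wedge_1_2 (\<eta>s k) (ext_deriv (\<eta>s k))))"
  obtains R C where "R > 0" "C > 0" "cball (cmap c p) R \<subseteq> V"
    "\<And>k. 0 \<le> d k" "\<And>k. 0 \<le> \<rho> k"
    "\<And>k y. y \<in> cball (cmap c p) R \<Longrightarrow> norm (\<eta>s k y - \<eta> y) \<le> C * \<delta> k"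
    "\<And>k y u v. y \<in> cball (cmap c p) R \<Longrightarrow> \<bar>ext_deriv (\<eta>s k) y u v\<bar> \<le> C * d k * norm u * norm v"
    "\<And>k y u v w. y \<in> cball (cmap c p) R \<Longrightarrow>
      \<bar>wedge_1_2 (\<eta>s k) (ext_deriv (\<eta>s k)) y u v w\<bar> \<le> C * \<rho> k * norm u * norm v * norm w"
proof -
  have A: "smooth_atlas A" and rm: "riemannian_metric A g" using M by (auto simp: riemannian_manifold_def)
  have c: "c \<in> A" "p \<in> cdom c" and V: "open V" "V \<subseteq> cimg c" "cmap c p \<in> V"
    using lc by (auto simp: local_chart_def)
  obtain G :: "'b \<Rightarrow> 'b \<Rightarrow> 'b \<Rightarrow> real" where G1: "\<And>x. x \<in> cimg c \<Longrightarrow> bilinear (G x)"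
      "\<And>x u. x \<in> cimg c \<Longrightarrow> u \<noteq> 0 \<Longrightarrow> G x u u > 0"
    and G2: "\<And>u w. smooth_on (cimg c) (\<lambda>x. G x u w)"
    and G3: "\<And>p v w. p \<in> cdom c \<Longrightarrow> v \<in> tangent_space A p \<Longrightarrow> w \<in> tangent_space A p \<Longrightarrow>
              g p v w = G (cmap c p) (v c) (w c)"
    using rm c unfolding riemannian_metric_def by metis
  obtain R where R: "R > 0" "cball (cmap c p) R \<subseteq> V" using V open_contains_cball by metis
  let ?K = "cball (cmap c p) R"
  have KV: "x \<in> V" "x \<in> cimg c" if "x \<in> ?K" for x using R V that by auto
  have contG: "continuous_on ?K (\<lambda>x. G x u w)" for u w
  proof -
    have "C_k_on 0 (cimg c) (\<lambda>x. G x u w)" using G2 unfolding smooth_on_def by blast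
    then show ?thesis using KV by (auto intro: continuous_on_subset)
  qed
  obtain \<kappa> where \<kappa>: "0 < \<kappa>" "\<kappa> \<le> 1" "\<And>x u. x \<in> ?K \<Longrightarrow> norm u \<le> \<kappa> \<Longrightarrow> G x u u \<le> 1"
    using unit_balls_contain_uniform_ball[OF compact_cball G1(1)[OF KV(2)] contG] by blast
  have invk: "C_k_on 1 V (\<eta>s k)" "C0_finite V (norm_1 A g c (\<lambda>x. \<eta>s k x - \<eta> x))"
      "C0_finite V (norm_2 A g c (ext_deriv (\<eta>s k)))"
      "C0_finite V (norm_3 A g c (wedge_1_2 (\<eta>s k) (ext_deriv (\<eta>s k))))" for k
    using inv unfolding involutive_approximation_def by auto
  define C where "C = 1 / \<kappa>^3"
  have C: "C > 0" using \<kappa> by (simp add: C_def)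
  have Cle: "1 / \<kappa> \<le> C" "1 / \<kappa>^2 \<le> C"
    using \<kappa> power_decreasing[of 1 3 \<kappa>] power_decreasing[of 2 3 \<kappa>] by (auto simp: C_def field_simps)
  {
    fix y k assume y: "y \<in> ?K"
    have E: "(\<lambda>v. v c) ` unit_ball A g (cinv c y) = {u. G y u u \<le> 1}"
      by (rule unit_ball_in_chart[OF A c(1) KV(2)[OF y]]) (rule G3)
    have bE: "bounded {u. G y u u \<le> 1}"
      using G1 KV(2)[OF y] by (intro positive_definite_unit_ball_bounded) auto
    have \<kappa>E: "cball 0 \<kappa> \<subseteq> {u. G y u u \<le> 1}" using \<kappa>(3)[OF y] by auto
    note nb = norm_1_bound[OF E bE \<kappa>(1) \<kappa>E] norm_2_bound[OF E bE \<kappa>(1) \<kappa>E] norm_3_bound[OF E bE \<kappa>(1) \<kappa>E]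
    obtain D where D: "(\<eta>s k has_derivative blinfun_apply (D y)) (at y)"
      using invk(1)[of k] KV(1)[OF y] unfolding C_1_on_iff[OF V(1)] by blast
    note ed = ext_deriv_eq[OF D]
    have Db: "\<bar>D y u v\<bar> \<le> norm (D y) * norm u * norm v" for u v
      using order_trans[OF norm_blinfun[of "D y u" v] mult_right_mono[OF norm_blinfun[of "D y" u] norm_ge_zero]] by simp
    have eb: "\<bar>ext_deriv (\<eta>s k) y u v\<bar> \<le> 2 * norm (D y) * norm u * norm v" for u v
      using Db[of u v] Db[of v u] by (simp add: ed algebra_simps)
    have 1: "norm (\<eta>s k y - \<eta> y) \<le> C * \<delta> k"
    proof (rule norm_blinfun_bound)
      have "0 \<le> norm_1 A g c (\<lambda>x. \<eta>s k x - \<eta> x) y"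
      proof -
        obtain u :: 'b where "u \<noteq> 0" using nonzero_Basis nonempty_Basis by blast
        then have "0 \<le> norm_1 A g c (\<lambda>x. \<eta>s k x - \<eta> x) y / \<kappa> * norm u"
          using order_trans[OF abs_ge_zero nb(1)] by blast
        then show ?thesis using \<kappa> \<open>u \<noteq> 0\<close> by (simp add: zero_le_mult_iff zero_le_divide_iff)
      qed
      then have \<delta>0: "0 \<le> \<delta> k" unfolding \<delta>_def using le_C0_norm[OF invk(2) KV(1)[OF y]] by (rule order_trans)
      then show "0 \<le> C * \<delta> k" using C by simp
      fix u
      have "\<bar>(\<eta>s k y - \<eta> y) u\<bar> \<le> norm_1 A g c (\<lambda>x. \<eta>s k x - \<eta> x) y / \<kappa> * norm u" by (rule nb(1))
      also have "\<dots> \<le> \<delta> k / \<kappa> * norm u"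
        unfolding \<delta>_def using le_C0_norm[OF invk(2) KV(1)[OF y]] \<kappa>
        by (intro mult_right_mono divide_right_mono) auto
      also have "\<dots> \<le> (C * \<delta> k) * norm u"
        using mult_right_mono[OF Cle(1) \<delta>0] by (intro mult_right_mono) auto
      finally show "norm ((\<eta>s k y - \<eta> y) u) \<le> C * \<delta> k * norm u" by simp
    qed
    have e: "\<bar>ext_deriv (\<eta>s k) y u v\<bar> \<le> norm_2 A g c (ext_deriv (\<eta>s k)) y / \<kappa>^2 * norm u * norm v" for u v
      by (rule nb(2)[where \<omega> = "ext_deriv (\<eta>s k)" and B = "2 * norm (D y)"])
        (rule eb | simp add: ed blinfun.bilinear_simps right_diff_distrib)+
    have w: "\<bar>wedge_1_2 (\<eta>s k) (ext_deriv (\<eta>s k)) y u v w\<bar>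
        \<le> norm_3 A g c (wedge_1_2 (\<eta>s k) (ext_deriv (\<eta>s k))) y / \<kappa>^3 * norm u * norm v * norm w" for u v w
    proof (rule nb(3)[where \<mu> = "wedge_1_2 (\<eta>s k) (ext_deriv (\<eta>s k))"
          and B = "3 * (norm (\<eta>s k y) * (2 * norm (D y)))"])
      fix u v w
      have t: "\<bar>\<eta>s k y u * ext_deriv (\<eta>s k) y v w\<bar> \<le> norm (\<eta>s k y) * (2 * norm (D y)) * norm u * norm v * norm w" for u v w
      proof -
        have "\<bar>\<eta>s k y u\<bar> * \<bar>ext_deriv (\<eta>s k) y v w\<bar> \<le> (norm (\<eta>s k y) * norm u) * (2 * norm (D y) * norm v * norm w)"
          using norm_blinfun[of "\<eta>s k y" u] by (intro mult_mono eb) auto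
        then show ?thesis by (simp add: abs_mult mult_ac)
      qed
      show "\<bar>wedge_1_2 (\<eta>s k) (ext_deriv (\<eta>s k)) y u v w\<bar> \<le> 3 * (norm (\<eta>s k y) * (2 * norm (D y))) * norm u * norm v * norm w"
        unfolding wedge_1_2_def using t[of u v w] t[of v w u] t[of w u v] by (simp add: mult_ac)
    qed (simp_all add: wedge_1_2_def ed blinfun.bilinear_simps algebra_simps)
    have n2: "0 \<le> norm_2 A g c (ext_deriv (\<eta>s k)) y"
      and n3: "0 \<le> norm_3 A g c (wedge_1_2 (\<eta>s k) (ext_deriv (\<eta>s k))) y"
    proof -
      obtain u :: 'b where u: "u \<noteq> 0" using nonzero_Basis nonempty_Basis by blast
      show "0 \<le> norm_2 A g c (ext_deriv (\<eta>s k)) y"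
        using order_trans[OF abs_ge_zero e[of u u]] \<kappa> u by (simp add: zero_le_mult_iff zero_le_divide_iff)
      show "0 \<le> norm_3 A g c (wedge_1_2 (\<eta>s k) (ext_deriv (\<eta>s k))) y"
        using order_trans[OF abs_ge_zero w[of u u u]] \<kappa> u by (simp add: zero_le_mult_iff zero_le_divide_iff)
    qed
    have l2: "norm_2 A g c (ext_deriv (\<eta>s k)) y \<le> d k"
      unfolding d_def by (rule le_C0_norm[OF invk(3) KV(1)[OF y]])
    have l3: "norm_3 A g c (wedge_1_2 (\<eta>s k) (ext_deriv (\<eta>s k))) y \<le> \<rho> k"
      unfolding \<rho>_def by (rule le_C0_norm[OF invk(4) KV(1)[OF y]])
    have 2: "\<bar>ext_deriv (\<eta>s k) y u v\<bar> \<le> C * d k * norm u * norm v" for u v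
    proof (rule order_trans[OF e])
      have "norm_2 A g c (ext_deriv (\<eta>s k)) y * (1 / \<kappa>^2) \<le> d k * C"
        using l2 n2 Cle \<kappa> by (intro mult_mono) auto
      then show "norm_2 A g c (ext_deriv (\<eta>s k)) y / \<kappa>^2 * norm u * norm v \<le> C * d k * norm u * norm v"
        by (intro mult_right_mono) (auto simp: mult.commute)
    qed
    have 3: "\<bar>wedge_1_2 (\<eta>s k) (ext_deriv (\<eta>s k)) y u v w\<bar> \<le> C * \<rho> k * norm u * norm v * norm w" for u v w
    proof (rule order_trans[OF w])
      have "norm_3 A g c (wedge_1_2 (\<eta>s k) (ext_deriv (\<eta>s k))) y * (1 / \<kappa>^3) \<le> \<rho> k * C"
        using l3 n3 \<kappa> by (intro mult_mono) (auto simp: C_def)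
      then show "norm_3 A g c (wedge_1_2 (\<eta>s k) (ext_deriv (\<eta>s k))) y / \<kappa>^3 * norm u * norm v * norm w
          \<le> C * \<rho> k * norm u * norm v * norm w"
        by (intro mult_right_mono) (auto simp: mult.commute)
    qed
    note 1 2 3 order_trans[OF n2 l2] order_trans[OF n3 l3]
  }
  note bounds = this
  have "cmap c p \<in> ?K" using R by simp
  then show thesis
    using R C bounds by (intro that[of R C]) blast+
qed

section \<open>The geometry of a single leaf\<close>

text \<open>
  A graph over the kernel of \<open>a\<close>, along the transverse direction \<open>e\<close>.  The function \<open>u\<close> lives on a ball of the
  whole space rather than of the kernel, which avoids calculus on subspaces.
\<close>
locale leaf_graph =
  fixes a :: "'e::euclidean_space \<Rightarrow>\<^sub>L real" and e x0 :: 'e and r :: real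
    and u :: "'e \<Rightarrow> real" and U' :: "'e \<Rightarrow> 'e \<Rightarrow>\<^sub>L real"
  assumes ae: "a e = 1" and r: "0 < r" and u0: "u 0 = 0"
    and du: "\<And>x. norm x < r \<Longrightarrow> (u has_derivative U' x) (at x)"
    and cU': "continuous_on (ball 0 r) U'"
begin

definition P :: "'e \<Rightarrow> 'e" where "P v = v - a v *\<^sub>R e"

definition graph :: "'e \<Rightarrow> 'e" where "graph h = x0 + h + u h *\<^sub>R e"

definition leaf :: "'e set" where
  "leaf = {y. norm (P (y - x0)) < r \<and> a (y - x0) = u (P (y - x0))}"

definition straighten :: "'e \<Rightarrow> 'e" where "straighten y = y - x0 - u (P (y - x0)) *\<^sub>R e"

definition bend :: "'e \<Rightarrow> 'e" where "bend w = x0 + w + u (P w) *\<^sub>R e"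

lemma bounded_linear_P: "bounded_linear P"
  unfolding P_def by (intro bounded_linear_intros)

lemma P_simps: "P (v + w) = P v + P w" "P (v - w) = P v - P w" "P (t *\<^sub>R v) = t *\<^sub>R P v" "P 0 = 0" "P e = 0"
  "a (P v) = 0"
  by (simp_all add: P_def blinfun.bilinear_simps ae algebra_simps)

lemma P_kernel: "a h = 0 \<Longrightarrow> P h = h"
  by (simp add: P_def)

lemma P_decompose: "v = P v + a v *\<^sub>R e"
  by (simp add: P_def)

lemma P_graph: "P (graph h - x0) = P h"
  by (simp add: graph_def P_simps add.assoc)

lemma graph_0: "graph 0 = x0"
  by (simp add: graph_def u0)

lemma base_in_leaf: "x0 \<in> leaf"
  using r by (simp add: leaf_def P_simps u0 blinfun.zero_right)

lemma leaf_eq_graph: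
  assumes "y \<in> leaf"
  shows "y = graph (P (y - x0))"
  using assms P_decompose[of "y - x0"] by (simp add: leaf_def graph_def algebra_simps)

lemma graph_in_leaf:
  assumes "a h = 0" "norm h < r"
  shows "graph h \<in> leaf" "P (graph h - x0) = h"
proof -
  show 1: "P (graph h - x0) = h" using assms by (simp add: P_graph P_kernel)
  have "a (graph h - x0) = u h"
    using assms ae by (simp add: graph_def add.assoc blinfun.bilinear_simps)
  then show "graph h \<in> leaf" using 1 assms by (simp add: leaf_def)
qed

lemma graph_has_vector_derivative:
  assumes "(x has_vector_derivative x') (at t within T)" "norm (x t) < r"
  shows "((\<lambda>t. graph (x t)) has_vector_derivative x' + U' (x t) x' *\<^sub>R e) (at t within T)"
proof -
  have "((\<lambda>t. u (x t)) has_vector_derivative U' (x t) x') (at t within T)"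
    using has_derivative_compose[OF assms(1)[unfolded has_vector_derivative_def] du[OF assms(2)]]
    by (simp add: has_vector_derivative_def blinfun.scaleR_right)
  from has_vector_derivative_add[OF has_vector_derivative_add[OF has_vector_derivative_const assms(1)]
      bounded_linear.has_vector_derivative[OF bounded_linear_scaleR_left this]]
  show ?thesis unfolding graph_def by simp
qed

text \<open>
  A curve in a graph is the lift of its own projection, so its velocity is the lift of the projected velocity.
\<close>
lemma leaf_velocity:
  assumes "0 < \<epsilon>" "\<And>s. \<bar>s\<bar> < \<epsilon> \<Longrightarrow> y s \<in> leaf" "(y has_vector_derivative w) (at (0::real))"
  shows "w = P w + U' (P (y 0 - x0)) (P w) *\<^sub>R e"
proof -
  have "((\<lambda>s. P (y s - x0)) has_vector_derivative P w) (at 0)"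
    using bounded_linear.has_vector_derivative[OF bounded_linear_P
        has_vector_derivative_diff[OF assms(3) has_vector_derivative_const[of x0]]] by simp
  moreover have "norm (P (y 0 - x0)) < r" using assms(2)[of 0] assms(1) by (simp add: leaf_def)
  ultimately have "((\<lambda>s. graph (P (y s - x0))) has_vector_derivative P w + U' (P (y 0 - x0)) (P w) *\<^sub>R e) (at 0)"
    by (rule graph_has_vector_derivative)
  then have "(y has_vector_derivative P w + U' (P (y 0 - x0)) (P w) *\<^sub>R e) (at 0)"
    by (rule has_vector_derivative_transform_within_open[where S = "{-\<epsilon><..<\<epsilon>}"])
      (use assms(1) leaf_eq_graph[OF assms(2)] in auto)
  with assms(3) show ?thesis by (rule vector_derivative_unique_at)
qed

text \<open>
  Lifting a straight line realises every vector with the slope of the graph as the velocity of a curve.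
\<close>
lemma leaf_curve:
  assumes y: "y \<in> leaf" and w: "w = P w + U' (P (y - x0)) (P w) *\<^sub>R e"
  obtains \<beta> \<epsilon> where "\<epsilon> > 0" "\<beta> ` {-\<epsilon><..<\<epsilon>} \<subseteq> leaf" "\<beta> 0 = y"
    "C_k_on 1 {-\<epsilon><..<\<epsilon>} \<beta>" "(\<beta> has_vector_derivative w) (at (0::real))"
proof -
  define h where "h = P (y - x0)"
  define \<epsilon> where "\<epsilon> = (r - norm h) / (norm (P w) + 1)"
  have h: "norm h < r" "a h = 0" using y P_simps(6) by (simp_all only: h_def leaf_def mem_Collect_eq)
  have p: "norm (P w) + 1 > 0" by (simp add: add_nonneg_pos)
  have \<epsilon>: "\<epsilon> > 0" using h p by (simp add: \<epsilon>_def)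
  have small: "norm (h + s *\<^sub>R P w) < r" if "\<bar>s\<bar> < \<epsilon>" for s
  proof -
    have "norm (h + s *\<^sub>R P w) \<le> norm h + \<bar>s\<bar> * norm (P w)" by (metis norm_scaleR norm_triangle_ineq)
    also have "\<dots> \<le> norm h + \<bar>s\<bar> * (norm (P w) + 1)" by (simp add: algebra_simps)
    also have "\<dots> < norm h + \<epsilon> * (norm (P w) + 1)" using that p by (simp add: mult_strict_right_mono)
    also have "\<dots> = r" using p by (simp add: \<epsilon>_def)
    finally show ?thesis .
  qed
  define \<beta> where "\<beta> s = graph (h + s *\<^sub>R P w)" for s
  have d: "(\<beta> has_vector_derivative P w + U' (h + s *\<^sub>R P w) (P w) *\<^sub>R e) (at s)" if "\<bar>s\<bar> < \<epsilon>" for s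
    unfolding \<beta>_def using that small
    by (intro graph_has_vector_derivative) (auto intro!: derivative_eq_intros)
  show thesis
  proof (rule that[OF \<epsilon>, of \<beta>])
    show "\<beta> ` {-\<epsilon><..<\<epsilon>} \<subseteq> leaf"
    proof clarify
      fix s assume "s \<in> {-\<epsilon><..<\<epsilon>}"
      then have "norm (h + s *\<^sub>R P w) < r" by (intro small) auto
      then show "\<beta> s \<in> leaf"
        unfolding \<beta>_def using h by (intro graph_in_leaf) (simp_all add: blinfun.bilinear_simps P_simps)
    qed
    show "\<beta> 0 = y" using leaf_eq_graph[OF y] by (simp add: \<beta>_def h_def)
    show "C_k_on 1 {-\<epsilon><..<\<epsilon>} \<beta>"
    proof (rule C_1_onI)
      show "(\<beta> has_derivative (\<lambda>t. t *\<^sub>R (P w + U' (h + s *\<^sub>R P w) (P w) *\<^sub>R e))) (at s)" if "s \<in> {-\<epsilon><..<\<epsilon>}" for s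
        using d[of s] that by (auto simp: has_vector_derivative_def abs_less_iff)
      have "continuous_on {-\<epsilon><..<\<epsilon>} (\<lambda>s. U' (h + s *\<^sub>R P w))"
        by (rule continuous_on_compose2[OF cU']) (use small in \<open>auto intro!: continuous_intros simp: abs_less_iff\<close>)
      then show "continuous_on {-\<epsilon><..<\<epsilon>} (\<lambda>s. t *\<^sub>R (P w + U' (h + s *\<^sub>R P w) (P w) *\<^sub>R e))" for t
        by (intro continuous_intros)
    qed
    show "(\<beta> has_vector_derivative w) (at 0)" using d[of 0] \<epsilon> w by (simp add: h_def)
  qed
qed

lemma straighten_bend:
  "P (straighten y) = P (y - x0)" "P (bend w - x0) = P w" "bend (straighten y) = y" "straighten (bend w) = w"
proof -
  show 1: "P (straighten y) = P (y - x0)" "P (bend w - x0) = P w"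
    by (simp_all add: straighten_def bend_def P_simps add.assoc)
  then show "bend (straighten y) = y" "straighten (bend w) = w"
    unfolding bend_def[of "straighten y"] straighten_def[of "bend w"]
    by (simp_all add: straighten_def bend_def)
qed

text \<open>
  Covers the shear and its inverse, with \<open>c = -1\<close> and \<open>c = 1\<close>.
\<close>
lemma C_1_on_shear:
  assumes "\<And>y. y \<in> V \<Longrightarrow> norm (P (y - z)) < r"
  shows "C_k_on 1 V (\<lambda>y. y + b + (c * u (P (y - z))) *\<^sub>R e)"
proof (rule C_1_onI)
  fix y assume y: "y \<in> V"
  have dP: "((\<lambda>y. P (y - z)) has_derivative P) (at y)"
    by (rule bounded_linear.has_derivative[OF bounded_linear_P]) (auto intro!: derivative_eq_intros)
  have "((\<lambda>y. u (P (y - z))) has_derivative (\<lambda>h. U' (P (y - z)) (P h))) (at y)"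
    using has_derivative_compose[OF dP du[OF assms[OF y]]] .
  then show "((\<lambda>y. y + b + (c * u (P (y - z))) *\<^sub>R e) has_derivative (\<lambda>h. h + (c * U' (P (y - z)) (P h)) *\<^sub>R e)) (at y)"
    by (auto intro!: derivative_eq_intros)
next
  fix v
  have cP: "continuous_on V (\<lambda>y. P (y - z))"
    by (intro linear_continuous_on_compose[OF _ bounded_linear_P[THEN bounded_linear.linear]] continuous_intros)
  have "continuous_on V (\<lambda>y. U' (P (y - z)))"
    by (rule continuous_on_compose2[OF cU' cP]) (use assms in auto)
  then show "continuous_on V (\<lambda>y. v + (c * U' (P (y - z)) (P v)) *\<^sub>R e)"
    by (intro continuous_intros)
qed

text \<open>
  The shear that subtracts the height of the graph flattens the leaf onto the kernel of \<open>a\<close>; its inverse is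
  the shear that adds the height.
\<close>
lemma leaf_slice:
  assumes "open V"
  defines "V' \<equiv> {y \<in> V. norm (P (y - x0)) < r}"
  shows "open V'" "open (straighten ` V')" "homeomorphism V' (straighten ` V') straighten bend"
    "C_k_on 1 V' straighten" "C_k_on 1 (straighten ` V') bend" "subspace {h. a h = 0}"
    "straighten ` (V' \<inter> leaf) = straighten ` V' \<inter> {h. a h = 0}"
proof -
  have cP: "continuous_on UNIV P" using bounded_linear_P by (rule linear_continuous_on)
  have oc: "open {y. norm (P (y - z)) < r}" for z
    by (intro open_Collect_less continuous_intros continuous_on_compose2[OF cP]) auto
  show V': "open V'" unfolding V'_def using open_Int[OF assms(1) oc[of x0]] by (simp add: Int_def)
  have "C_k_on 1 {y. norm (P (y - 0)) < r} (\<lambda>y. y + x0 + (1 * u (P (y - 0))) *\<^sub>R e)"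
    by (rule C_1_on_shear) simp
  then have cb: "C_k_on 1 {w. norm (P w) < r} bend"
    by (simp add: bend_def[abs_def] add.commute[of x0])
  have "C_k_on 1 V' (\<lambda>y. y + (- x0) + ((-1) * u (P (y - x0))) *\<^sub>R e)"
    by (rule C_1_on_shear) (simp add: V'_def)
  then show cs: "C_k_on 1 V' straighten" by (simp add: straighten_def[abs_def])
  have img: "straighten ` V' = {w. norm (P w) < r} \<inter> bend -` V"
  proof (intro equalityI subsetI)
    fix w assume "w \<in> {w. norm (P w) < r} \<inter> bend -` V"
    then show "w \<in> straighten ` V'"
      by (intro image_eqI[of w _ "bend w"]) (auto simp: straighten_bend V'_def)
  qed (auto simp: straighten_bend V'_def)
  have ob: "open {w. norm (P w) < r}" using oc[of 0] by simp
  have contb: "continuous_on {w. norm (P w) < r} bend"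
    using cb by (intro differentiable_imp_continuous_on) (auto simp: differentiable_on_def intro: differentiable_at_withinI)
  have conts: "continuous_on V' straighten"
    using cs by (intro differentiable_imp_continuous_on) (auto simp: differentiable_on_def intro: differentiable_at_withinI)
  show "open (straighten ` V')"
    unfolding img by (rule continuous_open_preimage[OF contb ob assms(1)])
  show "C_k_on 1 (straighten ` V') bend"
    by (rule C_1_on_subset[OF cb]) (auto simp: img)
  show "homeomorphism V' (straighten ` V') straighten bend"
  proof -
    have "straighten ` V' \<subseteq> {w. norm (P w) < r}" unfolding img by blast
    then show ?thesis
      using conts continuous_on_subset[OF contb]
      by (simp add: homeomorphism_def straighten_bend image_image)
  qed
  show "subspace {h. a h = 0}"
    by (simp add: subspace_def blinfun.bilinear_simps)
  show "straighten ` (V' \<inter> leaf) = straighten ` V' \<inter> {h. a h = 0}"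
  proof -
    have "a (straighten y) = 0 \<longleftrightarrow> y \<in> leaf" if "y \<in> V'" for y
      using that ae by (auto simp: straighten_def leaf_def V'_def blinfun.bilinear_simps)
    then show ?thesis by auto
  qed
qed

end

section \<open>Integral manifolds lie in the leaf\<close>

text \<open>
  Tested against the vectors orthogonal to \<open>S\<close>, the curve is constantly zero.
\<close>
lemma velocity_in_subspace:
  fixes f :: "real \<Rightarrow> 'e::euclidean_space"
  assumes S: "subspace S" and \<epsilon>: "0 < \<epsilon>" and f: "\<And>s. \<bar>s\<bar> < \<epsilon> \<Longrightarrow> f s \<in> S"
    and d: "(f has_vector_derivative w) (at 0)"
  shows "w \<in> S"
proof -
  have "orthogonal n w" if n: "n \<in> orthogonal_comp S" for n
  proof -
    have nf: "n \<bullet> f s = 0" if "\<bar>s\<bar> < \<epsilon>" for s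
    proof -
      have "orthogonal (f s) n" using n f[OF that] unfolding orthogonal_comp_def by blast
      then show ?thesis by (simp add: orthogonal_def inner_commute)
    qed
    have "((\<lambda>s. n \<bullet> f s) has_vector_derivative n \<bullet> w) (at 0)"
      by (rule bounded_linear.has_vector_derivative[OF bounded_linear_inner_right d])
    moreover have "((\<lambda>s. n \<bullet> f s) has_vector_derivative 0) (at 0)"
      by (rule has_vector_derivative_transform_within_open[OF has_vector_derivative_const, where S = "{-\<epsilon><..<\<epsilon>}"])
        (use \<epsilon> nf in \<open>simp_all add: abs_less_iff\<close>)
    ultimately show ?thesis unfolding orthogonal_def by (rule vector_derivative_unique_at)
  qed
  then have "w \<in> orthogonal_comp (orthogonal_comp S)" unfolding orthogonal_comp_def by blast
  then show ?thesis using orthogonal_comp_self[OF S] by simp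
qed

text \<open>
  Here \<open>T\<close> is an integral manifold in coordinates, given by a slice chart \<open>\<Phi>\<close>.  A point of \<open>T\<close> near \<open>x0\<close> is joined to
  \<open>x0\<close> by the preimage of a segment in the slice, and comparing this curve with the lift of its projection
  puts the point into the leaf.  So \<open>T\<close> is a graph over a subset of the kernel of \<open>a\<close>; the slice has at least the
  dimension of the kernel, because the derivative of \<open>\<Phi>\<close> embeds the kernel into it, and by invariance of
  domain that subset is a neighbourhood of the origin.
\<close>
lemma (in leaf_graph) slice_equals_leaf:
  fixes \<eta> :: "'e \<Rightarrow> 'e \<Rightarrow>\<^sub>L real" and \<eta>s :: "nat \<Rightarrow> 'e \<Rightarrow> 'e \<Rightarrow>\<^sub>L real"
    and \<Phi> \<Psi> :: "'e \<Rightarrow> 'e" and S T :: "'e set"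
  assumes V: "open V" "cball x0 R \<subseteq> V" and R: "0 < R" and a_def: "a = \<eta> x0"
    and U'_def: "\<And>h. norm h < r \<Longrightarrow> U' h = slope (\<eta> (graph h)) e"
    and graphK: "\<And>h. norm h < r \<Longrightarrow> graph h \<in> cball x0 R"
    and \<eta>e: "\<And>y. y \<in> cball x0 R \<Longrightarrow> \<eta> y e \<ge> 3/4"
    and M: "\<And>y. y \<in> cball x0 R \<Longrightarrow> norm (\<eta> y) \<le> M"
    and C1: "\<And>k. C_k_on 1 V (\<eta>s k)"
    and close: "\<And>k y. y \<in> cball x0 R \<Longrightarrow> norm (\<eta>s k y - \<eta> y) \<le> C * \<delta> k" and \<delta>: "\<delta> \<longlonglongrightarrow> 0"
    and \<omega>: "\<And>k y u v. y \<in> cball x0 R \<Longrightarrow> \<bar>ext_deriv (\<eta>s k) y u v\<bar> \<le> C * d k * norm u * norm v"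
    and nn: "0 \<le> C" "\<And>k. 0 \<le> d k"
    and lim: "(\<lambda>k. \<delta> k * exp (d k)) \<longlonglongrightarrow> 0"
    and V1: "open V1" "x0 \<in> V1" "V1 \<subseteq> {y \<in> cball x0 R. norm (P (y - x0)) < r}"
    and slice: "open (\<Phi> ` V1)" "homeomorphism V1 (\<Phi> ` V1) \<Phi> \<Psi>" "C_k_on 1 V1 \<Phi>" "C_k_on 1 (\<Phi> ` V1) \<Psi>"
      "subspace S" "\<Phi> ` (V1 \<inter> T) = \<Phi> ` V1 \<inter> S" "x0 \<in> T"
    and tangent: "\<And>\<beta> \<epsilon> w. 0 < \<epsilon> \<Longrightarrow> \<beta> ` {-\<epsilon><..<\<epsilon>} \<subseteq> T \<inter> V1 \<Longrightarrow> C_k_on 1 {-\<epsilon><..<\<epsilon>} \<beta> \<Longrightarrow>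
        (\<beta> has_vector_derivative w) (at (0::real)) \<Longrightarrow> \<eta> (\<beta> 0) w = 0"
    and cotangent: "\<And>w. \<eta> x0 w = 0 \<Longrightarrow> \<exists>\<beta> \<epsilon>. 0 < \<epsilon> \<and> \<beta> ` {-\<epsilon><..<\<epsilon>} \<subseteq> T \<and> \<beta> 0 = x0 \<and>
        (\<beta> has_vector_derivative w) (at (0::real))"
  shows "\<exists>W. open W \<and> x0 \<in> W \<and> T \<inter> W = leaf \<inter> W"
proof -
  define s0 where "s0 = \<Phi> x0"
  define H where "H = {h. a h = 0}"
  have H: "subspace H" unfolding H_def by (simp add: subspace_def blinfun.bilinear_simps)
  have \<Psi>\<Phi>: "\<Psi> (\<Phi> y) = y" if "y \<in> V1" for y using homeomorphism_apply1[OF slice(2) that] .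
  have \<Phi>\<Psi>: "\<Phi> (\<Psi> s) = s" "\<Psi> s \<in> V1" if "s \<in> \<Phi> ` V1" for s
    using homeomorphism_apply2[OF slice(2) that] \<Psi>\<Phi> that by auto
  have c\<Phi>: "continuous_on V1 \<Phi>" and c\<Psi>: "continuous_on (\<Phi> ` V1) \<Psi>"
    using slice(2) by (auto simp: homeomorphism_def)
  have s0: "s0 \<in> \<Phi> ` V1" "s0 \<in> S" using V1(2) slice(6,7) unfolding s0_def by blast+
  have \<Psi>T: "\<Psi> s \<in> V1 \<inter> T" if "s \<in> \<Phi> ` V1" "s \<in> S" for s
  proof -
    have "s \<in> \<Phi> ` (V1 \<inter> T)" using slice(6) that by simp
    then show ?thesis using \<Psi>\<Phi> by auto
  qed
  obtain \<Phi>' where \<Phi>': "(\<Phi> has_derivative blinfun_apply \<Phi>') (at x0)"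
    using slice(3) V1(2) unfolding C_1_on_iff[OF V1(1)] by blast
  obtain \<Psi>' where \<Psi>': "\<And>s. s \<in> \<Phi> ` V1 \<Longrightarrow> (\<Psi> has_derivative blinfun_apply (\<Psi>' s)) (at s)"
    and c\<Psi>': "continuous_on (\<Phi> ` V1) \<Psi>'"
    using slice(4) unfolding C_1_on_iff[OF slice(1)] by blast
  have dim: "dim H \<le> dim S"
  proof -
    have "(\<Psi> \<circ> \<Phi> has_derivative blinfun_apply (\<Psi>' s0) \<circ> blinfun_apply \<Phi>') (at x0)"
      using diff_chain_at[OF \<Phi>' \<Psi>'[OF s0(1), unfolded s0_def]] by (simp add: s0_def)
    then have "((\<lambda>y. y) has_derivative blinfun_apply (\<Psi>' s0) \<circ> blinfun_apply \<Phi>') (at x0)"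
      by (rule has_derivative_transform_within_open[OF _ V1(1,2)]) (simp add: \<Psi>\<Phi>)
    from has_derivative_unique[OF this has_derivative_ident]
    have inv: "\<Psi>' s0 (\<Phi>' w) = w" for w by (metis comp_apply)
    have "\<Phi>' w \<in> S" if w: "w \<in> H" for w
    proof -
      obtain \<beta> \<epsilon> where \<beta>: "0 < \<epsilon>" "\<beta> ` {-\<epsilon><..<\<epsilon>} \<subseteq> T" "\<beta> 0 = x0"
          "(\<beta> has_vector_derivative w) (at (0::real))"
        using cotangent[of w] w by (auto simp: H_def a_def)
      have "isCont \<beta> 0" using has_vector_derivative_continuous[OF \<beta>(4)] .
      then have "\<forall>\<^sub>F s in at 0. \<beta> s \<in> V1"
        using topological_tendstoD[OF _ V1(1)] V1(2) \<beta>(3) by (simp add: isCont_def)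
      then obtain \<epsilon>' where \<epsilon>': "0 < \<epsilon>'" "\<And>s. s \<noteq> 0 \<Longrightarrow> \<bar>s\<bar> < \<epsilon>' \<Longrightarrow> \<beta> s \<in> V1"
        unfolding eventually_at by (auto simp: dist_real_def)
      have \<beta>V: "\<beta> s \<in> V1" if "\<bar>s\<bar> < \<epsilon>'" for s using \<epsilon>' that V1(2) \<beta>(3) by (cases "s = 0") auto
      have "(\<Phi> \<circ> \<beta> has_vector_derivative \<Phi>' w) (at 0)"
        using diff_chain_at[OF \<beta>(4)[unfolded has_vector_derivative_def], of \<Phi> "blinfun_apply \<Phi>'"] \<Phi>' \<beta>(3)
        by (simp add: has_vector_derivative_def o_def blinfun.scaleR_right)
      then show ?thesis
      proof (rule velocity_in_subspace[OF slice(5), rotated 2])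
        show "0 < min \<epsilon> \<epsilon>'" using \<beta> \<epsilon>' by simp
        fix s :: real assume s: "\<bar>s\<bar> < min \<epsilon> \<epsilon>'"
        then have "\<beta> s \<in> V1 \<inter> T" using \<beta>V \<beta>(2) by (auto simp: image_subset_iff abs_less_iff)
        then have "\<Phi> (\<beta> s) \<in> \<Phi> ` V1 \<inter> S" unfolding slice(6)[symmetric] by blast
        then show "(\<Phi> \<circ> \<beta>) s \<in> S" by simp
      qed
    qed
    then have "blinfun_apply \<Phi>' ` H \<subseteq> S" by blast
    moreover have "dim (blinfun_apply \<Phi>' ` H) = dim H"
      by (rule dim_image_eq) (auto intro: bounded_linear.linear blinfun.bounded_linear_right inj_on_inverseI[where g = "\<Psi>' s0"] simp: inv)
    ultimately show ?thesis using dim_subset by metis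
  qed
  obtain \<sigma> where \<sigma>: "0 < \<sigma>" "cball s0 \<sigma> \<subseteq> \<Phi> ` V1" using slice(1) s0(1) open_contains_cball by metis
  obtain B where B: "0 < B" "\<And>s. s \<in> cball s0 \<sigma> \<Longrightarrow> norm (\<Psi>' s) \<le> B"
    using compact_imp_bounded[OF compact_continuous_image[OF continuous_on_subset[OF c\<Psi>' \<sigma>(2)] compact_cball]]
    by (auto simp: bounded_pos)
  have M0: "0 \<le> M" using order_trans[OF norm_ge_zero M[of x0]] R by simp
  define Sp where "Sp = 1 / (2 * norm e * C + 1)"
  have eC: "2 * norm e * C + 1 > 0" using nn by (simp add: add_nonneg_pos)
  have Sp: "Sp > 0" using eC by (simp add: Sp_def)
  have SpC: "2 * Sp * norm e * C \<le> 1"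
  proof -
    have "2 * Sp * norm e * C = (2 * norm e * C) / (2 * norm e * C + 1)" by (simp add: Sp_def)
    also have "\<dots> \<le> 1" using eC by (simp add: divide_le_eq_1)
    finally show ?thesis .
  qed
  define c where "c = (1 + 2 * M * norm e) * (1 + M * norm e)"
  have c: "1 \<le> c" unfolding c_def using M0 mult_mono[of 1 "1 + 2 * M * norm e" 1 "1 + M * norm e"] by simp
  \<comment> \<open>For points this close to s0 the connecting curves are slow enough for the comparison of integral curves.\<close>
  define \<sigma>' where "\<sigma>' = min \<sigma> (Sp / (c * B))"
  have \<sigma>': "0 < \<sigma>'" "\<sigma>' \<le> \<sigma>" using \<sigma> Sp c B by (simp_all add: \<sigma>'_def)
  have aM: "norm a \<le> M" using M[of x0] R by (simp add: a_def)
  have Pn: "norm (P v) \<le> (1 + M * norm e) * norm v" for v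
  proof -
    have "\<bar>a v\<bar> \<le> M * norm v"
      using order_trans[OF norm_blinfun[of a v] mult_right_mono[OF aM norm_ge_zero]] by simp
    then have "\<bar>a v\<bar> * norm e \<le> M * norm v * norm e" by (intro mult_right_mono) auto
    moreover have "norm (P v) \<le> norm v + \<bar>a v\<bar> * norm e"
      unfolding P_def using norm_triangle_ineq4[of v "a v *\<^sub>R e"] by simp
    ultimately show ?thesis by (simp add: algebra_simps)
  qed
  have in_leaf: "\<Psi> s \<in> leaf" if s: "s \<in> S" "norm (s - s0) < \<sigma>'" for s
  proof -
    define \<beta> where "\<beta> t = \<Psi> (s0 + t *\<^sub>R (s - s0))" for t
    define v where "v t = \<Psi>' (s0 + t *\<^sub>R (s - s0)) (s - s0)" for t
    \<comment> \<open>The curve extends beyond its endpoints, so that velocities at the endpoints are those of two-sided curves.\<close>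
    define \<epsilon> where "\<epsilon> = (\<sigma> - norm (s - s0)) / (norm (s - s0) + 1)"
    have p: "norm (s - s0) + 1 > 0" by (simp add: add_nonneg_pos)
    have \<epsilon>: "\<epsilon> > 0" using s \<sigma>' p by (simp add: \<epsilon>_def)
    have lin: "s0 + t *\<^sub>R (s - s0) \<in> cball s0 \<sigma>" "s0 + t *\<^sub>R (s - s0) \<in> \<Phi> ` V1" "s0 + t *\<^sub>R (s - s0) \<in> S"
      if t: "\<bar>t\<bar> < 1 + \<epsilon>" for t
    proof -
      have "\<bar>t\<bar> * norm (s - s0) \<le> (1 + \<epsilon>) * norm (s - s0)" using t by (intro mult_right_mono) auto
      also have "\<dots> \<le> norm (s - s0) + \<epsilon> * (norm (s - s0) + 1)" using \<epsilon> by (simp add: algebra_simps)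
      also have "\<dots> = \<sigma>" using p by (simp add: \<epsilon>_def)
      finally show 1: "s0 + t *\<^sub>R (s - s0) \<in> cball s0 \<sigma>" by (simp add: dist_norm)
      then show "s0 + t *\<^sub>R (s - s0) \<in> \<Phi> ` V1" using \<sigma> by blast
      show "s0 + t *\<^sub>R (s - s0) \<in> S"
        using s(1) s0(2) slice(5) by (intro subspace_add subspace_scale subspace_diff)
    qed
    have d\<beta>: "(\<beta> has_vector_derivative v t) (at t)" if "\<bar>t\<bar> < 1 + \<epsilon>" for t
    proof -
      have "((\<lambda>t. s0 + t *\<^sub>R (s - s0)) has_derivative (\<lambda>h. h *\<^sub>R (s - s0))) (at t)"
        by (auto intro!: derivative_eq_intros)
      from has_derivative_compose[OF this \<Psi>'[OF lin(2)[OF that]]]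
      show ?thesis unfolding \<beta>_def v_def by (simp add: has_vector_derivative_def blinfun.scaleR_right)
    qed
    have c\<Psi>'l: "continuous_on {-1-\<epsilon><..<1+\<epsilon>} (\<lambda>t. \<Psi>' (s0 + t *\<^sub>R (s - s0)))"
      by (rule continuous_on_compose2[OF c\<Psi>'])
        (use lin(2) in \<open>auto intro!: continuous_intros simp: abs_less_iff image_subset_iff simp del: image_iff\<close>)
    have cv: "continuous_on {-1-\<epsilon><..<1+\<epsilon>} v"
      unfolding v_def by (intro continuous_intros c\<Psi>'l)
    have \<beta>T: "\<beta> t \<in> T \<inter> V1" if "\<bar>t\<bar> < 1 + \<epsilon>" for t
      using \<Psi>T[OF lin(2,3)[OF that]] by (simp add: \<beta>_def)
    have \<beta>tan: "\<eta> (\<beta> t) (v t) = 0" if t: "t \<in> {0..1}" for t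
    proof -
      have "\<eta> ((\<lambda>\<tau>. \<beta> (t + \<tau>)) 0) (v t) = 0"
      proof (rule tangent[OF \<epsilon>])
        have bd: "\<bar>t + \<tau>\<bar> < 1 + \<epsilon>" if "\<tau> \<in> {-\<epsilon><..<\<epsilon>}" for \<tau> using t that by auto
        show "(\<lambda>\<tau>. \<beta> (t + \<tau>)) ` {- \<epsilon><..<\<epsilon>} \<subseteq> T \<inter> V1" using \<beta>T[OF bd] by blast
        have sh: "((\<lambda>\<tau>. \<beta> (t + \<tau>)) has_vector_derivative v (t + \<tau>)) (at \<tau>)" if "\<tau> \<in> {-\<epsilon><..<\<epsilon>}" for \<tau>
        proof -
          have "((\<lambda>\<tau>. t + \<tau>) has_derivative (\<lambda>h. h)) (at \<tau>)" by (auto intro!: derivative_eq_intros)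
          from has_derivative_compose[OF this d\<beta>[OF bd[OF that], unfolded has_vector_derivative_def]]
          show ?thesis by (simp add: has_vector_derivative_def)
        qed
        show "((\<lambda>\<tau>. \<beta> (t + \<tau>)) has_vector_derivative v t) (at 0)" using sh[of 0] \<epsilon> by simp
        show "C_k_on 1 {- \<epsilon><..<\<epsilon>} (\<lambda>\<tau>. \<beta> (t + \<tau>))"
        proof (rule C_1_onI)
          show "((\<lambda>\<tau>. \<beta> (t + \<tau>)) has_derivative (\<lambda>h. h *\<^sub>R v (t + \<tau>))) (at \<tau>)" if "\<tau> \<in> {-\<epsilon><..<\<epsilon>}" for \<tau>
            using sh[OF that] by (simp add: has_vector_derivative_def)
          show "continuous_on {-\<epsilon><..<\<epsilon>} (\<lambda>\<tau>. h *\<^sub>R v (t + \<tau>))" for h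
            by (intro continuous_intros continuous_on_compose2[OF cv]) (use t in auto)
        qed
      qed
      then show ?thesis by simp
    qed
    have t01: "\<bar>t\<bar> < 1 + \<epsilon>" if "t \<in> {0..1}" for t using that \<epsilon> by auto
    have vn: "c * norm (v t) \<le> Sp" if "t \<in> {0..1}" for t
    proof -
      have "norm (v t) \<le> norm (\<Psi>' (s0 + t *\<^sub>R (s - s0))) * norm (s - s0)" unfolding v_def by (rule norm_blinfun)
      also have "\<dots> \<le> B * \<sigma>'" using B(1) B(2)[OF lin(1)[OF t01[OF that]]] s(2) by (intro mult_mono) auto
      also have "\<dots> \<le> B * (Sp / (c * B))" using B by (intro mult_left_mono) (auto simp: \<sigma>'_def)
      also have "\<dots> = Sp / c" using B by simp
      finally show ?thesis using c by (simp add: field_simps)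
    qed
    define x where "x t = P (\<beta> t - x0)" for t
    have xr: "norm (x t) < r" if "t \<in> {0..1}" for t using \<beta>T[OF t01[OF that]] V1(3) by (auto simp: x_def)
    define v' where "v' t = P (v t) + U' (x t) (P (v t)) *\<^sub>R e" for t
    have "\<beta> 1 = graph (x 1)"
    proof (rule integral_curves_coincide[OF V C1 \<eta>e close \<delta> \<omega> nn lim, where v = v and v' = v' and S = Sp
          and \<gamma> = \<beta> and \<gamma>' = "\<lambda>t. graph (x t)" and s = "\<lambda>t. u (x t) - a (\<beta> t - x0)"])
      show "2 * Sp * norm e * C \<le> 1" by (rule SpC)
      show "\<beta> 0 = graph (x 0)" using \<Psi>\<Phi>[OF V1(2)] by (simp add: \<beta>_def x_def s0_def P_simps graph_0)
      have c01: "continuous_on {0..1} v" by (rule continuous_on_subset[OF cv]) (use \<epsilon> in auto)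
      show "continuous_on {0..1} v" by (rule c01)
      have cP: "continuous_on UNIV P" using bounded_linear_P by (rule linear_continuous_on)
      have c\<beta>: "continuous_on {0..1} \<beta>"
        using d\<beta>[OF t01] by (meson continuous_at_imp_continuous_on has_vector_derivative_continuous)
      have cx: "continuous_on {0..1} x" unfolding x_def
        by (rule continuous_on_compose2[OF cP]) (auto intro!: continuous_intros c\<beta>)
      have "continuous_on {0..1} (\<lambda>t. U' (x t))" by (rule continuous_on_compose2[OF cU' cx]) (use xr in auto)
      moreover have "continuous_on {0..1} (\<lambda>t. P (v t))" by (rule continuous_on_compose2[OF cP c01]) auto
      ultimately show "continuous_on {0..1} v'" unfolding v'_def by (intro continuous_intros)
      fix t :: real assume t: "t \<in> {0..1}"
      show d1: "(\<beta> has_vector_derivative v t) (at t within {0..1})"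
        using d\<beta>[OF t01[OF t]] by (rule has_vector_derivative_at_within)
      have "(x has_vector_derivative P (v t)) (at t within {0..1})"
        unfolding x_def
        using bounded_linear.has_vector_derivative[OF bounded_linear_P
            has_vector_derivative_diff[OF d1 has_vector_derivative_const[of x0]]] by simp
      then show "((\<lambda>t. graph (x t)) has_vector_derivative v' t) (at t within {0..1})"
        unfolding v'_def using xr[OF t] by (rule graph_has_vector_derivative)
      show "\<beta> t \<in> cball x0 R" using \<beta>T[OF t01[OF t]] V1(3) by auto
      show gK: "graph (x t) \<in> cball x0 R" by (rule graphK[OF xr[OF t]])
      have "norm (v t) \<le> c * norm (v t)" using c mult_right_mono[of 1 c "norm (v t)"] by simp
      then show "norm (v t) \<le> Sp" using vn[OF t] by simp
      have e1: "\<eta> (graph (x t)) e \<ge> 1/2" using \<eta>e[OF gK] by simp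
      have "\<bar>U' (x t) (P (v t))\<bar> \<le> norm (U' (x t)) * norm (P (v t))" using norm_blinfun[of "U' (x t)"] by simp
      also have "\<dots> \<le> (2 * M) * norm (P (v t))"
        unfolding U'_def[OF xr[OF t]] using e1 M[OF gK] by (intro mult_right_mono norm_slope_le) auto
      finally have "\<bar>U' (x t) (P (v t))\<bar> * norm e \<le> 2 * M * norm (P (v t)) * norm e" by (intro mult_right_mono) auto
      moreover have "norm (v' t) \<le> norm (P (v t)) + \<bar>U' (x t) (P (v t))\<bar> * norm e"
        unfolding v'_def by (metis norm_scaleR norm_triangle_ineq)
      ultimately have "norm (v' t) \<le> (1 + 2 * M * norm e) * norm (P (v t))" by (simp add: algebra_simps)
      also have "\<dots> \<le> (1 + 2 * M * norm e) * ((1 + M * norm e) * norm (v t))"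
        using M0 by (intro mult_left_mono Pn) auto
      also have "\<dots> = c * norm (v t)" by (simp add: c_def mult.assoc)
      finally show "norm (v' t) \<le> Sp" using vn[OF t] by simp
      show "\<eta> (\<beta> t) (v t) = 0" by (rule \<beta>tan[OF t])
      show "\<eta> (graph (x t)) (v' t) = 0"
        unfolding v'_def U'_def[OF xr[OF t]] using e1 by (subst slope_kernel_iff) auto
      show "graph (x t) - \<beta> t = (u (x t) - a (\<beta> t - x0)) *\<^sub>R e"
        using P_decompose[of "\<beta> t - x0"] by (simp add: graph_def x_def algebra_simps)
    qed
    moreover have "\<beta> 1 = \<Psi> s" by (simp add: \<beta>_def)
    moreover have "graph (x 1) \<in> leaf" using xr[of 1] by (intro graph_in_leaf) (simp_all add: x_def P_simps(6))
    ultimately show ?thesis by simp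
  qed
  define D where "D = S \<inter> ball s0 \<sigma>'"
  define f where "f s = P (\<Psi> s - x0)" for s
  have D: "s \<in> \<Phi> ` V1" "\<Psi> s \<in> leaf" "\<Psi> s \<in> V1 \<inter> T" if "s \<in> D" for s
  proof -
    have "norm (s - s0) < \<sigma>'" "s \<in> S" using that by (auto simp: D_def dist_norm norm_minus_commute)
    then show 1: "s \<in> \<Phi> ` V1" and "\<Psi> s \<in> leaf"
      using \<sigma> \<sigma>' in_leaf by (auto simp: subset_iff dist_norm norm_minus_commute)
    show "\<Psi> s \<in> V1 \<inter> T" using 1 \<open>s \<in> S\<close> by (rule \<Psi>T)
  qed
  have gf: "\<Psi> s = graph (f s)" if "s \<in> D" for s
    unfolding f_def by (rule leaf_eq_graph[OF D(2)[OF that]])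
  have op: "openin (top_of_set H) (f ` D)"
  proof (rule invariance_of_domain_subspaces[OF _ slice(5) H dim])
    show "openin (top_of_set S) D" unfolding D_def by (simp add: openin_open_Int)
    have "continuous_on D \<Psi>" by (rule continuous_on_subset[OF c\<Psi>]) (use D(1) in blast)
    then show "continuous_on D f" unfolding f_def
      by (intro continuous_on_compose2[OF linear_continuous_on[OF bounded_linear_P]] continuous_intros) auto
    show "f \<in> D \<rightarrow> H" by (auto simp: f_def H_def P_simps(6))
    show "inj_on f D"
    proof (rule inj_onI)
      fix s t assume s: "s \<in> D" and t: "t \<in> D" and "f s = f t"
      then have "\<Psi> s = \<Psi> t" using gf[OF s] gf[OF t] by simp
      then have "\<Phi> (\<Psi> s) = \<Phi> (\<Psi> t)" by simp
      then show "s = t" unfolding \<Phi>\<Psi>(1)[OF D(1)[OF s]] \<Phi>\<Psi>(1)[OF D(1)[OF t]] .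
    qed
  qed
  have "f s0 = 0" using \<Psi>\<Phi>[OF V1(2)] by (simp add: f_def s0_def P_simps)
  then have "0 \<in> f ` D" using s0 \<sigma>' by (intro image_eqI[of _ _ s0]) (auto simp: D_def)
  then obtain \<rho> where \<rho>: "\<rho> > 0" "ball 0 \<rho> \<inter> H \<subseteq> f ` D"
    using op unfolding openin_contains_ball by blast
  define W where "W = (V1 \<inter> \<Phi> -` ball s0 \<sigma>') \<inter> {y. norm (P (y - x0)) < \<rho>}"
  have "open {y. norm (P (y - x0)) < \<rho>}"
    by (intro open_Collect_less continuous_intros continuous_on_compose2[OF linear_continuous_on[OF bounded_linear_P]]) auto
  then have "open W" unfolding W_def by (intro open_Int continuous_open_preimage[OF c\<Phi> V1(1)]) auto
  moreover have "x0 \<in> W" using V1(2) \<sigma>' \<rho> by (simp add: W_def s0_def P_simps)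
  moreover have "T \<inter> W = leaf \<inter> W"
  proof (intro equalityI subsetI)
    fix y assume y: "y \<in> T \<inter> W"
    then have "y \<in> V1" "\<Phi> y \<in> S" "norm (\<Phi> y - s0) < \<sigma>'"
      using slice(6) by (auto simp: W_def dist_norm norm_minus_commute)
    then have "y \<in> leaf" using in_leaf[of "\<Phi> y"] \<Psi>\<Phi> by simp
    then show "y \<in> leaf \<inter> W" using y by simp
  next
    fix y assume y: "y \<in> leaf \<inter> W"
    then have "P (y - x0) \<in> ball 0 \<rho> \<inter> H" by (simp add: W_def H_def P_simps(6))
    then obtain s where s: "s \<in> D" "P (y - x0) = f s" using \<rho>(2) by blast
    then have "\<Psi> s = y" using gf[OF s(1)] leaf_eq_graph[of y] y by simp
    then show "y \<in> T \<inter> W" using D(3)[OF s(1)] y by auto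
  qed
  ultimately show ?thesis by blast
qed

section \<open>Integral manifolds of the distribution\<close>

lemma curve_tangent:
  assumes A: "smooth_atlas A" "c \<in> A" and \<epsilon>: "0 < \<epsilon>"
    and \<beta>: "\<beta> ` {-\<epsilon><..<\<epsilon>} \<subseteq> cmap c ` (N \<inter> cdom c)" "C_k_on 1 {-\<epsilon><..<\<epsilon>} \<beta>"
      "(\<beta> has_vector_derivative w) (at (0::real))"
  obtains v where "v \<in> submanifold_tangent A N (cinv c (\<beta> 0))" "v c = w"
proof -
  define \<gamma> where "\<gamma> = cinv c \<circ> \<beta>"
  have \<gamma>: "\<gamma> s \<in> N \<inter> cdom c \<and> cmap c (\<gamma> s) = \<beta> s" if s: "s \<in> {-\<epsilon><..<\<epsilon>}" for s
  proof -
    obtain q where "q \<in> N \<inter> cdom c" "\<beta> s = cmap c q" using \<beta>(1) s by blast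
    then show ?thesis using cinv_cmap[OF A, of q] by (simp add: \<gamma>_def)
  qed
  have z: "0 \<in> {-\<epsilon><..<\<epsilon>}" using \<epsilon> by simp
  have p: "cinv c (\<beta> 0) \<in> cdom c" using \<gamma>[OF z] by (simp add: \<gamma>_def)
  obtain v where v: "v \<in> tangent_space A (cinv c (\<beta> 0))" "v c = w"
    using tangent_vector_exists[OF A p] by blast
  have "((cmap c \<circ> \<gamma>) has_vector_derivative v c) (at 0)"
    unfolding v(2)
    by (rule has_vector_derivative_transform_within_open[OF \<beta>(3) _ z]) (use \<gamma> in \<open>simp_all\<close>)
  moreover have "C_k_on 1 {-\<epsilon><..<\<epsilon>} (cmap c \<circ> \<gamma>)"
    by (rule C_1_on_cong[OF _ \<beta>(2)]) (use \<gamma> in simp_all)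
  moreover have "\<gamma> ` {-\<epsilon><..<\<epsilon>} \<subseteq> N \<inter> cdom c" using \<gamma> by blast
  moreover have "\<gamma> 0 = cinv c (\<beta> 0)" by (simp add: \<gamma>_def)
  ultimately have "v \<in> submanifold_tangent A N (cinv c (\<beta> 0))"
    unfolding submanifold_tangent_def using v(1) A(2) \<epsilon> by blast
  then show thesis using v(2) that by blast
qed

text \<open>
  The slope of the graph is that of the kernel of \<open>\<eta>\<close>, so velocities of curves in the leaf are exactly the
  vectors in the distribution.
\<close>
lemma (in leaf_graph) leaf_integral_manifold:
  fixes A :: "('m::{t2_space,second_countable_topology}, 'e) chart set"
  assumes A: "smooth_atlas A" "c \<in> A" and V: "open V" "V \<subseteq> cimg c"
    and \<Delta>: "\<And>q. q \<in> carrier_of A \<Longrightarrow> \<Delta> q \<subseteq> tangent_space A q"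
    and \<eta>: "defining_form \<Delta> c V \<eta>"
    and graphV: "\<And>h. norm h < r \<Longrightarrow> graph h \<in> V"
    and U': "\<And>h. norm h < r \<Longrightarrow> \<eta> (graph h) e \<noteq> 0" "\<And>h. norm h < r \<Longrightarrow> U' h = slope (\<eta> (graph h)) e"
  shows "integral_manifold A \<Delta> (cinv c ` leaf)"
proof -
  define N where "N = cinv c ` leaf"
  have LV: "leaf \<subseteq> V"
  proof
    fix y assume y: "y \<in> leaf"
    then have "norm (P (y - x0)) < r" by (simp add: leaf_def)
    then show "y \<in> V" using graphV leaf_eq_graph[OF y] by metis
  qed
  have leafc: "cinv c y \<in> cdom c" "cmap c (cinv c y) = y" if "y \<in> leaf" for y
    using cmap_cinv[OF A, of y] LV V that by auto
  have N: "q \<in> cdom c \<and> cmap c q \<in> leaf \<and> cinv c (cmap c q) = q" if "q \<in> N" for q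
    using that leafc by (auto simp: N_def)
  have img: "cmap c ` (N \<inter> cdom c) = leaf"
    using N leafc unfolding N_def by force
  have ker: "\<eta> y w = 0 \<longleftrightarrow> w = P w + U' (P (y - x0)) (P w) *\<^sub>R e" if y: "y \<in> leaf" for y w
  proof -
    define h where "h = P (y - x0)"
    have h: "norm h < r" "graph h = y" using y leaf_eq_graph[OF y] by (simp_all add: h_def leaf_def)
    have "\<eta> y w = 0 \<longleftrightarrow> \<eta> y (P w + a w *\<^sub>R e) = 0" using P_decompose[of w] by simp
    also have "\<dots> \<longleftrightarrow> a w = U' h (P w)" using U'(1)[OF h(1)] h by (simp add: slope_kernel_iff U'(2)[OF h(1)])
    also have "\<dots> \<longleftrightarrow> w = P w + U' h (P w) *\<^sub>R e"
    proof
      assume "w = P w + U' h (P w) *\<^sub>R e"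
      then have "a w = a (P w + U' h (P w) *\<^sub>R e)" by simp
      then show "a w = U' h (P w)" by (simp add: blinfun.bilinear_simps P_simps(6) ae)
    qed (metis P_decompose)
    finally show ?thesis by (simp add: h_def)
  qed
  have carrier: "q \<in> carrier_of A" if "q \<in> N" for q
    using N[OF that] A(2) by (auto simp: carrier_of_def)
  have form: "v \<in> \<Delta> q \<longleftrightarrow> \<eta> (cmap c q) (v c) = 0" if q: "q \<in> N" and v: "v \<in> tangent_space A q" for q v
  proof -
    have "cmap c q \<in> V" using N[OF q] LV by blast
    then have "in_chart c (\<Delta> q) = {u. \<eta> (cmap c q) u = 0}"
      using \<eta> N[OF q] unfolding defining_form_def by (metis (no_types))
    then show ?thesis using in_chart_iff[OF A _ \<Delta>[OF carrier[OF q]] v] N[OF q] by simp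
  qed
  have "C1_submanifold A N"
    unfolding C1_submanifold_def
  proof (intro conjI ballI)
    show "N \<subseteq> carrier_of A" using carrier by blast
    fix q assume q: "q \<in> N"
    let ?V = "{y \<in> V. norm (P (y - x0)) < r}"
    have lc: "local_chart A q c ?V"
      using A(2) N[OF q] leaf_slice(1)[OF V(1)] V(2) LV by (auto simp: local_chart_def leaf_def)
    show "\<exists>c V \<Phi> \<Psi> S. local_chart A q c V \<and>
        open (\<Phi> ` V) \<and> homeomorphism V (\<Phi> ` V) \<Phi> \<Psi> \<and> C_k_on 1 V \<Phi> \<and> C_k_on 1 (\<Phi> ` V) \<Psi> \<and>
        subspace (S :: 'e set) \<and> \<Phi> ` (V \<inter> cmap c ` (N \<inter> cdom c)) = \<Phi> ` V \<inter> S"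
    proof (rule exI[of _ c], rule exI[of _ ?V], rule exI[of _ straighten], rule exI[of _ bend],
        rule exI[of _ "{h. a h = 0}"], intro conjI)
      show "straighten ` (?V \<inter> cmap c ` (N \<inter> cdom c)) = straighten ` ?V \<inter> {h. a h = 0}"
        unfolding img by (rule leaf_slice(7)[OF V(1)])
    qed (rule lc leaf_slice(2-6)[OF V(1)])+
  qed
  moreover have "submanifold_tangent A N q = \<Delta> q" if q: "q \<in> N" for q
  proof (intro equalityI subsetI)
    fix v assume v: "v \<in> submanifold_tangent A N q"
    obtain \<gamma> \<epsilon> where \<gamma>: "\<epsilon> > 0" "\<gamma> ` {-\<epsilon><..<\<epsilon>} \<subseteq> N \<inter> cdom c" "\<gamma> (0::real) = q"
      "((cmap c \<circ> \<gamma>) has_vector_derivative v c) (at 0)"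
      using submanifold_tangent_velocity[OF A _ v] N[OF q] by blast
    have "v c = P (v c) + U' (P ((cmap c \<circ> \<gamma>) 0 - x0)) (P (v c)) *\<^sub>R e"
    proof (rule leaf_velocity[OF \<gamma>(1) _ \<gamma>(4)])
      fix s :: real assume "\<bar>s\<bar> < \<epsilon>"
      then have "\<gamma> s \<in> N" using \<gamma>(2) by (simp add: image_subset_iff abs_less_iff)
      then show "(cmap c \<circ> \<gamma>) s \<in> leaf" using N by simp
    qed
    then have "\<eta> (cmap c q) (v c) = 0" using ker[of "cmap c q" "v c"] N[OF q] \<gamma>(3) by simp
    moreover have "v \<in> tangent_space A q" using v by (simp add: submanifold_tangent_def)
    ultimately show "v \<in> \<Delta> q" using form[OF q] by simp
  next
    fix v assume v: "v \<in> \<Delta> q"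
    then have vt: "v \<in> tangent_space A q" using \<Delta>[OF carrier[OF q]] by blast
    have y: "cmap c q \<in> leaf" using N[OF q] by simp
    have "v c = P (v c) + U' (P (cmap c q - x0)) (P (v c)) *\<^sub>R e"
      using form[OF q vt] v ker[OF y] by simp
    from leaf_curve[OF y this] obtain \<beta> \<epsilon> where \<beta>: "\<epsilon> > 0" "\<beta> ` {-\<epsilon><..<\<epsilon>} \<subseteq> leaf" "\<beta> 0 = cmap c q"
      "C_k_on 1 {-\<epsilon><..<\<epsilon>} \<beta>" "(\<beta> has_vector_derivative v c) (at (0::real))" .
    obtain w where w: "w \<in> submanifold_tangent A N (cinv c (\<beta> 0))" "w c = v c"
      using curve_tangent[OF A \<beta>(1) _ \<beta>(4,5), of N] \<beta>(2) unfolding img by blast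
    have wq: "w \<in> submanifold_tangent A N q" using w(1) \<beta>(3) N[OF q] by simp
    then have "w \<in> tangent_space A q" by (simp add: submanifold_tangent_def)
    then have "w = v" using tangent_vector_unique[OF _ vt A(2)] w(2) N[OF q] by blast
    then show "v \<in> submanifold_tangent A N q" using wq by simp
  qed
  ultimately show ?thesis by (simp add: integral_manifold_def N_def)
qed

text \<open>
  A slice chart may be expressed in any chart of the atlas and shrunk into any neighbourhood, so that two
  submanifolds can be compared in common coordinates.
\<close>
lemma slice_chart_transfer:
  fixes A :: "('m::{t2_space,second_countable_topology}, 'e::euclidean_space) chart set"
  assumes A: "smooth_atlas A" "c \<in> A" and N: "C1_submanifold A N" and p: "p \<in> N" "p \<in> cdom c"
    and W: "open W" "cmap c p \<in> W"
  obtains V \<Phi> \<Psi> S where "open V" "cmap c p \<in> V" "V \<subseteq> W" "open (\<Phi> ` V)" "homeomorphism V (\<Phi> ` V) \<Phi> \<Psi>"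
    "C_k_on 1 V \<Phi>" "C_k_on 1 (\<Phi> ` V) \<Psi>" "subspace (S :: 'e set)"
    "\<Phi> ` (V \<inter> cmap c ` (N \<inter> cdom c)) = \<Phi> ` V \<inter> S"
proof -
  obtain c' V' \<Phi>' \<Psi>' S where lc: "local_chart A p c' V'"
    and sl: "open (\<Phi>' ` V')" "homeomorphism V' (\<Phi>' ` V') \<Phi>' \<Psi>'" "C_k_on 1 V' \<Phi>'" "C_k_on 1 (\<Phi>' ` V') \<Psi>'"
      "subspace S" "\<Phi>' ` (V' \<inter> cmap c' ` (N \<inter> cdom c')) = \<Phi>' ` V' \<inter> (S :: 'e set)"
    using N p(1) unfolding C1_submanifold_def by blast
  have c': "c' \<in> A" "p \<in> cdom c'" "open V'" "V' \<subseteq> cimg c'" "cmap c' p \<in> V'"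
    using lc by (auto simp: local_chart_def)
  define U where "U = (cdom c \<inter> cmap c -` W) \<inter> (cdom c' \<inter> cmap c' -` V')"
  have U: "open U" "p \<in> U" "U \<subseteq> cdom c" "U \<subseteq> cdom c'"
    unfolding U_def using open_chart_preimage[OF A W(1)] open_chart_preimage[OF A(1) c'(1,3)] p W c' by auto
  define V where "V = cmap c ` U"
  define V2 where "V2 = cmap c' ` U"
  define \<tau> where "\<tau> = cmap c' \<circ> cinv c"
  define \<tau>' where "\<tau>' = cmap c \<circ> cinv c'"
  have V: "open V" unfolding V_def by (rule open_chart_image[OF A U(1,3)])
  have V2: "open V2" "V2 \<subseteq> V'" unfolding V2_def
    using open_chart_image[OF A(1) c'(1) U(1,4)] by (auto simp: U_def)
  have \<tau>U: "\<tau> (cmap c q) = cmap c' q" "\<tau>' (cmap c' q) = cmap c q" if "q \<in> U" for q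
    using cinv_cmap[OF A, of q] cinv_cmap[OF A(1) c'(1), of q] U that by (auto simp: \<tau>_def \<tau>'_def)
  have \<tau>V: "\<tau> ` V = V2" "\<tau>' ` V2 = V" 
    by (simp_all add: V_def V2_def image_image \<tau>U cong: image_cong)
  have inv: "\<tau>' (\<tau> y) = y" if "y \<in> V" for y
  proof -
    from that obtain q where "q \<in> U" "y = cmap c q" unfolding V_def by blast
    then show ?thesis using \<tau>U[of q] by simp
  qed
  have "cmap c ` U \<subseteq> cmap c ` (cdom c \<inter> cdom c')" "cmap c' ` U \<subseteq> cmap c' ` (cdom c' \<inter> cdom c)"
    by (rule image_mono; use U(3,4) in simp)+
  note C1\<tau> = C_1_on_subset[OF transition_C1(2)[OF A c'(1)] this(1), folded V_def \<tau>_def]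
    C_1_on_subset[OF transition_C1(2)[OF A(1) c'(1) A(2)] this(2), folded V2_def \<tau>'_def]
  have c1: "continuous_on X f" if "C_k_on 1 X f" for X and f :: "'e \<Rightarrow> 'e"
    using that by (intro differentiable_imp_continuous_on) (auto simp: differentiable_on_def intro: differentiable_at_withinI)
  have \<Psi>\<Phi>: "\<Psi>' (\<Phi>' y) = y" if "y \<in> V'" for y using homeomorphism_apply1[OF sl(2) that] .
  define \<Phi> where "\<Phi> = \<Phi>' \<circ> \<tau>"
  define \<Psi> where "\<Psi> = \<tau>' \<circ> \<Psi>'"
  have \<Phi>V: "\<Phi> ` V = \<Phi>' ` V2" unfolding \<Phi>_def image_comp[symmetric] \<tau>V ..
  have o\<Phi>: "open (\<Phi> ` V)"
  proof -
    have "\<Phi>' ` V2 = \<Phi>' ` V' \<inter> \<Psi>' -` V2"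
    proof (intro equalityI subsetI)
      fix s assume "s \<in> \<Phi>' ` V2"
      then obtain y where "y \<in> V2" "s = \<Phi>' y" by blast
      then show "s \<in> \<Phi>' ` V' \<inter> \<Psi>' -` V2" using V2(2) \<Psi>\<Phi>[of y] by auto
    next
      fix s assume "s \<in> \<Phi>' ` V' \<inter> \<Psi>' -` V2"
      then obtain y where "y \<in> V'" "s = \<Phi>' y" "\<Psi>' s \<in> V2" by blast
      then show "s \<in> \<Phi>' ` V2" using \<Psi>\<Phi>[of y] by auto
    qed
    moreover have "continuous_on (\<Phi>' ` V') \<Psi>'" using sl(2) by (simp add: homeomorphism_def)
    ultimately show ?thesis unfolding \<Phi>V using continuous_open_preimage[OF _ sl(1) V2(1)] by simp
  qed
  have C\<Phi>: "C_k_on 1 V \<Phi>"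
    unfolding \<Phi>_def by (rule C_1_on_compose[OF V c'(3) C1\<tau>(1) sl(3)]) (use \<tau>V V2 in simp)
  have \<Psi>im: "\<Psi>' ` (\<Phi> ` V) = V2" 
  proof -
    have "\<Psi>' (\<Phi>' y) = y" if "y \<in> V2" for y using \<Psi>\<Phi>[of y] V2(2) that by blast
    then show ?thesis unfolding \<Phi>V by (simp add: image_image cong: image_cong)
  qed
  have C\<Psi>: "C_k_on 1 (\<Phi> ` V) \<Psi>"
    unfolding \<Psi>_def
    by (rule C_1_on_compose[OF o\<Phi> V2(1) C_1_on_subset[OF sl(4)] C1\<tau>(2)]) (use \<Psi>im \<Phi>V V2 in auto)
  have hom: "homeomorphism V (\<Phi> ` V) \<Phi> \<Psi>"
  proof -
    have 1: "\<Psi> (\<Phi> y) = y" if "y \<in> V" for y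
    proof -
      have "\<tau> y \<in> V'" using that \<tau>V(1) V2(2) by blast
      then show ?thesis using \<Psi>\<Phi> inv[OF that] by (simp add: \<Psi>_def \<Phi>_def)
    qed
    then show ?thesis
      using c1[OF C\<Phi>] c1[OF C\<Psi>] by (auto simp: homeomorphism_def image_image)
  qed
  have "\<Phi> ` (V \<inter> cmap c ` (N \<inter> cdom c)) = \<Phi> ` V \<inter> S"
  proof -
    have 1: "\<Phi> ` (V \<inter> cmap c ` (N \<inter> cdom c)) = \<Phi>' ` (V2 \<inter> cmap c' ` (N \<inter> cdom c'))"
    proof -
      have cut: "cmap f ` U \<inter> cmap f ` (N \<inter> cdom f) = cmap f ` (U \<inter> N)"
        if "smooth_atlas A" "f \<in> A" "U \<subseteq> cdom f" for f
      proof -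
        have "inj_on (cmap f) (cdom f)" using cinv_cmap[OF that(1,2)] by (intro inj_on_inverseI)
        then have "cmap f ` (U \<inter> (N \<inter> cdom f)) = cmap f ` U \<inter> cmap f ` (N \<inter> cdom f)"
          using that(3) by (intro inj_on_image_Int[of _ "cdom f"]) auto
        moreover have "U \<inter> (N \<inter> cdom f) = U \<inter> N" using that(3) by blast
        ultimately show ?thesis by simp
      qed
      have "V \<inter> cmap c ` (N \<inter> cdom c) = cmap c ` (U \<inter> N)"
        unfolding V_def by (rule cut[OF A U(3)])
      moreover have "V2 \<inter> cmap c' ` (N \<inter> cdom c') = cmap c' ` (U \<inter> N)"
        unfolding V2_def by (rule cut[OF A(1) c'(1) U(4)])
      moreover have "\<Phi> ` cmap c ` (U \<inter> N) = \<Phi>' ` cmap c' ` (U \<inter> N)"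
        by (simp add: image_image \<Phi>_def \<tau>U)
      ultimately show ?thesis by simp
    qed
    have "\<Phi>' ` (V2 \<inter> X) = \<Phi>' ` V2 \<inter> \<Phi>' ` (V' \<inter> X)" for X
    proof -
      have "inj_on \<Phi>' V'" using \<Psi>\<Phi> by (rule inj_on_inverseI)
      then have "\<Phi>' ` (V2 \<inter> (V' \<inter> X)) = \<Phi>' ` V2 \<inter> \<Phi>' ` (V' \<inter> X)"
        using V2(2) by (intro inj_on_image_Int[of _ V']) auto
      moreover have "V2 \<inter> (V' \<inter> X) = V2 \<inter> X" using V2(2) by blast
      ultimately show ?thesis by simp
    qed
    then have "\<Phi>' ` (V2 \<inter> cmap c' ` (N \<inter> cdom c')) = \<Phi>' ` V2 \<inter> (\<Phi>' ` V' \<inter> S)" using sl(6) by simp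
    also have "\<dots> = \<Phi> ` V \<inter> S" using V2(2) \<Phi>V by blast
    finally show ?thesis using 1 by simp
  qed
  moreover have "cmap c p \<in> V" "V \<subseteq> W" using U(2) by (auto simp: V_def U_def)
  ultimately show thesis using that[OF V _ _ o\<Phi> hom C\<Phi> C\<Psi> sl(5)] by blast
qed

text \<open>
  The existence of a leaf together with the bounds on the approximating forms on one common ball, as needed
  both for existence and for uniqueness.
\<close>
lemma local_leaf_exists:
  fixes A :: "('m::{t2_space,second_countable_topology}, 'e::euclidean_space) chart set"
  assumes M: "riemannian_manifold A g" and lc: "local_chart A p c V"
    and \<eta>: "defining_form \<Delta> c V \<eta>" and inv: "involutive_approximation A g c V \<eta> \<eta>s"
    and x0_def: "x0 = cmap c p"
    and \<delta>_def: "\<delta> = (\<lambda>k. C0_norm V (norm_1 A g c (\<lambda>x. \<eta>s k x - \<eta> x)))"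
    and d_def: "d = (\<lambda>k. C0_norm V (norm_2 A g c (ext_deriv (\<eta>s k))))"
  obtains R C e B r u where "0 < R" "0 \<le> C" "cball x0 R \<subseteq> V" "\<And>k. 0 \<le> d k"
    "\<And>y. y \<in> cball x0 R \<Longrightarrow> \<eta> y e \<ge> 3/4" "\<And>y. y \<in> cball x0 R \<Longrightarrow> norm (\<eta> y) \<le> B"
    "\<And>k y. y \<in> cball x0 R \<Longrightarrow> norm (\<eta>s k y - \<eta> y) \<le> C * \<delta> k"
    "\<And>k y u v. y \<in> cball x0 R \<Longrightarrow> \<bar>ext_deriv (\<eta>s k) y u v\<bar> \<le> C * d k * norm u * norm v"
    "\<And>h. norm h < r \<Longrightarrow> x0 + h + u h *\<^sub>R e \<in> cball x0 R"
    "leaf_graph (\<eta> x0) e r u (\<lambda>h. slope (\<eta> (x0 + h + u h *\<^sub>R e)) e)"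
proof -
  define \<rho> where "\<rho> k = C0_norm V (norm_3 A g c (wedge_1_2 (\<eta>s k) (ext_deriv (\<eta>s k))))" for k
  have V: "open V" "x0 \<in> V" using lc by (auto simp: local_chart_def x0_def)
  have c\<eta>: "continuous_on V \<eta>" and \<eta>0: "\<eta> x0 \<noteq> 0" using \<eta> V by (auto simp: defining_form_def)
  have invk: "\<And>k. C_k_on 1 V (\<eta>s k)" "\<delta> \<longlonglongrightarrow> 0" "(\<lambda>k. \<rho> k * exp (d k)) \<longlonglongrightarrow> 0"
    using inv unfolding involutive_approximation_def \<delta>_def d_def \<rho>_def by blast+
  obtain R1 C where RC: "R1 > 0" "C > 0" "cball x0 R1 \<subseteq> V" "\<And>k. 0 \<le> d k" "\<And>k. 0 \<le> \<rho> k"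
    "\<And>k y. y \<in> cball x0 R1 \<Longrightarrow> norm (\<eta>s k y - \<eta> y) \<le> C * \<delta> k"
    "\<And>k y u v. y \<in> cball x0 R1 \<Longrightarrow> \<bar>ext_deriv (\<eta>s k) y u v\<bar> \<le> C * d k * norm u * norm v"
    "\<And>k y u v w. y \<in> cball x0 R1 \<Longrightarrow>
      \<bar>wedge_1_2 (\<eta>s k) (ext_deriv (\<eta>s k)) y u v w\<bar> \<le> C * \<rho> k * norm u * norm v * norm w"
    using involutive_approximation_bounds[OF M lc inv] unfolding x0_def \<delta>_def d_def \<rho>_def by blast
  obtain z where z: "\<eta> x0 z \<noteq> 0" using \<eta>0 by (metis blinfun_eqI zero_blinfun.rep_eq)
  define e where "e = (1 / \<eta> x0 z) *\<^sub>R z"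
  have e: "\<eta> x0 e = 1" using z by (simp add: e_def blinfun.scaleR_right)
  define \<beta> where "\<beta> = 1 / (4 * (norm e + 1))"
  have \<beta>: "\<beta> > 0" "\<beta> * norm e \<le> 1/4" by (auto simp: \<beta>_def field_simps add_pos_nonneg add_nonneg_pos)
  have "isCont \<eta> x0" using c\<eta> V by (simp add: continuous_on_eq_continuous_at)
  then obtain R2 where R2: "R2 > 0" "\<And>y. dist y x0 < R2 \<Longrightarrow> dist (\<eta> y) (\<eta> x0) < \<beta>"
    unfolding continuous_at_eps_delta using \<beta>(1) by meson
  define R where "R = min R1 (R2 / 2)"
  have R: "0 < R" "cball x0 R \<subseteq> cball x0 R1" using RC(1) R2(1) by (auto simp: R_def)
  have near: "norm (\<eta> y - \<eta> x0) \<le> \<beta>" if "y \<in> cball x0 R" for y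
  proof -
    have "dist y x0 < R2" using that R2(1) by (auto simp: R_def dist_commute)
    then show ?thesis using R2(2)[of y] by (simp add: dist_norm)
  qed
  have \<eta>e: "\<eta> y e \<ge> 3/4" if "y \<in> cball x0 R" for y
  proof -
    have "\<bar>(\<eta> y - \<eta> x0) e\<bar> \<le> norm (\<eta> y - \<eta> x0) * norm e" using norm_blinfun[of "\<eta> y - \<eta> x0" e] by simp
    also have "\<dots> \<le> \<beta> * norm e" using near[OF that] by (intro mult_right_mono) auto
    finally have "\<bar>\<eta> y e - 1\<bar> \<le> 1/4" using \<beta>(2) e by (simp add: blinfun.diff_left)
    then show ?thesis by linarith
  qed
  have B: "norm (\<eta> y) \<le> norm (\<eta> x0) + \<beta>" if "y \<in> cball x0 R" for y
    using near[OF that] norm_triangle_ineq[of "\<eta> y - \<eta> x0" "\<eta> x0"] by simp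
  have \<delta>C: "(\<lambda>k. C * \<delta> k) \<longlonglongrightarrow> 0" using tendsto_mult_right_zero[OF invk(2), of C] .
  have bounds: "norm (\<eta>s k y - \<eta> y) \<le> C * \<delta> k"
    "\<bar>ext_deriv (\<eta>s k) y u v\<bar> \<le> C * d k * norm u * norm v"
    "\<bar>wedge_1_2 (\<eta>s k) (ext_deriv (\<eta>s k)) y u v w\<bar> \<le> C * \<rho> k * norm u * norm v * norm w"
    if "y \<in> cball x0 R" for k y u v w using that R(2) RC(6,7,8) by blast+
  have RV: "cball x0 R \<subseteq> V" using R(2) RC(3) by blast
  have C0: "0 \<le> C" using RC(2) by simp
  obtain r u where r: "r > 0" and u: "u 0 = 0" "\<And>x. norm x \<le> r \<Longrightarrow> x0 + x + u x *\<^sub>R e \<in> cball x0 R"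
    "\<And>x. norm x \<le> r \<Longrightarrow> \<eta> (x0 + x + u x *\<^sub>R e) e \<ge> 1/2"
    "\<And>x. norm x \<le> r \<Longrightarrow> (u has_derivative slope (\<eta> (x0 + x + u x *\<^sub>R e)) e) (at x within cball 0 r)"
    using leaf_exists[OF V(1) RV R(1) c\<eta> e invk(1) bounds(1) \<delta>C bounds(2,3) C0 RC(4,5) invk(3)] by blast
  have du: "(u has_derivative slope (\<eta> (x0 + x + u x *\<^sub>R e)) e) (at x)" if "norm x < r" for x
    using u(4)[of x] that at_within_interior[of x "cball 0 r"] by simp
  have cu: "continuous_on (ball 0 r) u"
    by (rule has_derivative_continuous_on[OF has_derivative_at_withinI[OF du]]) simp
  have "continuous_on (ball 0 r) (\<lambda>x. \<eta> (x0 + x + u x *\<^sub>R e))"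
    by (rule continuous_on_compose2[OF c\<eta>]) (use u(2) RV in \<open>auto intro!: continuous_intros cu\<close>)
  then have "continuous_on (ball 0 r) (\<lambda>x. slope (\<eta> (x0 + x + u x *\<^sub>R e)) e)"
    unfolding slope_def
  proof (intro continuous_intros ballI)
    fix x :: 'e assume "x \<in> ball 0 r"
    then show "\<eta> (x0 + x + u x *\<^sub>R e) e \<noteq> 0" using u(3)[of x] by auto
  qed
  then have "leaf_graph (\<eta> x0) e r u (\<lambda>h. slope (\<eta> (x0 + h + u h *\<^sub>R e)) e)"
    using e r u(1) du by unfold_locales auto
  moreover have "x0 + h + u h *\<^sub>R e \<in> cball x0 R" if "norm h < r" for h
    using u(2) that by simp
  ultimately show thesis
    by (intro that[OF R(1) C0 RV RC(4) \<eta>e B bounds(1,2)])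
qed

lemma asymptotically_involutive_imp_integrable:
  fixes A :: "('m::{t2_space,second_countable_topology}, 'e::euclidean_space) chart set"
  assumes M: "riemannian_manifold A g" and \<Delta>: "continuous_corank1_distribution A \<Delta>"
    and inv: "asymptotically_involutive A g \<Delta>"
  shows "integrable_distribution A \<Delta>"
  unfolding integrable_distribution_def
proof
  fix p assume p: "p \<in> carrier_of A"
  obtain c V \<eta> \<eta>s where lc: "local_chart A p c V" and \<eta>: "defining_form \<Delta> c V \<eta>"
    and ia: "involutive_approximation A g c V \<eta> \<eta>s"
    using inv p unfolding asymptotically_involutive_def by blast
  have A: "smooth_atlas A" "c \<in> A" "p \<in> cdom c" and V: "open V" "V \<subseteq> cimg c"
    using M lc by (auto simp: riemannian_manifold_def local_chart_def)
  have sub: "\<Delta> q \<subseteq> tangent_space A q" if "q \<in> carrier_of A" for q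
    using \<Delta> that unfolding continuous_corank1_distribution_def distribution_def by blast
  define x0 where "x0 = cmap c p"
  obtain R C e B r u where "0 < R" "0 \<le> C" and RV: "cball x0 R \<subseteq> V"
    "\<And>k. 0 \<le> C0_norm V (norm_2 A g c (ext_deriv (\<eta>s k)))"
    and \<eta>e: "\<And>y. y \<in> cball x0 R \<Longrightarrow> \<eta> y e \<ge> 3/4"
    "\<And>y. y \<in> cball x0 R \<Longrightarrow> norm (\<eta> y) \<le> B"
    "\<And>k y. y \<in> cball x0 R \<Longrightarrow> norm (\<eta>s k y - \<eta> y) \<le> C * C0_norm V (norm_1 A g c (\<lambda>x. \<eta>s k x - \<eta> x))"
    "\<And>k y u v. y \<in> cball x0 R \<Longrightarrow>
      \<bar>ext_deriv (\<eta>s k) y u v\<bar> \<le> C * C0_norm V (norm_2 A g c (ext_deriv (\<eta>s k))) * norm u * norm v"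
    and gK: "\<And>h. norm h < r \<Longrightarrow> x0 + h + u h *\<^sub>R e \<in> cball x0 R"
    and lg: "leaf_graph (\<eta> x0) e r u (\<lambda>h. slope (\<eta> (x0 + h + u h *\<^sub>R e)) e)"
    by (rule local_leaf_exists[OF M lc \<eta> ia x0_def refl refl], rule that)
  interpret L: leaf_graph "\<eta> x0" e x0 r u "\<lambda>h. slope (\<eta> (x0 + h + u h *\<^sub>R e)) e"
    by (rule lg)
  have "integral_manifold A \<Delta> (cinv c ` L.leaf)"
  proof (rule L.leaf_integral_manifold[OF A(1,2) V sub \<eta>])
    fix h :: 'e assume h: "norm h < r"
    show "L.graph h \<in> V" using gK[OF h] RV(1) by (auto simp: L.graph_def)
    show "\<eta> (L.graph h) e \<noteq> 0" using \<eta>e(1)[OF gK[OF h]] by (auto simp: L.graph_def)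
    show "slope (\<eta> (x0 + h + u h *\<^sub>R e)) e = slope (\<eta> (L.graph h)) e" by (simp add: L.graph_def)
  qed
  moreover have "p \<in> cinv c ` L.leaf"
    using L.base_in_leaf cinv_cmap[OF A] by (intro image_eqI[of _ _ x0]) (simp_all add: x0_def)
  ultimately show "\<exists>N. p \<in> N \<and> integral_manifold A \<Delta> N" by blast
qed

text \<open>
  All integral manifolds through \<open>p\<close> are compared with one and the same set, the leaf constructed from the
  approximation.
\<close>
lemma uniform_approximation_local_uniqueness:
  fixes A :: "('m::{t2_space,second_countable_topology}, 'e::euclidean_space) chart set"
  assumes M: "riemannian_manifold A g" and lc: "local_chart A p c V" and \<eta>: "defining_form \<Delta> c V \<eta>"
    and ia: "involutive_approximation A g c V \<eta> \<eta>s"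
    and unif: "(\<lambda>k. C0_norm V (norm_1 A g c (\<lambda>x. \<eta>s k x - \<eta> x)) *
              exp (C0_norm V (norm_2 A g c (ext_deriv (\<eta>s k))))) \<longlonglongrightarrow> 0"
  obtains Nl where "\<And>N. integral_manifold A \<Delta> N \<Longrightarrow> p \<in> N \<Longrightarrow> \<exists>W. open W \<and> p \<in> W \<and> N \<inter> W = Nl \<inter> W"
proof -
  define x0 where "x0 = cmap c p"
  define \<delta> where "\<delta> = (\<lambda>k. C0_norm V (norm_1 A g c (\<lambda>x. \<eta>s k x - \<eta> x)))"
  define d where "d = (\<lambda>k. C0_norm V (norm_2 A g c (ext_deriv (\<eta>s k))))"
  have A: "smooth_atlas A" "c \<in> A" "p \<in> cdom c" and V: "open V" "V \<subseteq> cimg c" "x0 \<in> V"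
    using M lc by (auto simp: riemannian_manifold_def local_chart_def x0_def)
  have px0: "cinv c x0 = p" unfolding x0_def by (rule cinv_cmap[OF A])
  have invk: "\<And>k. C_k_on 1 V (\<eta>s k)" "\<delta> \<longlonglongrightarrow> 0"
    using ia unfolding involutive_approximation_def \<delta>_def by blast+
  have lim: "(\<lambda>k. \<delta> k * exp (d k)) \<longlonglongrightarrow> 0" using unif by (simp add: \<delta>_def d_def)
  have ker: "in_chart c (\<Delta> (cinv c y)) = {u. \<eta> y u = 0}" if "y \<in> V" for y
    using \<eta> that by (simp add: defining_form_def)
  obtain R C e B r u where R: "0 < R" "0 \<le> C" "cball x0 R \<subseteq> V" "\<And>k. 0 \<le> d k"
    and \<eta>e: "\<And>y. y \<in> cball x0 R \<Longrightarrow> \<eta> y e \<ge> 3/4" and B: "\<And>y. y \<in> cball x0 R \<Longrightarrow> norm (\<eta> y) \<le> B"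
    and close: "\<And>k y. y \<in> cball x0 R \<Longrightarrow> norm (\<eta>s k y - \<eta> y) \<le> C * \<delta> k"
    and \<omega>: "\<And>k y u v. y \<in> cball x0 R \<Longrightarrow> \<bar>ext_deriv (\<eta>s k) y u v\<bar> \<le> C * d k * norm u * norm v"
    and gK: "\<And>h. norm h < r \<Longrightarrow> x0 + h + u h *\<^sub>R e \<in> cball x0 R"
    and lg: "leaf_graph (\<eta> x0) e r u (\<lambda>h. slope (\<eta> (x0 + h + u h *\<^sub>R e)) e)"
    by (rule local_leaf_exists[OF M lc \<eta> ia x0_def \<delta>_def d_def], rule that)
  interpret L: leaf_graph "\<eta> x0" e x0 r u "\<lambda>h. slope (\<eta> (x0 + h + u h *\<^sub>R e)) e"
    by (rule lg)
  define O1 where "O1 = {y. norm (L.P (y - x0)) < r} \<inter> ball x0 R"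
  have "open {y. norm (L.P (y - x0)) < r}"
    by (intro open_Collect_less continuous_intros continuous_on_compose2[OF linear_continuous_on[OF L.bounded_linear_P]]) auto
  then have O1: "open O1" "x0 \<in> O1" using L.r R(1) by (auto simp: O1_def L.P_simps)
  show thesis
  proof (rule that[of "cinv c ` L.leaf"])
    fix N assume N: "integral_manifold A \<Delta> N" and p: "p \<in> N"
    define T where "T = cmap c ` (N \<inter> cdom c)"
    have tan: "submanifold_tangent A N q = \<Delta> q" if "q \<in> N" for q
      using N that by (simp add: integral_manifold_def)
    have "C1_submanifold A N" using N by (simp add: integral_manifold_def)
    from slice_chart_transfer[OF A(1,2) this p A(3) O1(1)] O1(2)
    obtain V1 \<Phi> \<Psi> S where V1: "open V1" "x0 \<in> V1" "V1 \<subseteq> O1" and sl: "open (\<Phi> ` V1)" "homeomorphism V1 (\<Phi> ` V1) \<Phi> \<Psi>"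
      "C_k_on 1 V1 \<Phi>" "C_k_on 1 (\<Phi> ` V1) \<Psi>" "subspace (S :: 'e set)" "\<Phi> ` (V1 \<inter> T) = \<Phi> ` V1 \<inter> S"
      unfolding x0_def T_def by metis
    have V1': "V1 \<subseteq> {y \<in> cball x0 R. norm (L.P (y - x0)) < r}" using V1(3) by (auto simp: O1_def)
    have x0T: "x0 \<in> T" using p A(3) by (auto simp: T_def x0_def)
    have "\<exists>W. open W \<and> x0 \<in> W \<and> T \<inter> W = L.leaf \<inter> W"
    proof (rule L.slice_equals_leaf[OF V(1) R(3,1) refl _ _ \<eta>e B invk(1) close invk(2) \<omega> R(2,4) lim V1(1,2) V1' sl x0T])
      fix h :: 'e assume h: "norm h < r"
      show "slope (\<eta> (x0 + h + u h *\<^sub>R e)) e = slope (\<eta> (L.graph h)) e" by (simp add: L.graph_def)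
      show "L.graph h \<in> cball x0 R" using gK[OF h] by (simp add: L.graph_def)
    next
      fix \<beta> :: "real \<Rightarrow> 'e" and \<epsilon> w
      assume \<beta>: "0 < \<epsilon>" "\<beta> ` {-\<epsilon><..<\<epsilon>} \<subseteq> T \<inter> V1" "C_k_on 1 {-\<epsilon><..<\<epsilon>} \<beta>"
        "(\<beta> has_vector_derivative w) (at 0)"
      have "\<beta> 0 \<in> T \<inter> V1" using \<beta>(1,2) by (simp add: image_subset_iff)
      then obtain q where q: "q \<in> N" "q \<in> cdom c" "\<beta> 0 = cmap c q" by (auto simp: T_def)
      have \<beta>V: "\<beta> 0 \<in> V" using \<open>\<beta> 0 \<in> T \<inter> V1\<close> V1' R(3) by blast
      obtain v where v: "v \<in> submanifold_tangent A N (cinv c (\<beta> 0))" "v c = w"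
        using curve_tangent[OF A(1,2) \<beta>(1) _ \<beta>(3,4), of N] \<beta>(2) unfolding T_def by blast
      have "v \<in> \<Delta> (cinv c (\<beta> 0))" using v(1) q cinv_cmap[OF A(1,2) q(2)] tan by simp
      then have "w \<in> in_chart c (\<Delta> (cinv c (\<beta> 0)))" using v(2) by (auto simp: in_chart_def)
      then show "\<eta> (\<beta> 0) w = 0" using ker[OF \<beta>V] by simp
    next
      fix w assume "\<eta> x0 w = 0"
      then have "w \<in> in_chart c (\<Delta> p)" using ker[OF V(3)] px0 by simp
      then obtain v where v: "v \<in> submanifold_tangent A N p" "v c = w"
        using tan[OF p] by (auto simp: in_chart_def)
      obtain \<gamma> \<epsilon> where "\<epsilon> > 0" "\<gamma> ` {-\<epsilon><..<\<epsilon>} \<subseteq> N \<inter> cdom c" "\<gamma> (0::real) = p"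
        "((cmap c \<circ> \<gamma>) has_vector_derivative v c) (at 0)"
        using submanifold_tangent_velocity[OF A v(1)] by blast
      then show "\<exists>\<beta> \<epsilon>. 0 < \<epsilon> \<and> \<beta> ` {-\<epsilon><..<\<epsilon>} \<subseteq> T \<and> \<beta> 0 = x0 \<and> (\<beta> has_vector_derivative w) (at (0::real))"
        using v(2) by (intro exI[of _ "cmap c \<circ> \<gamma>"] exI[of _ \<epsilon>]) (auto simp: T_def x0_def image_subset_iff)
    qed
    then obtain W where W: "open W" "x0 \<in> W" "T \<inter> W = L.leaf \<inter> W" by blast
    have leafc: "cinv c y \<in> cdom c" "cmap c (cinv c y) = y" if "y \<in> L.leaf" for y
    proof -
      have "norm (L.P (y - x0)) < r" using that by (simp add: L.leaf_def)
      from gK[OF this] have "y \<in> cimg c"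
        using L.leaf_eq_graph[OF that] R(3) V(2) by (auto simp: L.graph_def)
      then show "cinv c y \<in> cdom c" "cmap c (cinv c y) = y" using cmap_cinv[OF A(1,2)] by auto
    qed
    have "N \<inter> (cdom c \<inter> cmap c -` W) = cinv c ` L.leaf \<inter> (cdom c \<inter> cmap c -` W)"
    proof (intro equalityI subsetI)
      fix q assume "q \<in> N \<inter> (cdom c \<inter> cmap c -` W)"
      then have q: "q \<in> N" "q \<in> cdom c" "cmap c q \<in> T \<inter> W" by (auto simp: T_def)
      then have "cmap c q \<in> L.leaf" using W(3) by blast
      then show "q \<in> cinv c ` L.leaf \<inter> (cdom c \<inter> cmap c -` W)"
        using q cinv_cmap[OF A(1,2) q(2)] by (auto intro: image_eqI[of q _ "cmap c q"])
    next
      fix q assume q: "q \<in> cinv c ` L.leaf \<inter> (cdom c \<inter> cmap c -` W)"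
      then obtain y where y: "y \<in> L.leaf" "q = cinv c y" by blast
      then have "y \<in> T \<inter> W" using q leafc(2)[OF y(1)] W(3) by auto
      then obtain q' where q': "q' \<in> N" "q' \<in> cdom c" "y = cmap c q'" by (auto simp: T_def)
      then have "q = q'" using y(2) cinv_cmap[OF A(1,2) q'(2)] by simp
      then show "q \<in> N \<inter> (cdom c \<inter> cmap c -` W)" using q q'(1) by blast
    qed
    moreover have "p \<in> cdom c \<inter> cmap c -` W" using A(3) W(2) by (simp add: x0_def)
    ultimately show "\<exists>W. open W \<and> p \<in> W \<and> N \<inter> W = cinv c ` L.leaf \<inter> W"
      using open_chart_preimage[OF A(1,2) W(1)] by blast
  qed
qed

lemma uniformly_asymptotically_involutive_imp_uniquely_integrable:
  fixes A :: "('m::{t2_space,second_countable_topology}, 'e::euclidean_space) chart set"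
  assumes M: "riemannian_manifold A g" and \<Delta>: "continuous_corank1_distribution A \<Delta>"
    and inv: "uniformly_asymptotically_involutive A g \<Delta>"
  shows "uniquely_integrable_distribution A \<Delta>"
  unfolding uniquely_integrable_distribution_def
proof (intro conjI ballI allI impI)
  have "asymptotically_involutive A g \<Delta>"
    using inv unfolding uniformly_asymptotically_involutive_def asymptotically_involutive_def by meson
  then show "integrable_distribution A \<Delta>"
    by (rule asymptotically_involutive_imp_integrable[OF M \<Delta>])
  fix p N\<^sub>1 N\<^sub>2
  assume p: "p \<in> carrier_of A"
    and N: "integral_manifold A \<Delta> N\<^sub>1 \<and> integral_manifold A \<Delta> N\<^sub>2 \<and> p \<in> N\<^sub>1 \<and> p \<in> N\<^sub>2"
  obtain c V \<eta> \<eta>s where data: "local_chart A p c V" "defining_form \<Delta> c V \<eta>" "involutive_approximation A g c V \<eta> \<eta>s"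
    "(\<lambda>k. C0_norm V (norm_1 A g c (\<lambda>x. \<eta>s k x - \<eta> x)) *
              exp (C0_norm V (norm_2 A g c (ext_deriv (\<eta>s k))))) \<longlonglongrightarrow> 0"
    using inv p unfolding uniformly_asymptotically_involutive_def by blast
  obtain Nl where Nl: "\<And>N. integral_manifold A \<Delta> N \<Longrightarrow> p \<in> N \<Longrightarrow> \<exists>W. open W \<and> p \<in> W \<and> N \<inter> W = Nl \<inter> W"
    by (rule uniform_approximation_local_uniqueness[OF M data], rule that)
  obtain W1 where W1: "open W1" "p \<in> W1" "N\<^sub>1 \<inter> W1 = Nl \<inter> W1" using Nl[of N\<^sub>1] N by blast
  obtain W2 where W2: "open W2" "p \<in> W2" "N\<^sub>2 \<inter> W2 = Nl \<inter> W2" using Nl[of N\<^sub>2] N by blast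
  have "N\<^sub>1 \<inter> (W1 \<inter> W2) = N\<^sub>2 \<inter> (W1 \<inter> W2)" using W1(3) W2(3) by blast
  then show "\<exists>W. open W \<and> p \<in> W \<and> N\<^sub>1 \<inter> W = N\<^sub>2 \<inter> W" using W1 W2 by (intro exI[of _ "W1 \<inter> W2"]) auto
qed

theorem theorem1p2:
  fixes A :: "('m::{t2_space,second_countable_topology}, 'e::euclidean_space) chart set"
    and g :: "'m \<Rightarrow> ('m, 'e) tvec \<Rightarrow> ('m, 'e) tvec \<Rightarrow> real"
    and \<Delta> :: "'m \<Rightarrow> ('m, 'e) tvec set"
  assumes "riemannian_manifold A g"
    and "DIM('e) = 2 \<or> DIM('e) = 3"
    and "continuous_corank1_distribution A \<Delta>"
  shows "(asymptotically_involutive A g \<Delta> \<longrightarrow> integrable_distribution A \<Delta>) \<and>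
         (uniformly_asymptotically_involutive A g \<Delta> \<longrightarrow> uniquely_integrable_distribution A \<Delta>)"
  using asymptotically_involutive_imp_integrable[OF assms(1,3)]
    uniformly_asymptotically_involutive_imp_uniquely_integrable[OF assms(1,3)] by blast

end
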